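(* Let $n\ge1$. The images in $R_n=\mathit{QSym}_n/\mathcal{E}_n$ of the quasisymmetric Schur polynomials $\{\mathcal{S}_\beta : \beta\in\mathsf{B}_n\}$ form a basis of the $\mathit{Sym}_n$-module $R_n$. (Since the positive-degree symmetric polynomials act by zero on $R_n$, this means they form a basis of $R_n$ as a $\mathbb{Q}$-vector space.)
   Context: Let $\mathbf{x}=\{x_1,\dots,x_n\}$. A composition is a finite sequence $\alpha=(\alpha_1,\dots,\alpha_k)$ of positive integers; $\bm{l}(\alpha)=k$ is its length; the empty composition (written $0$) is allowed. A polynomial $f\in\mathbb{Q}[\mathbf{x}]$ is quasisymmetric if for every composition $(\alpha_1,\dots,\alpha_k)$ with $k\le n$, the coefficient of $x_1^{\alpha_1}\cdots x_k^{\alpha_k}$ equals that of $x_{i_1}^{\alpha_1}\cdots x_{i_k}^{\alpha_k}$ for all $1\le i_1<\dots<i_k\le n$. $\mathit{QSym}_n$ is the ring of quasisymmetric polynomials in $\mathbf{x}$, $\mathit{Sym}_n$ the ring of symmetric polynomials, $\mathcal{E}_n$ the ideal of $\mathit{QSym}_n$ generated by the symmetric polynomials with zero constant term, and $R_n=\mathit{QSym}_n/\mathcal{E}_n$. The diagram of a composition $\alpha$ has $\alpha_i$ cells in row $i$ (rows numbered from the top, cells $(i,j)$ in matrix notation). A composition tableau of shape $\alpha$ is a filling $T$ of the cells with positive integers such that: (CT1) entries weakly decrease left to right along each row; (CT2) entries of the leftmost column strictly increase from top to bottom; (CT3, triple rule) for any two cells $(i,k)$, $(j,k)$ of the diagram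 with $i<j$: if $\alpha_i\ge\alpha_j$ (and $k\ge2$) then $T(j,k)<T(i,k)$ or $T(i,k-1)<T(j,k)$; if $\alpha_i<\alpha_j$ then $T(j,k)<T(i,k)$ or $T(i,k)<T(j,k+1)$. The weight of $T$ is $x^T=\prod_i x_i^{a_i}$ where $a_i$ is the number of entries equal to $i$. The quasisymmetric Schur polynomial is $\mathcal{S}_\alpha(x_1,\dots,x_n)=\sum_T x^T$ over composition tableaux of shape $\alpha$ with entries in $\{1,\dots,n\}$ ($\mathcal{S}_0=1$). A composition $\alpha$ is inverting if for each integer $i$ with $1<i\le\max_j\alpha_j$ there exist $s<t$ with $\alpha_s=i$, $\alpha_t=i-1$. Every composition factors uniquely as $\alpha=\gamma\,k^{i_k}\cdots2^{i_2}1^{i_1}$ ($i_j\ge1$) with $\gamma$ containing none of the values $1,\dots,k$ and $k\ge0$ maximal; $\alpha$ is pure if $k$ is even. $\mathsf{B}_n$ is the set of pure and inverting compositions of length at most $n$ (including the empty composition). *)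

theory Defs
  imports Complex_Main "HOL-Library.Poly_Mapping" "HOL-Combinatorics.Permutations"
begin

text \<open>Polynomials over the rationals in variables indexed by natural numbers:
  a monomial is a finitely supported exponent vector; variable x_i (1 \<le> i \<le> n)
  corresponds to index i.\<close>

type_synonym monom = "nat \<Rightarrow>\<^sub>0 nat"
type_synonym qpoly = "monom \<Rightarrow>\<^sub>0 rat"

definition poly_in :: "nat \<Rightarrow> qpoly \<Rightarrow> bool" where
  "poly_in n p \<longleftrightarrow> (\<forall>m \<in> Poly_Mapping.keys p. Poly_Mapping.keys m \<subseteq> {1..n})"

definition scal :: "rat \<Rightarrow> qpoly \<Rightarrow> qpoly" where
  "scal c p = Poly_Mapping.map (\<lambda>a. c * a) p"

definition is_composition :: "nat list \<Rightarrow> bool" where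
  "is_composition \<alpha> \<longleftrightarrow> (\<forall>a \<in> set \<alpha>. 0 < a)"

definition monom_of :: "nat list \<Rightarrow> nat list \<Rightarrow> monom" where
  "monom_of is \<alpha> = (\<Sum>j<length \<alpha>. Poly_Mapping.single (is ! j) (\<alpha> ! j))"

definition quasisymmetric :: "nat \<Rightarrow> qpoly \<Rightarrow> bool" where
  "quasisymmetric n f \<longleftrightarrow> poly_in n f \<and>
     (\<forall>\<alpha> is. is_composition \<alpha> \<and> length \<alpha> \<le> n \<and> length is = length \<alpha> \<and>
        sorted_wrt (<) is \<and> set is \<subseteq> {1..n} \<longrightarrow>
        Poly_Mapping.lookup f (monom_of [1..<length \<alpha> + 1] \<alpha>) = Poly_Mapping.lookup f (monom_of is \<alpha>))"

definition QSym :: "nat \<Rightarrow> qpoly set" where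
  "QSym n = {f. quasisymmetric n f}"

definition symmetric :: "nat \<Rightarrow> qpoly \<Rightarrow> bool" where
  "symmetric n f \<longleftrightarrow> poly_in n f \<and>
     (\<forall>\<sigma> m m'. \<sigma> permutes {1..n} \<and> (\<forall>i. Poly_Mapping.lookup m' i = Poly_Mapping.lookup m (\<sigma> i)) \<longrightarrow>
        Poly_Mapping.lookup f m' = Poly_Mapping.lookup f m)"

definition Sym :: "nat \<Rightarrow> qpoly set" where
  "Sym n = {f. symmetric n f}"

definition Eideal :: "nat \<Rightarrow> qpoly set" where
  "Eideal n = {p. \<exists>qs ss. length qs = length ss \<and> set qs \<subseteq> QSym n \<and>
      (\<forall>s \<in> set ss. s \<in> Sym n \<and> Poly_Mapping.lookup s 0 = 0) \<and>
      p = sum_list (map2 (*) qs ss)}"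

text \<open>Composition tableaux (rows and columns 1-indexed, matrix notation).
  Fillings are normalised to be 0 outside the diagram.\<close>
definition cells :: "nat list \<Rightarrow> (nat \<times> nat) set" where
  "cells \<alpha> = {(i, j). 1 \<le> i \<and> i \<le> length \<alpha> \<and> 1 \<le> j \<and> j \<le> \<alpha> ! (i - 1)}"

definition is_comp_tableau :: "nat \<Rightarrow> nat list \<Rightarrow> (nat \<times> nat \<Rightarrow> nat) \<Rightarrow> bool" where
  "is_comp_tableau n \<alpha> T \<longleftrightarrow>
     (\<forall>c. c \<notin> cells \<alpha> \<longrightarrow> T c = 0) \<and>
     (\<forall>c \<in> cells \<alpha>. 1 \<le> T c \<and> T c \<le> n) \<and>
     \<comment> \<open>CT1\<close>
     (\<forall>i j. (i, j) \<in> cells \<alpha> \<and> (i, j + 1) \<in> cells \<alpha> \<longrightarrow> T (i, j + 1) \<le> T (i, j)) \<and>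
     \<comment> \<open>CT2\<close>
     (\<forall>i i'. 1 \<le> i \<and> i < i' \<and> i' \<le> length \<alpha> \<longrightarrow> T (i, 1) < T (i', 1)) \<and>
     \<comment> \<open>CT3 (triple rule)\<close>
     (\<forall>i j k. (i, k) \<in> cells \<alpha> \<and> (j, k) \<in> cells \<alpha> \<and> i < j \<longrightarrow>
        (\<alpha> ! (i - 1) \<ge> \<alpha> ! (j - 1) \<and> k \<ge> 2 \<longrightarrow>
            T (j, k) < T (i, k) \<or> T (i, k - 1) < T (j, k)) \<and>
        (\<alpha> ! (i - 1) < \<alpha> ! (j - 1) \<longrightarrow>
            T (j, k) < T (i, k) \<or> T (i, k) < T (j, k + 1)))"

definition tableau_weight :: "nat list \<Rightarrow> (nat \<times> nat \<Rightarrow> nat) \<Rightarrow> monom" where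
  "tableau_weight \<alpha> T = (\<Sum>c \<in> cells \<alpha>. Poly_Mapping.single (T c) 1)"

text \<open>Quasisymmetric Schur polynomial S_\<alpha>(x_1,...,x_n); S_0 = 1 automatically
  (the unique empty tableau has weight 1).\<close>
definition qsSchur :: "nat \<Rightarrow> nat list \<Rightarrow> qpoly" where
  "qsSchur n \<alpha> = (\<Sum>T \<in> {T. is_comp_tableau n \<alpha> T}. Poly_Mapping.single (tableau_weight \<alpha> T) 1)"

definition inverting :: "nat list \<Rightarrow> bool" where
  "inverting \<alpha> \<longleftrightarrow> (\<forall>i. 1 < i \<and> (\<exists>a \<in> set \<alpha>. i \<le> a) \<longrightarrow>
      (\<exists>s t. s < t \<and> t < length \<alpha> \<and> \<alpha> ! s = i \<and> \<alpha> ! t = i - 1))"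

definition tail_factor :: "nat list \<Rightarrow> nat \<Rightarrow> bool" where
  "tail_factor \<alpha> k \<longleftrightarrow> (\<exists>\<gamma> m. (\<forall>j \<in> {1..k}. 1 \<le> m j) \<and> (\<forall>x \<in> set \<gamma>. x \<notin> {1..k}) \<and>
      \<alpha> = \<gamma> @ concat (map (\<lambda>j. replicate (m j) j) (rev [1..<k + 1])))"

definition pure :: "nat list \<Rightarrow> bool" where
  "pure \<alpha> \<longleftrightarrow> even (GREATEST k. tail_factor \<alpha> k)"

definition Bset :: "nat \<Rightarrow> nat list set" where
  "Bset n = {\<beta>. is_composition \<beta> \<and> length \<beta> \<le> n \<and> pure \<beta> \<and> inverting \<beta>}"

end

theory Submission
  imports Defs "HOL-Combinatorics.Multiset_Permutations" "HOL-Library.List_Lexorder"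
begin

text \<open>Let \<open>M\<^sub>\<alpha>\<close> and \<open>m\<^sub>\<mu>\<close> be the monomial quasisymmetric and symmetric polynomials. The products
  \<open>m\<^sub>\<mu> S\<^sub>\<beta>\<close> with \<open>\<beta> \<in> B\<^sub>n\<close> form a basis of \<open>QSym\<^sub>n\<close>, and those with \<open>\<mu> \<noteq> \<emptyset>\<close> span the ideal.

  They span: otherwise some linear functional kills all products of a minimal degree \<open>d\<close>, but not
  all \<open>M\<^sub>\<alpha>\<close>; let \<open>\<phi>(\<alpha>)\<close> be its value at \<open>M\<^sub>\<alpha>\<close>, and argue by induction on the sum of squares of \<open>\<alpha>\<close>.
  The polynomials \<open>e\<^sub>j M\<^sub>\<gamma>\<close> of degree \<open>d\<close> are killed, and keeping their terms with largest sum of squares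
  shows that \<open>\<phi>\<close> sums to zero over all rearrangements of \<open>\<alpha>\<close> that become equal when the letters
  \<open>v\<close> and \<open>v - 1\<close> are identified, or when the letters 1 are deleted. As \<open>S\<^sub>\<beta>\<close> is \<open>M\<^sub>\<beta>\<close> plus terms with smaller
  sum of squares, \<open>\<phi>\<close> also vanishes at the pure and inverting rearrangements. These conditions force
  \<open>\<phi> = 0\<close>, by an induction that removes the two smallest letters.

  They are independent: the pairs \<open>(\<mu>, \<beta>)\<close> inject into the compositions of length at most \<open>n\<close> and the same
  degree, so there are no more products than elements of the basis \<open>M\<^sub>\<alpha>\<close>.\<close>

section \<open>Functions on the rearrangements of a word\<close>

text \<open>Lowering every entry \<ge> v of \<alpha> by one and dropping zeros gives a \<gamma> such
  that e_j M_\<gamma> has the degree of \<alpha>, where j is the number of lowered entries. The best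
  way to put the units back is not unique: an entry v - 1 of \<gamma> may come from v or from v - 1,
  and for v = 1 the lost entries fit anywhere. The merging equations alone reduce everything to
  words in which each letter v > 1 precedes some v - 1. If such a word has an even number of
  complete final blocks, its value is zero by assumption; an odd number means that it ends in all
  its 1s. Its value must then come from the deletion equation, which mixes it with all ways of
  spreading the 1s over the word. This obstacle is met by deleting in a prefix only and letting its
  length vary. Two letters are removed at a time because two complete final blocks leave the parity
  unchanged.\<close>

definition csum :: "(nat list \<Rightarrow> rat) \<Rightarrow> nat multiset \<Rightarrow> (nat list \<Rightarrow> 'b) \<Rightarrow> 'b \<Rightarrow> rat" where
  "csum f M \<pi> c = (\<Sum>w | mset w = M \<and> \<pi> w = c. f w)"

abbreviation del :: "'a \<Rightarrow> 'a list \<Rightarrow> 'a list" where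
  "del c \<equiv> filter (\<lambda>a. a \<noteq> c)"

lemma finite_mset_eq [simp]: "finite {w. mset w = M}"
  using finite_permutations_of_multiset[of M] by (simp add: permutations_of_multiset_def)

lemma finite_mset_eq_conj [simp]: "finite {w. mset w = M \<and> Q w}"
  by (rule finite_subset[OF _ finite_mset_eq[of M]]) auto

lemma csum_refine:
  assumes "\<And>w. mset w = M \<Longrightarrow> \<pi> w = h (\<rho> w)"
  shows "csum f M \<pi> c = (\<Sum>u \<in> {u \<in> \<rho> ` {w. mset w = M}. h u = c}. csum f M \<rho> u)"
proof -
  let ?A = "{w. mset w = M \<and> \<pi> w = c}"
  have "csum f M \<pi> c = (\<Sum>u \<in> \<rho> ` ?A. \<Sum>w \<in> {w. w \<in> ?A \<and> \<rho> w = u}. f w)"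
    unfolding csum_def by (rule sum.image_gen) simp
  also have "\<dots> = (\<Sum>u \<in> {u \<in> \<rho> ` {w. mset w = M}. h u = c}. csum f M \<rho> u)"
  proof (rule sum.cong)
    show "\<rho> ` ?A = {u \<in> \<rho> ` {w. mset w = M}. h u = c}"
      using assms by auto
  next
    fix u assume "u \<in> {u \<in> \<rho> ` {w. mset w = M}. h u = c}"
    then have "{w. w \<in> ?A \<and> \<rho> w = u} = {w. mset w = M \<and> \<rho> w = u}"
      using assms by auto
    then show "(\<Sum>w \<in> {w. w \<in> ?A \<and> \<rho> w = u}. f w) = csum f M \<rho> u"
      by (simp add: csum_def)
  qed
  finally show ?thesis .
qed

text \<open>Fibres of a coarser map are unions of fibres of a finer one. Most derived relations
  arise in this way: a map that factors through a merging or a deletion inherits its vanishing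
  sums.\<close>

lemma csum_zero_refine:
  assumes "\<And>w. mset w = M \<Longrightarrow> \<pi> w = h (\<rho> w)" and "\<And>u. csum f M \<rho> u = 0"
  shows "csum f M \<pi> c = 0"
  by (subst csum_refine[of M \<pi> h \<rho>]) (use assms in auto)

lemma csum_add: "csum (\<lambda>w. f w + g w) M \<pi> c = csum f M \<pi> c + csum g M \<pi> c"
  by (simp add: csum_def sum.distrib)

lemma csum_outside: "c \<notin> \<pi> ` {w. mset w = M} \<Longrightarrow> csum f M \<pi> c = 0"
  unfolding csum_def by (rule sum.neutral) auto

section \<open>Precedence of letters and merging of neighbouring letters\<close>

definition bef :: "'a \<Rightarrow> 'a \<Rightarrow> 'a list \<Rightarrow> bool" where
  "bef i j w \<longleftrightarrow> (\<exists>us vs. w = us @ vs \<and> i \<in> set us \<and> j \<in> set vs)"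

lemma bef_append1: "bef i j w \<Longrightarrow> bef i j (w @ v)"
  unfolding bef_def by (metis append_assoc set_append UnCI)

lemma bef_append2: "bef i j w \<Longrightarrow> bef i j (v @ w)"
  unfolding bef_def by (metis append_assoc set_append UnCI)

lemma bef_append3: "i \<in> set v \<Longrightarrow> j \<in> set w \<Longrightarrow> bef i j (v @ w)"
  unfolding bef_def by blast

lemma bef_append_cases:
  assumes "bef i j (v @ w)"
  shows "bef i j v \<or> bef i j w \<or> (i \<in> set v \<and> j \<in> set w)"
proof -
  from assms obtain us vs where *: "v @ w = us @ vs" "i \<in> set us" "j \<in> set vs"
    unfolding bef_def by blast
  then obtain zs where "(v = us @ zs \<and> zs @ w = vs) \<or> (v @ zs = us \<and> w = zs @ vs)"
    by (auto simp: append_eq_append_conv2)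
  then show ?thesis using * unfolding bef_def by auto
qed

lemma bef_append_iff:
  "bef i j (v @ w) \<longleftrightarrow> bef i j v \<or> bef i j w \<or> (i \<in> set v \<and> j \<in> set w)"
  by (metis bef_append1 bef_append2 bef_append3 bef_append_cases)

lemma bef_Nil [simp]: "\<not> bef i j []" by (simp add: bef_def)

lemma bef_single [simp]: "\<not> bef i j [a]"
  unfolding bef_def by (auto simp: append_eq_Cons_conv Cons_eq_append_conv)

lemma bef_Cons: "bef i j (a # w) \<longleftrightarrow> bef i j w \<or> (i = a \<and> j \<in> set w)"
  using bef_append_iff[of i j "[a]" w] by auto

lemma bef_filter: "P i \<Longrightarrow> P j \<Longrightarrow> bef i j (filter P w) \<longleftrightarrow> bef i j w"
  by (induction w) (auto simp: bef_Cons)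

lemma bef_mem: "bef i j w \<Longrightarrow> i \<in> set w \<and> j \<in> set w"
  unfolding bef_def by auto

definition mgw :: "nat \<Rightarrow> nat list \<Rightarrow> nat list" where
  "mgw i w = map (\<lambda>a. if a = i then i - 1 else a) w"

lemma mgw_append [simp]: "mgw i (u @ v) = mgw i u @ mgw i v" by (simp add: mgw_def)
lemma length_mgw [simp]: "length (mgw i u) = length u" by (simp add: mgw_def)
lemma mgw_Cons: "mgw i (a # u) = (if a = i then i - 1 else a) # mgw i u" by (simp add: mgw_def)
lemma mgw_Nil [simp]: "mgw i [] = []" by (simp add: mgw_def)
lemma take_mgw: "take q (mgw i u) = mgw i (take q u)" by (simp add: mgw_def take_map)
lemma drop_mgw: "drop q (mgw i u) = mgw i (drop q u)" by (simp add: mgw_def drop_map)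
lemma mgw_id: "i \<notin> set u \<Longrightarrow> mgw i u = u"
  unfolding mgw_def by (rule map_idI) auto

lemma mgw_inj:
  assumes "mgw (Suc b) u = mgw (Suc b) u'" "b \<notin> set u" "b \<notin> set u'"
  shows "u = u'"
proof -
  have "inj_on (\<lambda>a. if a = Suc b then b else a) (set u \<union> set u')"
    using assms(2,3) by (intro inj_onI) (metis Un_iff)
  then show ?thesis using assms(1) unfolding mgw_def diff_Suc_1 by (simp only: inj_on_map_eq_map)
qed

text \<open>If no \<open>i\<close> stands before an \<open>i - 1\<close>, then among the positions
  holding these two letters all the \<open>i - 1\<close> come first. At the first difference from
  another member of the class, \<open>w\<close> therefore has \<open>i - 1\<close> where
  \<open>w'\<close> has \<open>i\<close>.\<close>

lemma sorted_class_less: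
  assumes "mgw i w = mgw i w'" "mset w = mset w'" "\<not> bef i (i - 1) w" "w \<noteq> w'" "0 < i"
  shows "w < w'"
  using assms
proof (induction w arbitrary: w')
  case Nil then show ?case by simp
next
  case (Cons a w)
  obtain a' w'' where w': "w' = a' # w''"
    using Cons.prems(2) by (cases w') auto
  show ?case
  proof (cases "a = a'")
    case True
    have "w < w''"
      by (rule Cons.IH) (use Cons.prems True w' in \<open>auto simp: mgw_Cons bef_Cons\<close>)
    then show ?thesis using True w' by simp
  next
    case False
    have eq: "(if a = i then i - 1 else a) = (if a' = i then i - 1 else a')"
      using Cons.prems(1) w' by (simp add: mgw_Cons)
    have "a \<noteq> i"
    proof
      assume ai: "a = i"
      then have a': "a' = i - 1" using eq False by (auto split: if_splits)
      have "i - 1 \<in> set (a # w)" using Cons.prems(2) w' a'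
        by (metis list.set_intros(1) mset_eq_setD)
      then have "i - 1 \<in> set w" using ai Cons.prems(5) by auto
      then show False using Cons.prems(3) ai by (simp add: bef_Cons)
    qed
    then have "a = i - 1 \<and> a' = i" using eq False by (auto split: if_splits)
    then show ?thesis using w' Cons.prems(5) by simp
  qed
qed

text \<open>The lexicographically largest word of the support is forced to have every letter \<open>i\<close>
  of \<open>I\<close> before some letter \<open>i - 1\<close>, since a word violating this is the smallest in its class.\<close>

lemma lexmax_vanish:
  fixes \<Phi> :: "nat list \<Rightarrow> rat"
  assumes fin: "finite S"
    and cls: "\<And>v i. v \<in> S \<Longrightarrow> i \<in> I \<Longrightarrow> (\<Sum>v' \<in> {v' \<in> S. mgw i v' = mgw i v}. \<Phi> v') = 0"
    and ms: "\<And>v v' i. v \<in> S \<Longrightarrow> v' \<in> S \<Longrightarrow> i \<in> I \<Longrightarrow> mgw i v = mgw i v' \<Longrightarrow> mset v = mset v'"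
    and pos: "\<And>i. i \<in> I \<Longrightarrow> 0 < i"
    and inv: "\<And>v. v \<in> S \<Longrightarrow> (\<forall>i\<in>I. bef i (i - 1) v) \<Longrightarrow> \<Phi> v = 0"
    and "v \<in> S"
  shows "\<Phi> v = 0"
proof (rule ccontr)
  assume "\<Phi> v \<noteq> 0"
  define Z where "Z = {v \<in> S. \<Phi> v \<noteq> 0}"
  have Z: "finite Z" "Z \<noteq> {}" using fin \<open>v \<in> S\<close> \<open>\<Phi> v \<noteq> 0\<close> by (auto simp: Z_def)
  define m where "m = Max Z"
  have "m \<in> Z" unfolding m_def using Z by (rule Max_in)
  then have m: "m \<in> S" "\<Phi> m \<noteq> 0" by (auto simp: Z_def)
  then obtain i where i: "i \<in> I" "\<not> bef i (i - 1) m" using inv by blast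
  have oth: "\<Phi> v' = 0" if "v' \<in> {v' \<in> S. mgw i v' = mgw i m} - {m}" for v'
  proof (rule ccontr)
    assume "\<Phi> v' \<noteq> 0"
    then have "v' \<le> m" unfolding m_def using that Z by (intro Max_ge) (auto simp: Z_def)
    moreover have "m < v'"
      by (rule sorted_class_less[of i]) (use that m i ms[of m v' i] pos in auto)
    ultimately show False by simp
  qed
  have "(\<Sum>v' \<in> {v' \<in> S. mgw i v' = mgw i m}. \<Phi> v') = \<Phi> m + (\<Sum>v' \<in> {v' \<in> S. mgw i v' = mgw i m} - {m}. \<Phi> v')"
    by (rule sum.remove) (use fin m in auto)
  also have "\<dots> = \<Phi> m" using oth by simp
  finally show False using cls[OF m(1) i(1)] m by simp
qed

section \<open>Deleting a letter in a prefix of varying length\<close>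

definition sg :: "nat \<Rightarrow> nat \<Rightarrow> nat list \<Rightarrow> nat list" where
  "sg c q w = del c (take q w) @ drop q w"

text \<open>The last letter of the prefix is either \<open>d\<close>, which the shorter prefix no
  longer deletes, or the last survivor \<open>c\<close>. The length of \<open>z\<close> tells where
  the untouched suffix begins, so the two cases can be read off from the result.\<close>

lemma csum_sg_step:
  assumes "0 < q" "q \<le> size M" "length z = size M - q" "c \<noteq> d"
  shows "csum f M (sg d q) (y @ c # z) = csum f M (sg d (q-1)) (y @ c # d # z) + csum f M (sg d (q-1)) (y @ c # z)"
proof -
  have key: "sg d q w = y @ c # z \<longleftrightarrow> sg d (q-1) w = y @ c # d # z \<or> sg d (q-1) w = y @ c # z"
    "\<not> (sg d (q-1) w = y @ c # d # z \<and> sg d (q-1) w = y @ c # z)"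
    if "mset w = M" for w
  proof -
    have lw: "length w = size M" using that by auto
    define u a z' where "u = take (q-1) w" "a = w ! (q-1)" "z' = drop q w"
    have w: "w = u @ a # z'" unfolding u_a_z'_def using assms lw
      by (metis Suc_pred' id_take_nth_drop le_less_trans lessI less_imp_diff_less nless_le)
    have lz: "length z' = length z" "length u = q - 1" unfolding u_a_z'_def using assms lw by auto
    have 1: "sg d q w = del d u @ (if a = d then [] else [a]) @ z'"
      unfolding sg_def w using lz assms by (auto simp: take_Cons' drop_Cons')
    have 2: "sg d (q-1) w = del d u @ [a] @ z'"
      unfolding sg_def w using lz by simp
    show "sg d q w = y @ c # z \<longleftrightarrow> sg d (q-1) w = y @ c # d # z \<or> sg d (q-1) w = y @ c # z"
      "\<not> (sg d (q-1) w = y @ c # d # z \<and> sg d (q-1) w = y @ c # z)"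
    proof -
      have gen: "X @ z' = Y @ z \<longleftrightarrow> z' = z \<and> X = Y" for X Y :: "nat list"
      using lz append_eq_append_conv[of X Y z' z] by blast
      have e1: "del d u @ (if a = d then [] else [a]) @ z' = y @ c # z \<longleftrightarrow>
         z' = z \<and> del d u @ (if a = d then [] else [a]) = y @ [c]"
        using gen[of "del d u @ (if a = d then [] else [a])" "y @ [c]"]
        by (simp only: append_assoc append_Cons append_Nil)
      have e2: "del d u @ [a] @ z' = y @ c # d # z \<longleftrightarrow> z' = z \<and> a = d \<and> del d u = y @ [c]"
        using gen[of "del d u @ [a]" "(y @ [c]) @ [d]"] by auto
      have e3: "del d u @ [a] @ z' = y @ c # z \<longleftrightarrow> z' = z \<and> a = c \<and> del d u = y"
        using gen[of "del d u @ [a]" "y @ [c]"] by auto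
      show "sg d q w = y @ c # z \<longleftrightarrow> sg d (q-1) w = y @ c # d # z \<or> sg d (q-1) w = y @ c # z"
        unfolding 1 2 e1 e2 e3 using assms(4) by auto
      show "\<not> (sg d (q-1) w = y @ c # d # z \<and> sg d (q-1) w = y @ c # z)"
        unfolding 1 2 e1 e2 e3 using assms(4) by auto
    qed
  qed
  have "{w. mset w = M \<and> sg d q w = y @ c # z} =
     {w. mset w = M \<and> sg d (q-1) w = y @ c # d # z} \<union> {w. mset w = M \<and> sg d (q-1) w = y @ c # z}"
    using key by blast
  then show ?thesis unfolding csum_def
    by (simp only:) (rule sum.union_disjoint, use key in auto)
qed

text \<open>The boundary case: if nothing of the prefix survives, its last letter is
  \<open>d\<close>, and there is no second summand.\<close>

lemma csum_sg_step_Nil: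
  assumes "0 < q" "q \<le> size M" "length z = size M - q"
  shows "csum f M (sg d q) z = csum f M (sg d (q-1)) (d # z)"
proof -
  have "sg d q w = z \<longleftrightarrow> sg d (q-1) w = d # z" if "mset w = M" for w
  proof -
    have lw: "length w = size M" using that by auto
    define u a z' where "u = take (q-1) w" "a = w ! (q-1)" "z' = drop q w"
    have w: "w = u @ a # z'" unfolding u_a_z'_def using assms lw
      by (metis Suc_pred' id_take_nth_drop le_less_trans lessI less_imp_diff_less nless_le)
    have lz: "length z' = length z" "length u = q - 1" unfolding u_a_z'_def using assms lw by auto
    have 1: "sg d q w = del d u @ (if a = d then [] else [a]) @ z'"
      unfolding sg_def w using lz assms by (auto simp: take_Cons' drop_Cons')
    have 2: "sg d (q-1) w = del d u @ [a] @ z'"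
      unfolding sg_def w using lz by simp
    have gen: "X @ z' = Y @ z \<longleftrightarrow> z' = z \<and> X = Y" for X Y :: "nat list"
      using lz append_eq_append_conv[of X Y z' z] by blast
    have e1: "del d u @ (if a = d then [] else [a]) @ z' = z \<longleftrightarrow>
         z' = z \<and> del d u @ (if a = d then [] else [a]) = []"
      using gen[of "del d u @ (if a = d then [] else [a])" "[]"]
      by (simp only: append_assoc append_Cons append_Nil)
    have e2: "del d u @ [a] @ z' = d # z \<longleftrightarrow> z' = z \<and> a = d \<and> del d u = []"
      using gen[of "del d u @ [a]" "[d]"] by auto
    show ?thesis unfolding 1 2 e1 e2 by auto
  qed
  then have "{w. mset w = M \<and> sg d q w = z} = {w. mset w = M \<and> sg d (q-1) w = d # z}" by blast
  then show ?thesis by (simp add: csum_def)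
qed

lemma length_takeWhile_mgw: "length (takeWhile P (rev (mgw i v))) = length (takeWhile (\<lambda>a. P (if a = i then i - 1 else a)) (rev v))"
  by (simp add: mgw_def rev_map takeWhile_map comp_def)

lemma csum_cong: "(\<And>w. mset w = M \<Longrightarrow> f w = f' w) \<Longrightarrow> (\<And>w. mset w = M \<Longrightarrow> \<pi> w = c \<longleftrightarrow> \<pi>' w = c') \<Longrightarrow> csum f M \<pi> c = csum f' M \<pi>' c'"
  unfolding csum_def by (rule sum.cong) blast+

text \<open>If \<open>b\<close> does not occur, the value is the full length of the word, so a
  smaller value certifies an occurrence.\<close>

definition tl_free :: "nat \<Rightarrow> nat list \<Rightarrow> nat" where
  "tl_free b v = length (takeWhile (\<lambda>a. a \<noteq> b) (rev v))"

lemma tl_free_append_Cons: "b \<notin> set z \<Longrightarrow> tl_free b (u @ b # z) = length z"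
  by (simp add: tl_free_def takeWhile_append)

lemma tl_free_split:
  assumes "tl_free b v < length v"
  shows "\<exists>u z. v = u @ b # z \<and> b \<notin> set z \<and> length z = tl_free b v"
proof -
  have "b \<in> set v"
  proof (rule ccontr)
    assume "b \<notin> set v"
    then have "takeWhile (\<lambda>a. a \<noteq> b) (rev v) = rev v" by (subst takeWhile_eq_all_conv) auto
    from arg_cong[OF this, of length] have "tl_free b v = length v"
      by (simp only: tl_free_def length_rev)
    then show False using assms by simp
  qed
  then obtain u z where "v = u @ b # z" "b \<notin> set z" using split_list_last by metis
  then show ?thesis using tl_free_append_Cons[of b z u] by auto
qed

text \<open>For a word \<open>\<beta>\<close> without \<open>b\<close> let \<open>g \<beta>\<close> be the value of \<open>f\<close> at \<open>\<beta> b \<dots> b\<close>, and let \<open>fe\<close>, \<open>fn\<close> be the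
  restrictions of \<open>f\<close> to words of this form and to the other words. In \<open>Phi q\<close> the words are
  summed up to deletion of the \<open>b\<close> among their first \<open>q\<close> letters, in \<open>Gam p\<close> up to deletion of the \<open>b + 1\<close>.
  Summing over the fibres of \<open>Cq\<close>, which deletes \<open>b\<close> and \<open>b + 1\<close> in the prefix and identifies them
  in the rest, expresses \<open>Gam p\<close> through \<open>Gam p'\<close> with \<open>p' > p\<close>. Since \<open>Gam l\<close> is a function on words
  without \<open>b\<close> and \<open>b + 1\<close> that satisfies the hypotheses for the base letter \<open>b + 2\<close>, it vanishes, hence so
  does \<open>Gam 0 = g\<close>.\<close>

locale ribbon_fn =
  fixes b r :: nat and M :: "nat multiset" and f :: "nat list \<Rightarrow> rat"
  assumes set_M: "set_mset M = {b..r}" and br: "b < r"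
    and R: "\<And>i u. b < i \<Longrightarrow> i \<le> r \<Longrightarrow> csum f M (mgw i) u = 0"
    and D: "\<And>x. csum f M (del b) x = 0"
    and P: "\<And>w. mset w = M \<Longrightarrow> (\<forall>i\<in>{b<..r}. bef i (i - 1) w) \<Longrightarrow>
        drop (size M - count M b) w \<noteq> replicate (count M b) b \<Longrightarrow> f w = 0"
begin

definition "m1 = count M b"
definition "m2 = count M (Suc b)"
definition "N = size M"
definition "l = N - m1"
definition "endw w \<longleftrightarrow> drop l w = replicate m1 b"
definition "fn w = (if endw w then 0 else f w)"
definition "fe w = (if endw w then f w else 0)"
definition "g \<beta> = f (\<beta> @ replicate m1 b)"
definition "M2 = filter_mset (\<lambda>a. a \<noteq> b) M"
definition "Cq q w = filter (\<lambda>a. a \<noteq> b \<and> a \<noteq> Suc b) (take q w) @ mgw (Suc b) (drop q w)"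
definition "Phi q v = csum fn M (sg b q) v"
definition "Gam p u = csum g M2 (sg (Suc b) p) u"
definition "S q = sg b q ` {w. mset w = M}"

lemma m1_pos: "0 < m1" and m2_pos: "0 < m2"
  using set_M br by (auto simp: m1_def m2_def)

lemma M_split: "M = M2 + replicate_mset m1 b"
proof -
  have "M = filter_mset (\<lambda>a. a \<noteq> b) M + filter_mset (\<lambda>a. \<not> a \<noteq> b) M"
    by (rule multiset_partition)
  then show ?thesis by (simp add: M2_def m1_def filter_eq_replicate_mset eq_commute)
qed

lemma size_M2: "size M2 = l" and m1_le: "m1 \<le> N" and l_plus: "l + m1 = N"
proof -
  have "N = size M2 + m1" unfolding N_def by (subst M_split) simp
  then show "size M2 = l" "m1 \<le> N" "l + m1 = N" by (auto simp: l_def)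
qed

lemma length_M2: "mset w = M2 \<Longrightarrow> length w = l"
  using size_M2 size_mset[of w] by simp

lemma set_M2: "set_mset M2 = {Suc b..r}"
  unfolding M2_def using set_M by auto

lemma b_notin: "mset \<beta> = M2 \<Longrightarrow> b \<notin> set \<beta>"
  using set_M2 by (metis Suc_n_not_le_n atLeastAtMost_iff set_mset_mset)

lemma end_iff: "mset w = M \<and> endw w \<longleftrightarrow> (\<exists>\<beta>. mset \<beta> = M2 \<and> w = \<beta> @ replicate m1 b)"
proof
  assume *: "mset w = M \<and> endw w"
  then have "w = take l w @ replicate m1 b" unfolding endw_def by (metis append_take_drop_id)
  then show "\<exists>\<beta>. mset \<beta> = M2 \<and> w = \<beta> @ replicate m1 b"
    using * M_split by (metis add_right_cancel mset_append mset_replicate)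
next
  assume "\<exists>\<beta>. mset \<beta> = M2 \<and> w = \<beta> @ replicate m1 b"
  then obtain \<beta> where \<beta>: "mset \<beta> = M2" "w = \<beta> @ replicate m1 b" by blast
  then have "length \<beta> = l" using size_M2 size_mset[of \<beta>] by simp
  then show "mset w = M \<and> endw w" using \<beta> M_split by (simp add: endw_def)
qed

section \<open>Relations for the two restrictions of \<open>f\<close>\<close>

lemma csum_f: "csum f M \<pi> c = csum fn M \<pi> c + csum fe M \<pi> c"
  unfolding csum_add[symmetric] by (rule csum_cong) (auto simp: fn_def fe_def)

lemma csum_fe: "csum fe M \<pi> c = csum g M2 (\<lambda>\<beta>. \<pi> (\<beta> @ replicate m1 b)) c"
proof -
  let ?h = "\<lambda>\<beta>. \<beta> @ replicate m1 b"
  let ?B = "{\<beta>. mset \<beta> = M2 \<and> \<pi> (?h \<beta>) = c}"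
  have h: "mset (?h \<beta>) = M" "endw (?h \<beta>)" if "mset \<beta> = M2" for \<beta>
    using end_iff[of "?h \<beta>"] that by simp_all
  have h': "w \<in> ?h ` ?B" if "mset w = M" "endw w" "\<pi> w = c" for w
    using end_iff[of w] that by auto
  have "csum fe M \<pi> c = (\<Sum>w \<in> ?h ` ?B. f w)"
    unfolding csum_def
  proof (rule sum.mono_neutral_cong_right)
    show "?h ` ?B \<subseteq> {w. mset w = M \<and> \<pi> w = c}" using h by auto
    show "\<forall>w \<in> {w. mset w = M \<and> \<pi> w = c} - ?h ` ?B. fe w = 0"
      using h' unfolding fe_def by auto
    show "\<And>w. w \<in> ?h ` ?B \<Longrightarrow> fe w = f w" using h unfolding fe_def by auto
  qed simp
  also have "\<dots> = (\<Sum>\<beta> \<in> ?B. f (?h \<beta>))"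
    by (subst sum.reindex) (auto simp: inj_on_def)
  finally show ?thesis by (simp add: csum_def g_def)
qed

lemma endw_mgw:
  assumes "Suc b < i"
  shows "endw (mgw i w) \<longleftrightarrow> endw w"
proof -
  have "map h xs = replicate k b \<longleftrightarrow> xs = replicate k b"
    if "\<And>a. h a = b \<longleftrightarrow> a = b" for h :: "nat \<Rightarrow> nat" and xs k
    by (auto simp: list_eq_iff_nth_eq that)
  note this[of "\<lambda>a. if a = i then i - 1 else a" "drop l w" m1]
  moreover have "(if a = i then i - 1 else a) = b \<longleftrightarrow> a = b" for a using assms by auto
  ultimately show ?thesis
    unfolding endw_def drop_mgw mgw_def[of i "drop l w"] by blast
qed

text \<open>Merging \<open>i\<close> with \<open>i - 1 > b\<close> does not affect the positions of
  \<open>b\<close>, so each class lies inside or outside of \<open>endw\<close> and the relation for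
  \<open>f\<close> splits into one for \<open>fn\<close> and one for \<open>fe\<close>.\<close>

lemma R_fn:
  assumes "Suc b < i" "i \<le> r"
  shows "csum fn M (mgw i) u = 0"
proof (cases "endw u")
  case True
  then show ?thesis unfolding csum_def
    by (intro sum.neutral) (use endw_mgw[OF assms(1)] in \<open>auto simp: fn_def\<close>)
next
  case False
  have "csum fn M (mgw i) u = csum f M (mgw i) u"
    unfolding csum_def
    by (rule sum.cong) (use endw_mgw[OF assms(1)] False in \<open>auto simp: fn_def\<close>)
  then show ?thesis using R[of i u] assms by simp
qed

lemma R_g:
  assumes "Suc b < i" "i \<le> r"
  shows "csum g M2 (mgw i) u = 0"
proof -
  have "csum fe M (mgw i) (u @ replicate m1 b) = 0"
    using R_fn[OF assms, of "u @ replicate m1 b"] R[of i "u @ replicate m1 b"]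
      csum_f[of "mgw i" "u @ replicate m1 b"] assms by simp
  moreover have "mgw i (replicate m1 b) = replicate m1 b"
    by (rule mgw_id) (use assms in auto)
  ultimately show ?thesis by (simp add: csum_fe) (simp add: csum_def)
qed

lemma sg_mgw: "c \<noteq> i \<Longrightarrow> c \<noteq> i - 1 \<Longrightarrow> sg c q (mgw i w) = mgw i (sg c q w)"
proof -
  assume a: "c \<noteq> i" "c \<noteq> i - 1"
  have "del c (mgw i u) = mgw i (del c u)" for u
    using a by (induction u) (auto simp: mgw_Cons)
  then show ?thesis unfolding sg_def take_mgw drop_mgw by simp
qed

lemma S_facts:
  assumes "v \<in> S q"
  shows "filter_mset (\<lambda>a. a \<noteq> b) (mset v) = M2" "set v \<subseteq> {b..r}" "count (mset v) (Suc b) = m2"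
proof -
  obtain w where w: "mset w = M" "v = sg b q w" using assms by (auto simp: S_def)
  have "del b v = del b w"
  proof -
    have "del b (take q w) @ del b (drop q w) = del b w"
      by (metis append_take_drop_id filter_append)
    then show ?thesis unfolding w sg_def by simp
  qed
  then show 1: "filter_mset (\<lambda>a. a \<noteq> b) (mset v) = M2"
    using w by (metis M2_def mset_filter)
  have "set v \<subseteq> set w" unfolding w sg_def by (auto dest: in_set_takeD in_set_dropD)
  then show "set v \<subseteq> {b..r}" using w set_M by (metis set_mset_mset)
  have "count (mset v) (Suc b) = count (filter_mset (\<lambda>a. a \<noteq> b) (mset v)) (Suc b)" by simp
  then show "count (mset v) (Suc b) = m2" unfolding 1 by (simp add: M2_def m2_def)
qed

text \<open>Words of \<open>S q\<close> may retain different numbers of \<open>b\<close>, but their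
  other letters are always those of \<open>M2\<close>, and merging above \<open>b + 1\<close>
  preserves the number of \<open>b\<close>.\<close>

lemma S_mset_eq:
  assumes "v \<in> S q" "v' \<in> S q" "Suc b < i" "mgw i v = mgw i v'"
  shows "mset v = mset v'"
proof -
  have c: "count (mset v) b = count (mset (mgw i v)) b" for v
    using assms(3) by (induction v) (auto simp: mgw_Cons)
  have "mset v = filter_mset (\<lambda>a. a \<noteq> b) (mset v) + replicate_mset (count (mset v) b) b" for v
    using multiset_partition[of "mset v" "\<lambda>a. a \<noteq> b"] by (simp add: filter_eq_replicate_mset eq_commute)
  from this[of v] this[of v'] show ?thesis
    using S_facts(1)[OF assms(1)] S_facts(1)[OF assms(2)] c[of v] c[of v'] assms(4) by simp
qed

lemma finite_S: "finite (S q)" by (simp add: S_def)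

lemma tl_free_mgw: "Suc b < i \<Longrightarrow> tl_free b (mgw i v) = tl_free b v"
  unfolding tl_free_def length_takeWhile_mgw
  by (rule arg_cong[where f = length], rule takeWhile_cong) auto

text \<open>Deleting \<open>b\<close> commutes with merging \<open>i\<close> and
  \<open>i - 1\<close>, as neither of them is \<open>b\<close>; so the relations for
  \<open>fn\<close> pass to \<open>Phi q\<close>.\<close>

lemma Phi_class:
  assumes "Suc b < i" "i \<le> r"
  shows "(\<Sum>v' \<in> {v' \<in> S q. mgw i v' = c}. Phi q v') = 0"
proof -
  have "csum fn M (\<lambda>w. mgw i (sg b q w)) c = 0"
    by (rule csum_zero_refine[of M _ "sg b q" "mgw i"]) (use assms sg_mgw R_fn in auto)
  moreover have "csum fn M (\<lambda>w. mgw i (sg b q w)) c = (\<Sum>v' \<in> {v' \<in> S q. mgw i v' = c}. Phi q v')"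
    unfolding S_def Phi_def by (rule csum_refine) simp
  ultimately show ?thesis by simp
qed

lemma S_length: "v \<in> S q \<Longrightarrow> q \<le> N \<Longrightarrow> N - q \<le> length v"
  by (auto simp: S_def sg_def N_def)

text \<open>The suffix left alone by \<open>sg b q\<close> has length \<open>N - q\<close>, so
  counting from the right end finds the cut although the prefix has shrunk by an unknown amount.
  This is why \<open>Cq q\<close> factors through \<open>sg b q\<close>.\<close>

definition "hC q v = del (Suc b) (take (length v - (N - q)) v) @ mgw (Suc b) (drop (length v - (N - q)) v)"

lemma Cq_hC:
  assumes "mset w = M" "q \<le> N" shows "Cq q w = hC q (sg b q w)"
proof -
  have "length w = N" using assms by (auto simp: N_def)
  then have "length (sg b q w) - (N - q) = length (del b (take q w))"
    using assms by (simp add: sg_def)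
  then show ?thesis by (simp add: hC_def sg_def Cq_def conj_commute)
qed

lemma Phi_Cclass:
  assumes "q \<le> N"
  shows "csum fn M (Cq q) c = (\<Sum>v' \<in> {v' \<in> S q. hC q v' = c}. Phi q v')"
  unfolding S_def Phi_def by (rule csum_refine) (use Cq_hC assms in auto)

lemma S_split:
  assumes "v \<in> S q" "q \<le> N"
  obtains x z where "v = x @ z" "length z = N - q" "b \<notin> set x"
    "\<And>w. mset w = M \<Longrightarrow> sg b q w = v \<Longrightarrow> drop q w = z \<and> del b (take q w) = x"
proof -
  obtain w0 where w0: "mset w0 = M" "v = sg b q w0" using assms by (auto simp: S_def)
  let ?x = "del b (take q w0)" and ?z = "drop q w0"
  have l: "length (drop q w) = N - q" if "mset w = M" for w
    using that by (auto simp: N_def)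
  show ?thesis
  proof (rule that[of ?x ?z])
    fix w assume w: "mset w = M" "sg b q w = v"
    then show "drop q w = ?z \<and> del b (take q w) = ?x"
      using l[OF w(1)] l[OF w0(1)] unfolding w0 sg_def by (metis append_eq_append_conv)
  qed (use w0 l in \<open>auto simp: sg_def\<close>)
qed

text \<open>The key vanishing statement. When no letter \<open>b + 1\<close> precedes the last \<open>b\<close>, every other
  member of the class of \<open>hC q\<close> has its last \<open>b\<close> further to the right.\<close>

lemma Phi_vanish:
  assumes q: "q \<le> N" and "(\<forall>c. csum fn M (Cq q) c = 0) \<or> tl_free b v < m2"
    and "v \<in> S q" "tl_free b v < N - q"
  shows "Phi q v = 0"
  using assms(2-)
proof (induction "tl_free b v" arbitrary: v rule: less_induct)
  case less
  define e where "e = tl_free b v"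
  define T where "T = {v \<in> S q. tl_free b v = e}"
  have eC: "(\<forall>c. csum fn M (Cq q) c = 0) \<or> e < m2" using less.prems(1) e_def by simp
  have eN: "e < N - q" using less.prems(3) e_def by simp
  have IH: "Phi q v' = 0" if "v' \<in> S q" "tl_free b v' < e" for v'
    using less.hyps[of v'] that less.prems e_def by fastforce
  have "v \<in> T" using less.prems by (simp add: T_def e_def)
  show ?case
  \<comment> \<open>Merging letters above \<open>b + 1\<close> does not move the last
    \<open>b\<close>, so the words of \<open>S q\<close> with a given value of
    \<open>tl_free b\<close> form a union of classes.\<close>
  proof (rule lexmax_vanish[of T "{Suc b<..r}" "Phi q", OF _ _ _ _ _ \<open>v \<in> T\<close>])
    show "finite T" using finite_S by (simp add: T_def)
    show "(\<Sum>v' \<in> {v' \<in> T. mgw i v' = mgw i v}. Phi q v') = 0" if "v \<in> T" "i \<in> {Suc b<..r}" for v i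
    proof -
      have "{v' \<in> T. mgw i v' = mgw i v} = {v' \<in> S q. mgw i v' = mgw i v}"
        using that by (auto simp: T_def) (metis tl_free_mgw)
      then show ?thesis using Phi_class[of i q] that by simp
    qed
    show "mset v = mset v'" if "v \<in> T" "v' \<in> T" "i \<in> {Suc b<..r}" "mgw i v = mgw i v'" for v v' i
      using that S_mset_eq[of v q v' i] by (auto simp: T_def)
    show "0 < i" if "i \<in> {Suc b<..r}" for i using that by simp
  next
    fix v assume v: "v \<in> T" and inv: "\<forall>i\<in>{Suc b<..r}. bef i (i - 1) v"
    then have vS: "v \<in> S q" and ve: "tl_free b v = e" by (auto simp: T_def)
    obtain x z where xz: "v = x @ z" "length z = N - q" "b \<notin> set x"
      "\<And>w. mset w = M \<Longrightarrow> sg b q w = v \<Longrightarrow> drop q w = z \<and> del b (take q w) = x"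
      using S_split[OF vS q] by metis
    have "e < length v" using S_length[OF vS q] eN by simp
    then obtain u z2 where uz: "v = u @ b # z2" "b \<notin> set z2" "length z2 = e"
      using tl_free_split[of b v] ve by blast
    have lxu: "length x \<le> length u"
      using arg_cong[OF xz(1), of length] arg_cong[OF uz(1), of length] xz(2) uz(3) eN by simp
    define z1 where "z1 = drop (length x) u"
    have "x = take (length x) u"
      using arg_cong[OF trans[OF xz(1)[symmetric] uz(1)], of "take (length x)"] lxu by simp
    then have u: "u = x @ z1" unfolding z1_def by (metis append_take_drop_id)
    then have z1: "u = x @ z1" "z = z1 @ b # z2"
      using xz(1) uz(1) by auto
    show "Phi q v = 0"
    \<comment> \<open>If some \<open>b + 1\<close> stands before the last \<open>b\<close> of
      \<open>v\<close>, the same holds in every preimage \<open>w\<close>, because the last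
      \<open>b\<close> lies in the untouched suffix. Then \<open>w\<close> has all required
      precedences, and \<open>fn w = 0\<close> by \<open>P\<close> or by definition.\<close>
    proof (cases "Suc b \<in> set u")
      case True
      have "fn w = 0" if w: "mset w = M" "sg b q w = v" for w
      proof -
        have wz: "drop q w = z" "del b (take q w) = x" using xz(4)[OF w] by auto
        have f1: "del b w = del b v"
        proof -
          have "del b w = del b (take q w @ drop q w)" by simp
          also have "\<dots> = x @ del b z" using wz by (simp del: append_take_drop_id)
          also have "\<dots> = del b v" using xz(1,3) by (auto intro!: filter_True[symmetric])
          finally show ?thesis .
        qed
        have "bef i (i - 1) w" if "i \<in> {b<..r}" for i
        proof (cases "i = Suc b")
          case True
          have "Suc b \<in> set x \<or> Suc b \<in> set z1" using \<open>Suc b \<in> set u\<close> z1 by auto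
          then have "bef (Suc b) b (take q w @ drop q w)"
          proof
            assume "Suc b \<in> set x"
            then have "Suc b \<in> set (take q w)" unfolding wz(2)[symmetric] by simp
            then show ?thesis using wz(1) z1 by (intro bef_append3) auto
          next
            assume "Suc b \<in> set z1"
            then show ?thesis unfolding wz(1) z1 by (intro bef_append2 bef_append3) auto
          qed
          then show ?thesis using True by simp
        next
          case False
          then have "bef i (i - 1) v" using inv that by auto
          then have "bef i (i - 1) (del b w)"
            unfolding f1 using False that by (subst bef_filter) auto
          then show ?thesis using False that by (subst (asm) bef_filter) auto
        qed
        then show ?thesis using P[of w] w unfolding fn_def endw_def l_def N_def m1_def by auto
      qed
      then show ?thesis unfolding Phi_def csum_def by (intro sum.neutral) auto
    next
      case False
      have cz2: "count (mset z2) (Suc b) = m2"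
      proof -
        have "count (mset u) (Suc b) = 0" using False by (simp add: count_eq_zero_iff)
        moreover have "count (mset u) (Suc b) + count (mset z2) (Suc b) = m2"
          using S_facts(3)[OF vS] uz(1) by simp
        ultimately show ?thesis by linarith
      qed
      \<comment> \<open>All the \<open>b + 1\<close> stand behind the last \<open>b\<close>, which
        rules out the second alternative of the assumption; the vanishing over the fibres of
        \<open>Cq q\<close> is therefore at hand.\<close>
      have "m2 \<le> e" using cz2 uz(3) by (metis count_le_size size_mset)
      then have C0: "csum fn M (Cq q) (hC q v) = 0" using eC by simp
      have hCv: "hC q v = x @ mgw (Suc b) z"
        using False z1 xz by (auto simp: hC_def intro!: filter_True)
      have oth: "Phi q v' = 0" if v': "v' \<in> {v' \<in> S q. hC q v' = hC q v} - {v}" for v'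
      proof -
        have v'S: "v' \<in> S q" using v' by simp
        obtain x' z' where xz': "v' = x' @ z'" "length z' = N - q" "b \<notin> set x'"
          using S_split[OF v'S q] by metis
        have hCv': "hC q v' = del (Suc b) x' @ mgw (Suc b) z'"
          using xz' by (simp add: hC_def)
        have eq: "del (Suc b) x' = x" "mgw (Suc b) z' = mgw (Suc b) z"
          using v' hCv hCv' xz(2) xz'(2) by (auto dest: append_eq_append_conv[THEN iffD1, rotated])
        define y where "y = take (Suc (length z1)) z'"
        define z2' where "z2' = drop (Suc (length z1)) z'"
        have z': "z' = y @ z2'" unfolding y_def z2'_def by simp
        have ly: "length y = Suc (length z1)" unfolding y_def using xz'(2) xz(2) z1 by simp
        have eqs: "mgw (Suc b) y = mgw (Suc b) (z1 @ [b])" "mgw (Suc b) z2' = mgw (Suc b) z2"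
        proof -
          have "mgw (Suc b) y @ mgw (Suc b) z2' = mgw (Suc b) (z1 @ [b]) @ mgw (Suc b) z2"
            using eq(2) unfolding z' z1 by (simp add: mgw_Cons)
          then have "mgw (Suc b) y = mgw (Suc b) (z1 @ [b]) \<and> mgw (Suc b) z2' = mgw (Suc b) z2"
            by (subst (asm) append_eq_append_conv) (use ly in auto)
          then show "mgw (Suc b) y = mgw (Suc b) (z1 @ [b])" "mgw (Suc b) z2' = mgw (Suc b) z2" by auto
        qed
        show ?thesis
        \<comment> \<open>A \<open>b\<close> in this part would be closer to the right end, where
          the induction applies. Without it merging is injective here, so this part already holds
          all \<open>m2\<close> letters \<open>b + 1\<close>, and nothing else can differ from
          \<open>v\<close>.\<close>
        proof (cases "b \<in> set z2'")
          case True
          then obtain p1 p2 where p: "z2' = p1 @ b # p2" "b \<notin> set p2" by (meson split_list_last)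
          have "length z2' = e" using eqs(2) uz(3) by (metis length_mgw)
          then have "tl_free b v' < e" using tl_free_append_Cons[of b p2 "x' @ y @ p1"] p xz'(1) z' by simp
          then show ?thesis using IH v'S by blast
        next
          case False2: False
          have "z2' = z2" by (rule mgw_inj[OF eqs(2) False2 uz(2)])
          then have c0: "count (mset (x' @ y)) (Suc b) = 0"
            using S_facts(3)[OF v'S] cz2 xz'(1) z' by simp
          then have nx: "Suc b \<notin> set x'" "Suc b \<notin> set y" by (auto simp: count_eq_zero_iff)
          have "x' = x" using eq(1) nx by (metis (mono_tags, lifting) filter_True)
          moreover have "y = z1 @ [b]" using eqs(1) mgw_id[of "Suc b" y] mgw_id[of "Suc b" "z1 @ [b]"] nx False z1 by auto
          ultimately have "v' = v" using xz' xz z' z1 \<open>z2' = z2\<close> by simp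
          then show ?thesis using v' by simp
        qed
      qed
      have "(\<Sum>v' \<in> {v' \<in> S q. hC q v' = hC q v}. Phi q v') = Phi q v + (\<Sum>v' \<in> {v' \<in> S q. hC q v' = hC q v} - {v}. Phi q v')"
        by (rule sum.remove) (use finite_S vS in auto)
      then show ?thesis using C0 Phi_Cclass[OF q] oth by simp
    qed
  qed
qed

section \<open>Evaluation of \<open>Phi\<close> and the recursion for \<open>Gam\<close>\<close>

lemma Phi_vanish':
  assumes "q \<le> N" "(\<forall>c. csum fn M (Cq q) c = 0) \<or> tl_free b v < m2" "tl_free b v < N - q"
  shows "Phi q v = 0"
proof (cases "v \<in> S q")
  case True then show ?thesis using Phi_vanish assms by blast
next
  case False then show ?thesis unfolding Phi_def S_def by (rule csum_outside)
qed

text \<open>With the whole word as prefix this is the deletion relation: the words not ending in all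
  \<open>b\<close> balance the single word \<open>v b ... b\<close>.\<close>

lemma Phi_N: assumes "mset v = M2" shows "Phi N v = - g v"
proof -
  have "csum f M (sg b N) v = csum f M (del b) v"
    by (rule csum_cong) (auto simp: sg_def N_def)
  then have "Phi N v = - csum fe M (sg b N) v"
    using csum_f[of "sg b N" v] D by (simp add: Phi_def)
  also have "csum fe M (sg b N) v = csum g M2 (\<lambda>w. w) v"
    unfolding csum_fe
  proof (rule csum_cong)
    fix w assume w: "mset w = M2"
    then have "length w = l" using size_M2 size_mset[of w] by simp
    then show "sg b N (w @ replicate m1 b) = v \<longleftrightarrow> w = v"
    proof -
      have "del b w = w" by (rule filter_True) (use b_notin[OF w] in auto)
      then show ?thesis using \<open>length w = l\<close> l_plus by (simp add: sg_def)
    qed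
  qed simp
  also have "\<dots> = g v"
  proof -
    have "{w. mset w = M2 \<and> w = v} = {v}" using assms by auto
    then show ?thesis by (simp add: csum_def)
  qed
  finally show ?thesis .
qed

text \<open>Each shortening of the prefix splits off a term with a \<open>b\<close> directly at the
  cut (\<open>csum_sg_step\<close>). As long as these terms vanish, the value found for the full
  prefix persists.\<close>

lemma Phi_eq_g:
  assumes v: "mset v = M2"
    and "k \<le> l" "\<And>k'. k' < k \<Longrightarrow> Phi (N - k' - 1) (take (l - k') v @ b # drop (l - k') v) = 0"
  shows "Phi (N - k) v = - g v"
  using assms(2-)
proof (induction k)
  case 0 then show ?case using Phi_N v by simp
next
  case (Suc k)
  have lv: "length v = l" using v size_M2 size_mset[of v] by simp
  define y c z where "y = take (l - k - 1) v" "c = v ! (l - k - 1)" "z = drop (l - k) v"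
  have kl: "l - k - 1 < length v" "Suc (l - k - 1) = l - k" using Suc.prems(1) lv by auto
  have tk: "take (l - k) v = y @ [c]" unfolding y_c_z_def using take_Suc_conv_app_nth[OF kl(1)] kl(2) by simp
  have vv: "v = y @ c # z" using tk y_c_z_def(3) append_take_drop_id[of "l - k" v] by simp
  have "c \<noteq> b" using b_notin[OF v] vv by auto
  have "Phi (N - k) v = Phi (N - k - 1) (y @ c # b # z) + Phi (N - k - 1) v"
    unfolding Phi_def vv
    by (rule csum_sg_step) (use Suc.prems(1) l_plus m1_pos lv \<open>c \<noteq> b\<close> in \<open>auto simp: N_def[symmetric] y_c_z_def(3)\<close>)
  moreover have "Phi (N - k - 1) (y @ c # b # z) = 0"
    using Suc.prems(2)[of k] tk y_c_z_def(3) by simp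
  moreover have "Phi (N - k) v = - g v" using Suc by simp
  ultimately show ?case by simp
qed

text \<open>Put all the \<open>b\<close> in front, where they get deleted.\<close>

lemma mem_S: assumes "mset \<beta> = M2" "m1 \<le> q" shows "\<beta> \<in> S q"
proof -
  have "sg b q (replicate m1 b @ \<beta>) = \<beta>"
  proof -
    have "del b (take (q - m1) \<beta>) = take (q - m1) \<beta>"
      by (rule filter_True) (use b_notin[OF assms(1)] in_set_takeD in metis)
    then show ?thesis using assms by (simp add: sg_def)
  qed
  moreover have "mset (replicate m1 b @ \<beta>) = M" using assms M_split by (simp add: add.commute)
  ultimately show ?thesis unfolding S_def by (metis (mono_tags, lifting) imageI mem_Collect_eq)
qed

text \<open>A word of the fibre that still contains \<open>b\<close> has one among its last
  \<open>k\<close> letters and contributes nothing. On the words without \<open>b\<close> the value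
  of \<open>Phi\<close> is \<open>- g\<close>, and there the fibre of \<open>Cq\<close> is one of
  \<open>sg (Suc b) (l - k)\<close>, since merging is injective in the absence of \<open>b\<close>.
  The index drops from \<open>N - k\<close> to \<open>l - k\<close> because the \<open>m1\<close>
  letters \<open>b\<close> are gone.\<close>

lemma fn_Cq_eq:
  assumes k: "0 < k" "k \<le> l" and z: "length z = k" "b \<notin> set z"
    and eqg: "\<And>v. mset v = M2 \<Longrightarrow> drop (l - k) v = z \<Longrightarrow> Phi (N - k) v = - g v"
    and van: "\<And>v. v \<in> S (N - k) \<Longrightarrow> tl_free b v < k \<Longrightarrow> Phi (N - k) v = 0"
  shows "csum fn M (Cq (N - k)) (x @ mgw (Suc b) z) = - Gam (l - k) (x @ z)"
proof -
  let ?q = "N - k"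
  have q: "?q \<le> N" "N - ?q = k" "m1 \<le> ?q" using k l_plus by auto
  let ?A = "{v \<in> S ?q. hC ?q v = x @ mgw (Suc b) z}"
  let ?B = "{\<beta>. mset \<beta> = M2 \<and> sg (Suc b) (l - k) \<beta> = x @ z}"
  have eqv: "hC ?q \<beta> = x @ mgw (Suc b) z \<longleftrightarrow> sg (Suc b) (l - k) \<beta> = x @ z" if "mset \<beta> = M2" for \<beta>
  proof -
    have lb: "length \<beta> = l" using that size_M2 size_mset[of \<beta>] by simp
    have bf: "b \<notin> set (drop (l - k) \<beta>)" using b_notin[OF that] in_set_dropD by metis
    have ld: "length (drop (l - k) \<beta>) = length z" using lb z k by simp
    have "hC ?q \<beta> = x @ mgw (Suc b) z \<longleftrightarrow>
       del (Suc b) (take (l - k) \<beta>) = x \<and> mgw (Suc b) (drop (l - k) \<beta>) = mgw (Suc b) z"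
      unfolding hC_def lb q(2) using ld append_eq_append_conv by (metis length_mgw)
    also have "\<dots> \<longleftrightarrow> del (Suc b) (take (l - k) \<beta>) = x \<and> drop (l - k) \<beta> = z"
      using mgw_inj[OF _ bf z(2)] by auto
    also have "\<dots> \<longleftrightarrow> sg (Suc b) (l - k) \<beta> = x @ z"
      unfolding sg_def using ld append_eq_append_conv by metis
    finally show ?thesis .
  qed
  have sub: "?B \<subseteq> ?A" using eqv mem_S q(3) by auto
  have drp: "drop (l - k) \<beta> = z" if "\<beta> \<in> ?B" for \<beta>
  proof -
    have lb: "length \<beta> = l" using that size_M2 size_mset[of \<beta>] by auto
    then have "length (drop (l - k) \<beta>) = length z" using z k by simp
    then show ?thesis using that unfolding sg_def using append_eq_append_conv by blast
  qed
  have "csum fn M (Cq ?q) (x @ mgw (Suc b) z) = (\<Sum>v \<in> ?A. Phi ?q v)"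
    by (rule Phi_Cclass) simp
  also have "\<dots> = (\<Sum>v \<in> ?B. Phi ?q v)"
  proof (rule sum.mono_neutral_right)
    show "\<forall>v \<in> ?A - ?B. Phi ?q v = 0"
    proof
      fix v assume v: "v \<in> ?A - ?B"
      have "b \<in> set v"
      proof (rule ccontr)
        assume "b \<notin> set v"
        then have "filter_mset (\<lambda>a. a \<noteq> b) (mset v) = mset v"
          by (metis (mono_tags, lifting) filter_True mset_filter)
        then have "mset v = M2" using S_facts(1)[of v ?q] v by simp
        then show False using v eqv by auto
      qed
      obtain x' z' where xz: "v = x' @ z'" "length z' = N - ?q" "b \<notin> set x'"
        using S_split[of v ?q] v q(1) by (metis (no_types, lifting) DiffD1 mem_Collect_eq)
      then have "b \<in> set z'" using \<open>b \<in> set v\<close> by auto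
      then obtain p1 p2 where "z' = p1 @ b # p2" "b \<notin> set p2" using split_list_last by metis
      then have "tl_free b v < k" using tl_free_append_Cons[of b p2 "x' @ p1"] xz q(2) by simp
      then show "Phi ?q v = 0" using van v by simp
    qed
  qed (use finite_S sub in auto)
  also have "\<dots> = (\<Sum>v \<in> ?B. - g v)"
    by (rule sum.cong) (use eqg drp in auto)
  finally show ?thesis by (simp add: Gam_def csum_def sum_negf)
qed

text \<open>\<open>Cq q\<close> never distinguishes \<open>b + 1\<close> from \<open>b\<close>: it
  deletes both in the prefix and identifies them afterwards. So it factors through the
  merging.\<close>

lemma f_Cq: "csum f M (Cq q) c = 0"
proof (rule csum_zero_refine[of M _ "\<lambda>u. filter (\<lambda>a. a \<noteq> b \<and> a \<noteq> Suc b) (take q u) @ drop q u" "mgw (Suc b)"])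
  fix w :: "nat list"
  have "filter (\<lambda>a. a \<noteq> b \<and> a \<noteq> Suc b) (mgw (Suc b) u) = filter (\<lambda>a. a \<noteq> b \<and> a \<noteq> Suc b) u" for u
    by (induction u) (auto simp: mgw_Cons)
  then show "Cq q w = filter (\<lambda>a. a \<noteq> b \<and> a \<noteq> Suc b) (take q (mgw (Suc b) w)) @ drop q (mgw (Suc b) w)"
    by (simp add: Cq_def take_mgw drop_mgw)
next
  show "csum f M (mgw (Suc b)) u = 0" for u using R[of "Suc b" u] br by simp
qed

lemma fn_Cq: "csum fn M (Cq q) c = - csum fe M (Cq q) c"
  using csum_f[of "Cq q" c] f_Cq by simp

text \<open>The final run loses the \<open>q - l\<close> letters \<open>b\<close> that belong to the
  prefix; truncated subtraction makes this zero for \<open>q \<le> l\<close>.\<close>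

lemma Cq_end:
  assumes "mset \<beta> = M2"
  shows "Cq q (\<beta> @ replicate m1 b) = del (Suc b) (take q \<beta>) @ mgw (Suc b) (drop q \<beta>) @ replicate (m1 - (q - l)) b"
proof -
  have lb: "length \<beta> = l" using assms size_M2 size_mset[of \<beta>] by simp
  have "b \<notin> set (take q \<beta>)" using b_notin[OF assms] in_set_takeD by metis
  then have "filter (\<lambda>a. a \<noteq> b \<and> a \<noteq> Suc b) (take q \<beta>) = del (Suc b) (take q \<beta>)"
    by (intro filter_cong) auto
  moreover have "mgw (Suc b) (replicate n b) = replicate n b" for n by (rule mgw_id) auto
  ultimately show ?thesis using lb by (simp add: Cq_def)
qed

text \<open>With \<open>k = l - p\<close>, the relation for \<open>Cq\<close> is used at the index
  \<open>N - k = p + m1\<close>. Its \<open>fn\<close> part is \<open>- Gam p\<close>, its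
  \<open>fe\<close> part is a sum of values of \<open>Gam (p + m1)\<close>, and
  \<open>m1 > 0\<close>. The cuts passed on the way also have index above \<open>p\<close>.\<close>

lemma Gam_step:
  assumes p: "p < l" and T: "\<And>p' u. p < p' \<Longrightarrow> Gam p' u = 0"
  shows "Gam p u = 0"
proof (cases "u \<in> sg (Suc b) p ` {w. mset w = M2}")
  case False then show ?thesis unfolding Gam_def by (rule csum_outside)
next
  case True
  then obtain \<beta> where \<beta>: "mset \<beta> = M2" "u = sg (Suc b) p \<beta>" by auto
  have lb: "length \<beta> = l" using \<beta> size_M2 size_mset[of \<beta>] by simp
  define k where "k = l - p"
  have k: "0 < k" "k \<le> l" "l - k = p" using p by (auto simp: k_def)
  \<comment> \<open>On words \<open>w b ... b\<close> the map \<open>Cq q\<close> factors through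
    \<open>sg (Suc b) q\<close>; as in \<open>hC\<close>, the cut is found by counting from the
    right end.\<close>
  have C: "csum fn M (Cq q) c = 0" if "p < q" for q c
  proof -
    have "csum fe M (Cq q) c = 0" unfolding csum_fe
    proof (rule csum_zero_refine[of M2 _ "\<lambda>u. take (length u - (l - q)) u @ mgw (Suc b) (drop (length u - (l - q)) u) @ replicate (m1 - (q - l)) b" "sg (Suc b) q"])
      fix w assume w: "mset w = M2"
      have "length w = l" using w size_M2 size_mset[of w] by simp
      then have "length (sg (Suc b) q w) - (l - q) = length (del (Suc b) (take q w))"
        by (simp add: sg_def)
      then show "Cq q (w @ replicate m1 b) = take (length (sg (Suc b) q w) - (l - q)) (sg (Suc b) q w) @
         mgw (Suc b) (drop (length (sg (Suc b) q w) - (l - q)) (sg (Suc b) q w)) @ replicate (m1 - (q - l)) b"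
        unfolding Cq_end[OF w] by (simp add: sg_def)
    next
      show "csum g M2 (sg (Suc b) q) u = 0" for u using T[OF that] by (simp add: Gam_def)
    qed
    then show ?thesis using fn_Cq by simp
  qed
  have Nk: "p < N - k" "N - (N - k) = k" using p k l_plus m1_pos by auto
  have "csum fn M (Cq (N - k)) (del (Suc b) (take p \<beta>) @ mgw (Suc b) (drop p \<beta>))
      = - Gam (l - k) (del (Suc b) (take p \<beta>) @ drop p \<beta>)"
  proof (rule fn_Cq_eq[OF k(1,2)])
    show "length (drop p \<beta>) = k" using lb k by simp
    show "b \<notin> set (drop p \<beta>)" using b_notin[OF \<beta>(1)] in_set_dropD by metis
    show "Phi (N - k) v = 0" if "tl_free b v < k" for v
      by (rule Phi_vanish') (use C Nk that in auto)
    show "Phi (N - k) v = - g v" if v: "mset v = M2" for v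
    proof (rule Phi_eq_g[OF v k(2)])
      fix k' assume k': "k' < k"
      have "b \<notin> set (drop (l - k') v)" using b_notin[OF v] in_set_dropD by metis
      then have tf: "tl_free b (take (l - k') v @ b # drop (l - k') v) = k'"
        using tl_free_append_Cons[of b "drop (l - k') v" "take (l - k') v"] v size_M2 size_mset[of v] k' k by simp
      have "p < N - k' - 1" using k' Nk k l_plus m1_pos by linarith
      moreover have "k' < N - (N - k' - 1)" using k' k l_plus m1_pos by linarith
      ultimately show "Phi (N - k' - 1) (take (l - k') v @ b # drop (l - k') v) = 0"
        by (intro Phi_vanish') (use C tf in auto)
    qed
  qed
  then show ?thesis using C[OF Nk(1)] k(3) \<beta>(2) by (simp add: sg_def)
qed

lemma m2_le: "m2 \<le> l"
proof -
  have "m2 = count M2 (Suc b)" by (simp add: m2_def M2_def)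
  then show ?thesis using size_M2 by (metis count_le_size)
qed

text \<open>Unlike \<open>Gam_step\<close> this does not presuppose the vanishing at larger indices:
  fewer than \<open>m2\<close> letters follow the last \<open>b\<close>, so the second alternative
  of \<open>Phi_vanish\<close> applies. The relation for \<open>Cq\<close> then leads from
  \<open>s\<close> to \<open>s - m1\<close>, until fewer than \<open>m1\<close> letters follow
  \<open>c\<close>.\<close>

lemma Gam_single:
  assumes "s < m2" "c \<noteq> b" "c \<noteq> Suc b" "Suc s \<le> l"
  shows "Gam (l - Suc s) (x @ c # replicate s (Suc b)) = 0"
  using assms(1,4)
proof (induction s rule: less_induct)
  case (less s)
  define z where "z = c # replicate s (Suc b)"
  define k where "k = Suc s"
  have k: "0 < k" "k \<le> l" using less.prems by (auto simp: k_def)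
  have z: "length z = k" "b \<notin> set z" using assms by (auto simp: z_def k_def)
  have mz: "mgw (Suc b) z = c # replicate s b"
    using assms by (simp add: z_def mgw_Cons) (simp add: mgw_def)
  have Nk: "N - (N - k) = k" using k l_plus by auto
  have "csum fn M (Cq (N - k)) (x @ mgw (Suc b) z) = - Gam (l - k) (x @ z)"
  proof (rule fn_Cq_eq[OF k z])
    show "Phi (N - k) v = 0" if "tl_free b v < k" for v
      by (rule Phi_vanish') (use Nk that less.prems in \<open>auto simp: k_def\<close>)
    show "Phi (N - k) v = - g v" if v: "mset v = M2" for v
    proof (rule Phi_eq_g[OF v k(2)])
      fix k' assume k': "k' < k"
      have "b \<notin> set (drop (l - k') v)" using b_notin[OF v] in_set_dropD by metis
      then have tf: "tl_free b (take (l - k') v @ b # drop (l - k') v) = k'"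
        using tl_free_append_Cons[of b "drop (l - k') v" "take (l - k') v"] v size_M2 size_mset[of v] k' k by simp
      have "k' < N - (N - k' - 1)" using k' k l_plus m1_pos by linarith
      then show "Phi (N - k' - 1) (take (l - k') v @ b # drop (l - k') v) = 0"
        by (intro Phi_vanish') (use tf k' less.prems in \<open>auto simp: k_def\<close>)
    qed
  qed
  moreover have "csum fe M (Cq (N - k)) (x @ mgw (Suc b) z) = 0"
  proof (cases "m1 \<le> s")
    case False
    \<comment> \<open>Here the last \<open>s + 1\<close> letters of the image are all
      \<open>b\<close>, whereas the fibre requires \<open>c\<close> at the first of these
      places.\<close>
    have "Cq (N - k) (w @ replicate m1 b) \<noteq> x @ mgw (Suc b) z" if w: "mset w = M2" for w
    proof
      assume a: "Cq (N - k) (w @ replicate m1 b) = x @ mgw (Suc b) z"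
      have lw: "length w = l" using w size_M2 size_mset[of w] by simp
      have "l \<le> N - k" "m1 - (N - k - l) = k" using False l_plus k by (auto simp: k_def)
      then have "del (Suc b) (take (N - k) w) @ replicate k b = x @ c # replicate s b"
        using a lw unfolding Cq_end[OF w] mz by simp
      then have "replicate k b = c # replicate s b"
        by (subst (asm) append_eq_append_conv) (auto simp: k_def)
      then show False using assms by (simp add: k_def)
    qed
    then have "{w. mset w = M2 \<and> Cq (N - k) (w @ replicate m1 b) = x @ mgw (Suc b) z} = {}" by blast
    then show ?thesis unfolding csum_fe unfolding csum_def by (simp only: sum.empty)
  next
    case True
    have q: "N - k \<le> l" "N - k = l - Suc (s - m1)" "m1 - (N - k - l) = m1"
      using True l_plus k by (auto simp: k_def)
    have "csum fe M (Cq (N - k)) (x @ mgw (Suc b) z) = Gam (N - k) (x @ c # replicate (s - m1) (Suc b))"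
      unfolding csum_fe Gam_def
    proof (rule csum_cong)
      fix w assume w: "mset w = M2"
      have lw: "length w = l" using w size_M2 size_mset[of w] by simp
      let ?d = "drop (N - k) w"
      have ld: "length ?d = Suc (s - m1)" using lw q less.prems True by auto
      have bf: "b \<notin> set ?d" using b_notin[OF w] in_set_dropD by metis
      have rep: "replicate s b = replicate (s - m1) b @ replicate m1 b"
        using True by (simp flip: replicate_add)
      have m: "mgw (Suc b) (c # replicate (s - m1) (Suc b)) = c # replicate (s - m1) b"
        using assms by (simp add: mgw_Cons) (simp add: mgw_def)
      have "Cq (N - k) (w @ replicate m1 b) = x @ mgw (Suc b) z \<longleftrightarrow>
         del (Suc b) (take (N - k) w) @ mgw (Suc b) ?d = x @ c # replicate (s - m1) b"
        unfolding Cq_end[OF w] mz q(3) rep by (metis append.assoc append_Cons append_same_eq)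
      also have "\<dots> \<longleftrightarrow> del (Suc b) (take (N - k) w) = x \<and> mgw (Suc b) ?d = mgw (Suc b) (c # replicate (s - m1) (Suc b))"
        unfolding m by (rule append_eq_append_conv) (use ld in simp)
      also have "\<dots> \<longleftrightarrow> del (Suc b) (take (N - k) w) = x \<and> ?d = c # replicate (s - m1) (Suc b)"
        using mgw_inj[OF _ bf, of "c # replicate (s - m1) (Suc b)"] assms by auto
      also have "\<dots> \<longleftrightarrow> sg (Suc b) (N - k) w = x @ c # replicate (s - m1) (Suc b)"
        unfolding sg_def by (rule append_eq_append_conv[symmetric]) (use ld in simp)
      finally show "Cq (N - k) (w @ replicate m1 b) = x @ mgw (Suc b) z \<longleftrightarrow> sg (Suc b) (N - k) w = x @ c # replicate (s - m1) (Suc b)" .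
    qed simp
    also have "\<dots> = 0" unfolding q(2)
      by (rule less.IH) (use True m1_pos less.prems in auto)
    finally show ?thesis .
  qed
  ultimately show ?case using fn_Cq by (simp add: z_def k_def)
qed

text \<open>Shortening the prefix exposes either one more \<open>b + 1\<close> or the last letter of
  \<open>x\<close>, and terms of the second kind vanish by \<open>Gam_single\<close>.\<close>

lemma Gam_shift:
  assumes "s \<le> m2" "b \<notin> set x" "Suc b \<notin> set x"
  shows "Gam l x = Gam (l - s) (x @ replicate s (Suc b))"
  using assms(1)
proof (induction s)
  case (Suc s)
  let ?z = "replicate s (Suc b)"
  have sl: "Suc s \<le> l" using Suc.prems m2_le by simp
  have "Gam (l - s) (x @ ?z) = Gam (l - s - 1) (x @ Suc b # ?z)"
  proof (cases x rule: rev_cases)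
    case Nil
    then show ?thesis unfolding Gam_def using sl size_M2 csum_sg_step_Nil[of "l - s" M2 ?z g "Suc b"] by simp
  next
    case (snoc y c)
    then have c: "c \<noteq> b" "c \<noteq> Suc b" using assms by auto
    have "Gam (l - s) (y @ c # ?z) = Gam (l - s - 1) (y @ c # Suc b # ?z) + Gam (l - s - 1) (y @ c # ?z)"
      unfolding Gam_def by (rule csum_sg_step) (use sl size_M2 c in auto)
    moreover have "Gam (l - s - 1) (y @ c # ?z) = 0"
      using Gam_single[of s c y] c Suc.prems sl by simp
    ultimately show ?thesis using snoc by simp
  qed
  then show ?case using Suc by simp
qed simp

section \<open>Passage to the base letter \<open>b + 2\<close>\<close>

definition "M3 = filter_mset (\<lambda>a. a \<noteq> Suc b) M2"

lemma M2_split: "M2 = M3 + replicate_mset m2 (Suc b)"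
proof -
  have "M2 = filter_mset (\<lambda>a. a \<noteq> Suc b) M2 + filter_mset (\<lambda>a. \<not> a \<noteq> Suc b) M2"
    by (rule multiset_partition)
  moreover have "count M2 (Suc b) = m2" by (simp add: M2_def m2_def)
  ultimately show ?thesis by (simp add: M3_def filter_eq_replicate_mset eq_commute)
qed

lemma set_M3: "set_mset M3 = {Suc (Suc b)..<Suc r}"
  unfolding M3_def using set_M2 by auto

lemma Gam_l: "Gam l x = csum g M2 (del (Suc b)) x"
  unfolding Gam_def
proof (rule csum_cong)
  fix w assume "mset w = M2"
  then have "length w = l" using size_M2 size_mset[of w] by simp
  then show "sg (Suc b) l w = x \<longleftrightarrow> del (Suc b) w = x" by (simp add: sg_def)
qed simp

text \<open>Once all \<open>m2\<close> letters \<open>b + 1\<close> stand in the suffix, none is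
  left to be deleted and the sum has one term. So \<open>Gam l\<close> records the values of
  \<open>f\<close> at words with two complete final blocks.\<close>

lemma Gam_l_eq:
  assumes "mset x = M3"
  shows "Gam l x = g (x @ replicate m2 (Suc b))"
proof -
  have nx: "b \<notin> set x" "Suc b \<notin> set x" using assms set_M3 by (metis Suc_n_not_le_n atLeastLessThan_iff le_SucI set_mset_mset)+
  have lx: "length x = l - m2" using assms size_M2 M2_split size_mset[of x] by simp
  have "{\<beta>. mset \<beta> = M2 \<and> sg (Suc b) (l - m2) \<beta> = x @ replicate m2 (Suc b)} = {x @ replicate m2 (Suc b)}"
  proof (intro equalityI subsetI; clarsimp)
    fix \<beta> assume \<beta>: "mset \<beta> = M2" "sg (Suc b) (l - m2) \<beta> = x @ replicate m2 (Suc b)"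
    have lb: "length \<beta> = l" using \<beta> size_M2 size_mset[of \<beta>] by simp
    have d: "drop (l - m2) \<beta> = replicate m2 (Suc b)" "del (Suc b) (take (l - m2) \<beta>) = x"
      using \<beta>(2) lb m2_le unfolding sg_def by (subst (asm) append_eq_append_conv; simp)+
    have "length (del (Suc b) (take (l - m2) \<beta>)) = length (take (l - m2) \<beta>)"
      using d(2) lx lb by simp
    then have "del (Suc b) (take (l - m2) \<beta>) = take (l - m2) \<beta>"
      by (metis filter_id_conv length_filter_less less_irrefl)
    then show "\<beta> = x @ replicate m2 (Suc b)" using d by (metis append_take_drop_id)
  next
    show "mset x + replicate_mset m2 (Suc b) = M2 \<and> sg (Suc b) (l - m2) (x @ replicate m2 (Suc b)) = x @ replicate m2 (Suc b)"
    proof -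
      have "del (Suc b) x = x" by (rule filter_True) (use nx in auto)
      then show ?thesis using assms M2_split lx by (simp add: sg_def)
    qed
  qed
  then have "Gam (l - m2) (x @ replicate m2 (Suc b)) = g (x @ replicate m2 (Suc b))"
    by (simp add: Gam_def csum_def)
  then show ?thesis using Gam_shift[of m2 x] nx by simp
qed

lemma csum_xi: "csum (Gam l) M3 \<pi> c = csum g M2 (\<lambda>\<beta>. \<pi> (del (Suc b) \<beta>)) c"
proof -
  have im: "del (Suc b) ` {w. mset w = M2} = {w. mset w = M3}"
  proof (intro equalityI subsetI)
    fix x assume "x \<in> {w. mset w = M3}"
    then have x: "mset x = M3" by simp
    have "Suc b \<notin> set x" using x set_M3 by (metis Suc_n_not_le_n atLeastLessThan_iff set_mset_mset)
    then have "del (Suc b) x = x" by (intro filter_True) auto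
    then have "x = del (Suc b) (x @ replicate m2 (Suc b))" by simp
    moreover have "mset (x @ replicate m2 (Suc b)) = M2" using x M2_split by simp
    ultimately show "x \<in> del (Suc b) ` {w. mset w = M2}" by blast
  qed (auto simp: M3_def mset_filter)
  have "csum g M2 (\<lambda>\<beta>. \<pi> (del (Suc b) \<beta>)) c =
      (\<Sum>u \<in> {u \<in> del (Suc b) ` {w. mset w = M2}. \<pi> u = c}. csum g M2 (del (Suc b)) u)"
    by (rule csum_refine) simp
  then show ?thesis unfolding im by (simp add: csum_def[of "Gam l"] Gam_l)
qed

lemma R_xi:
  assumes "Suc (Suc b) < i" "i \<le> r"
  shows "csum (Gam l) M3 (mgw i) u = 0"
  unfolding csum_xi
proof (rule csum_zero_refine[of M2 _ "del (Suc b)" "mgw i"])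
  show "mgw i (del (Suc b) w) = del (Suc b) (mgw i w)" for w
    using assms by (induction w) (auto simp: mgw_Cons)
qed (use R_g assms in auto)

text \<open>When \<open>b + 1\<close> and \<open>b + 2\<close> are both deleted, it does not matter
  which was which. The deletion relation for the new base letter thus comes from the merging
  relation for \<open>b + 2\<close>.\<close>

lemma D_xi:
  assumes "Suc (Suc b) \<le> r"
  shows "csum (Gam l) M3 (del (Suc (Suc b))) u = 0"
  unfolding csum_xi
proof (rule csum_zero_refine[of M2 _ "\<lambda>w. del (Suc (Suc b)) (del (Suc b) w)" "mgw (Suc (Suc b))"])
  show "del (Suc (Suc b)) (del (Suc b) w) =
    del (Suc (Suc b)) (del (Suc b) (mgw (Suc (Suc b)) w))" for w
    by (induction w) (auto simp: mgw_Cons)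
qed (use R_g assms in auto)

lemma vanish:
  assumes xi: "\<And>x. mset x = M3 \<Longrightarrow> Gam l x = 0" and w: "mset w = M"
  shows "f w = 0"
proof -
  have T: "Gam p u = 0" for p u
  proof (induction "l - p" arbitrary: p u rule: less_induct)
    case less
    show ?case
    proof (cases "p < l")
      case True
      show ?thesis
      proof (rule Gam_step[OF True])
        fix p' u assume "p < p'"
        then show "Gam p' u = 0" using less[of p' u] True by simp
      qed
    next
      case False
      have "Gam p u = Gam l u" unfolding Gam_def
      proof (rule csum_cong)
        fix w assume "mset w = M2"
        then have "length w = l" using size_M2 size_mset[of w] by simp
        then show "sg (Suc b) p w = u \<longleftrightarrow> sg (Suc b) l w = u" using False by (simp add: sg_def)
      qed simp
      also have "\<dots> = 0"
      proof (cases "mset u = M3")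
        case False
        have "u \<notin> del (Suc b) ` {w. mset w = M2}"
          using False by (auto simp: M3_def)
        then show ?thesis unfolding Gam_l by (rule csum_outside)
      qed (use xi in simp)
      finally show ?thesis .
    qed
  qed
  have g0: "g v = 0" if "mset v = M2" for v
  proof -
    have "{w. mset w = M2 \<and> sg (Suc b) 0 w = v} = {v}" using that by (auto simp: sg_def)
    then show ?thesis using T[of 0 v] by (simp add: Gam_def csum_def)
  qed
  \<comment> \<open>Now \<open>f\<close> vanishes at every word with all precedences: if the word
    ends in all its \<open>b\<close>, because \<open>g\<close> is zero, and otherwise by
    \<open>P\<close>. The merging relations settle the remaining words.\<close>
  show ?thesis
  proof (rule lexmax_vanish[of "{w. mset w = M}" "{b<..r}" f])
    show "(\<Sum>v' \<in> {v' \<in> {w. mset w = M}. mgw i v' = mgw i v}. f v') = 0" if "i \<in> {b<..r}" for v i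
      using R[of i "mgw i v"] that by (simp add: csum_def)
    show "f v = 0" if v: "v \<in> {w. mset w = M}" "\<forall>i\<in>{b<..r}. bef i (i - 1) v" for v
    proof (cases "endw v")
      case True
      then obtain \<beta> where "mset \<beta> = M2" "v = \<beta> @ replicate m1 b" using end_iff[of v] v by blast
      then show ?thesis using g0[of \<beta>] by (simp add: g_def)
    next
      case False
      then show ?thesis using P[of v] v by (auto simp: endw_def l_def N_def m1_def)
    qed
  qed (use w in auto)
qed

end

section \<open>Complete final blocks and the vanishing theorem\<close>

definition strip :: "nat \<Rightarrow> nat list \<Rightarrow> nat list" where
  "strip b w = rev (dropWhile (\<lambda>a. a = b) (rev w))"

lemma strip_append_replicate: "b \<notin> set w \<Longrightarrow> strip b (w @ replicate j b) = w"
proof -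
  assume b: "b \<notin> set w"
  have "dropWhile (\<lambda>a. a = b) (replicate j b @ rev w) = dropWhile (\<lambda>a. a = b) (rev w)"
    by (induction j) auto
  also have "\<dots> = rev w"
  proof (cases "rev w")
    case (Cons a v)
    then have "a \<in> set w" by (metis list.set_intros(1) set_rev)
    then show ?thesis using b Cons by auto
  qed simp
  finally show ?thesis by (simp add: strip_def)
qed

lemma strip_decomp: "\<exists>j. w = strip b w @ replicate j b"
proof -
  have "rev w = takeWhile (\<lambda>a. a = b) (rev w) @ dropWhile (\<lambda>a. a = b) (rev w)" by simp
  moreover have "takeWhile (\<lambda>a. a = b) (rev w) = replicate (length (takeWhile (\<lambda>a. a = b) (rev w))) b"
    by (rule replicate_eqI[symmetric, THEN sym]) (auto dest: set_takeWhileD)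
  ultimately have "rev w = replicate (length (takeWhile (\<lambda>a. a = b) (rev w))) b @ rev (strip b w)"
    by (metis strip_def rev_rev_ident)
  then have "w = rev (replicate (length (takeWhile (\<lambda>a. a = b) (rev w))) b @ rev (strip b w))"
    by (metis rev_rev_ident)
  then show ?thesis by (metis rev_append rev_replicate rev_rev_ident)
qed

lemma length_strip: "w \<noteq> [] \<Longrightarrow> last w = b \<Longrightarrow> length (strip b w) < length w"
proof -
  assume "w \<noteq> []" "last w = b"
  then obtain v where "w = v @ [b]" by (metis append_butlast_last_id)
  then show ?thesis using length_dropWhile_le[of "\<lambda>a. a = b" "rev v"] by (simp add: strip_def le_imp_less_Suc)
qed

text \<open>The number \<open>k\<close> of final blocks \<open>(b+k-1)\<dots>(b+1)b\<close> of a word that comprise all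
  occurrences of their letters.\<close>

function tailn :: "nat \<Rightarrow> nat list \<Rightarrow> nat" where
  "tailn b w = (if w \<noteq> [] \<and> last w = b \<and> b \<notin> set (strip b w) then Suc (tailn (Suc b) (strip b w)) else 0)"
  by auto
termination by (relation "measure (length \<circ> snd)") (auto simp: length_strip)

declare tailn.simps [simp del]

lemma tailn_block: "b \<notin> set w \<Longrightarrow> 0 < j \<Longrightarrow> tailn b (w @ replicate j b) = Suc (tailn (Suc b) w)"
  by (subst tailn.simps) (auto simp: strip_append_replicate)

lemma tailn_pos:
  assumes "0 < tailn b w"
  obtains w' j where "w = w' @ replicate j b" "b \<notin> set w'" "0 < j" "tailn b w = Suc (tailn (Suc b) w')"
proof -
  have *: "w \<noteq> []" "last w = b" "b \<notin> set (strip b w)"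
    using assms by (subst (asm) tailn.simps, auto split: if_splits)+
  obtain j where j: "w = strip b w @ replicate j b" using strip_decomp by blast
  have "0 < j"
  proof (rule ccontr)
    assume "\<not> 0 < j"
    then have "w = strip b w" using j by simp
    then show False using * last_in_set by metis
  qed
  then show ?thesis using that[OF j *(3)] tailn_block[OF *(3), of j] j by simp
qed

text \<open>Appending complete blocks of \<open>b + 1\<close> and \<open>b\<close> raises
  \<open>tailn\<close> by two, so the hypothesis on even values is inherited when the base letter
  changes to \<open>b + 2\<close>. For the empty word the deletion relation would be the claim
  itself; it is assumed for nonempty \<open>M\<close> only, and the even value
  \<open>tailn b [] = 0\<close> takes its place.\<close>

theorem words_vanish:
  fixes f :: "nat list \<Rightarrow> rat"
  assumes "set_mset M = {b..<e}"
    and "\<And>i u. b < i \<Longrightarrow> i < e \<Longrightarrow> csum f M (mgw i) u = 0"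
    and "\<And>x. M \<noteq> {#} \<Longrightarrow> csum f M (del b) x = 0"
    and "\<And>w. mset w = M \<Longrightarrow> (\<forall>i\<in>{b<..<e}. bef i (i - 1) w) \<Longrightarrow> even (tailn b w) \<Longrightarrow> f w = 0"
    and "mset w = M"
  shows "f w = 0"
  using assms
proof (induction "size M" arbitrary: M b f w rule: less_induct)
  case less
  note SM = less.prems(1) and R = less.prems(2) and D = less.prems(3) and PP = less.prems(4)
  consider "e \<le> b" | "e = Suc b" | "Suc b < e" by linarith
  then show ?case
  proof cases
    case 1
    then have "M = {#}" using SM by (auto simp flip: set_mset_eq_empty_iff)
    then have "w = []" using less.prems(5) by simp
    moreover have "tailn b [] = 0" by (simp add: tailn.simps)
    ultimately show ?thesis using PP[of w] less.prems(5) 1 by simp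
  next
    case 2
    then have "set w = {b}" using SM less.prems(5) by (metis atLeastLessThan_singleton set_mset_mset)
    have rep: "v = replicate (size M) b" if "mset v = M" for v
    proof (rule replicate_eqI)
      show "length v = size M" using that by auto
      show "y = b" if "y \<in> set v" for y
        using SM 2 \<open>mset v = M\<close> that by (metis atLeastLessThan_singleton set_mset_mset singletonD)
    qed
    \<comment> \<open>A nonempty word in one letter has the odd value \<open>tailn b w = 1\<close>.
      What settles it is the deletion relation, whose fibre over the empty word contains only
      \<open>w\<close>.\<close>
    have "{v. mset v = M \<and> del b v = []} = {w}"
    proof -
      have "mset v = M \<longleftrightarrow> v = w" for v
      proof
        assume "mset v = M"
        then have "v = replicate (size M) b" by (rule rep)
        also have "\<dots> = w" by (rule rep[OF less.prems(5), symmetric])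
        finally show "v = w" .
      next
        assume "v = w"
        then show "mset v = M" using less.prems(5) by simp
      qed
      moreover have "del b w = []" using \<open>set w = {b}\<close> by (simp add: filter_empty_conv)
      ultimately show ?thesis by (intro set_eqI) (simp, blast)
    qed
    moreover have "M \<noteq> {#}" using SM 2 by auto
    ultimately show ?thesis using D[of "[]"] by (simp add: csum_def)
  next
    case 3
    define r where "r = e - 1"
    have e: "e = Suc r" "b < r" using 3 by (auto simp: r_def)
    interpret ribbon_fn b r M f
    proof
      show "set_mset M = {b..r}" using SM e(1) by (simp only: atLeastLessThanSuc_atLeastAtMost)
      show "b < r" by (rule e)
      show "csum f M (mgw i) u = 0" if "b < i" "i \<le> r" for i u
        by (rule R[OF that(1)]) (use that(2) e(1) in linarith)
      have "M \<noteq> {#}"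
      proof
        assume "M = {#}"
        then have "{b..<e} = {}" using SM by simp
        then show False using 3 by simp
      qed
      then show "csum f M (del b) x = 0" for x by (rule D)
      fix w assume w: "mset w = M" "\<forall>i\<in>{b<..r}. bef i (i - 1) w"
        "drop (size M - count M b) w \<noteq> replicate (count M b) b"
      \<comment> \<open>A positive value would mean that the word ends in all its \<open>b\<close>,
        against the assumption in \<open>P\<close>.\<close>
      have "tailn b w = 0"
      proof (rule ccontr)
        assume "tailn b w \<noteq> 0"
        then have "0 < tailn b w" by simp
        then obtain w' j where wj: "w = w' @ replicate j b" "b \<notin> set w'"
          by (rule tailn_pos)
        have "count (mset w) b = j" unfolding wj(1) using wj(2) by (simp add: count_eq_zero_iff)
        then have "count M b = j" unfolding w(1) .
        moreover have "size (mset w) = length w' + j" unfolding wj(1) by simp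
        then have "size M = length w' + j" unfolding w(1) .
        ultimately show False using w(3) wj by simp
      qed
      moreover have "\<forall>i\<in>{b<..<e}. bef i (i - 1) w" using w(2) e by simp
      ultimately show "f w = 0" by (intro PP[OF w(1)]) simp_all
    qed
    show ?thesis
    proof (rule vanish)
      fix x assume x: "mset x = M3"
      show "Gam l x = 0"
      proof (rule less.hyps[of M3 "Suc (Suc b)" "Gam l" x])
        have "size M2 = size M3 + m2" using arg_cong[OF M2_split, of size] by simp
        then show "size M3 < size M" using size_M2 m2_pos l_plus m1_pos N_def by linarith
        show "set_mset M3 = {Suc (Suc b)..<e}" using set_M3 e by simp
        show "csum (Gam l) M3 (mgw i) u = 0" if "Suc (Suc b) < i" "i < e" for i u
          using R_xi that e by simp
        show "csum (Gam l) M3 (del (Suc (Suc b))) x = 0" if "M3 \<noteq> {#}" for x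
        proof (rule D_xi)
          show "Suc (Suc b) \<le> r"
          proof (rule ccontr)
            assume "\<not> Suc (Suc b) \<le> r"
            then have "set_mset M3 = {}" using set_M3 by simp
            then show False using that by simp
          qed
        qed
        show "Gam l x = 0" if x: "mset x = M3" "\<forall>i\<in>{Suc (Suc b)<..<e}. bef i (i - 1) x" "even (tailn (Suc (Suc b)) x)" for x
        proof -
          let ?w = "x @ replicate m2 (Suc b) @ replicate m1 b"
          have nx: "b \<notin> set x" "Suc b \<notin> set x"
            using set_M3 unfolding x(1)[symmetric] by auto
          have w: "mset ?w = M" using x(1) M2_split M_split by (simp add: add.assoc)
          have "bef i (i - 1) ?w" if i: "i \<in> {b<..<e}" for i
          proof -
            consider "i = Suc b" | "i = Suc (Suc b)" | "Suc (Suc b) < i" using i by fastforce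
            then show ?thesis
            proof cases
              case 1 then show ?thesis using m1_pos m2_pos by (intro bef_append2 bef_append3) auto
            next
              case 2
              then have "Suc (Suc b) \<in> set_mset M3" using set_M3 i e by auto
              then have "i \<in> set x" using 2 unfolding x(1)[symmetric] by simp
              then show ?thesis using 2 m2_pos by (intro bef_append3) auto
            next
              case 3 then show ?thesis using x(2) i by (intro bef_append1) auto
            qed
          qed
          moreover have "tailn b ?w = Suc (Suc (tailn (Suc (Suc b)) x))"
            using tailn_block[of b "x @ replicate m2 (Suc b)" m1] tailn_block[of "Suc b" x m2] nx m1_pos m2_pos by simp
          ultimately have "f ?w = 0" using x(3) by (intro less.prems(4)[OF w]) simp_all
          then show ?thesis using Gam_l_eq[OF x(1)] by (simp add: g_def)
        qed
      qed (rule x)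
    qed (rule less.prems(5))
  qed
qed

section \<open>Monomial quasisymmetric and symmetric polynomials\<close>

abbreviation "lk \<equiv> Poly_Mapping.lookup"
abbreviation "ksupp \<equiv> Poly_Mapping.keys"

lemma lookup_scal [simp]: "lk (scal c f) m = c * lk f m"
  unfolding scal_def by (simp add: Poly_Mapping.map.rep_eq when_def)

text \<open>Exponent vectors as lists, with the index shifted because variables are numbered from 1.
  Missing entries count as zero, so a composition stands for its monomial in the first
  variables.\<close>

definition xmon :: "nat list \<Rightarrow> monom" where
  "xmon p = (\<Sum>i<length p. Poly_Mapping.single (Suc i) (p ! i))"

lemma lookup_xmon: "lk (xmon p) k = (if 1 \<le> k \<and> k \<le> length p then p ! (k - 1) else 0)"
proof -
  have "lk (xmon p) k = (\<Sum>i<length p. if i = k - 1 \<and> 1 \<le> k then p ! i else 0)"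
    unfolding xmon_def by (simp add: lookup_sum lookup_single when_def) (intro sum.cong, auto)
  also have "\<dots> = (\<Sum>i\<in>{..<length p} \<inter> {i. i = k - 1 \<and> 1 \<le> k}. p ! i)"
    by (simp add: sum.inter_restrict)
  also have "{..<length p} \<inter> {i. i = k - 1 \<and> 1 \<le> k} = (if 1 \<le> k \<and> k \<le> length p then {k - 1} else {})"
    by auto
  finally show ?thesis by simp
qed

lemma xmon_eq_iff: "length p = length q \<Longrightarrow> xmon p = xmon q \<longleftrightarrow> p = q"
proof
  assume l: "length p = length q" and e: "xmon p = xmon q"
  show "p = q"
  proof (rule nth_equalityI[OF l])
    fix i assume "i < length p"
    then show "p ! i = q ! i"
      using arg_cong[OF e, of "\<lambda>m. lk m (Suc i)"] l by (simp add: lookup_xmon)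
  qed
qed simp

lemma xmon_append_zeros [simp]: "xmon (p @ replicate k 0) = xmon p"
  by (rule poly_mapping_eqI) (auto simp: lookup_xmon nth_append)

lemma xmon_add:
  assumes "length p = length q"
  shows "xmon p + xmon q = xmon (map2 (+) p q)"
  using assms by (intro poly_mapping_eqI) (auto simp: lookup_add lookup_xmon)

lemma keys_xmon: "ksupp (xmon p) \<subseteq> {1..length p}"
  by (auto simp: in_keys_iff lookup_xmon split: if_splits)

lemma xmon_cases:
  assumes "ksupp m \<subseteq> {1..n}"
  obtains p where "length p = n" "m = xmon p"
proof (rule that[of "map (\<lambda>i. lk m (Suc i)) [0..<n]"])
  show "m = xmon (map (\<lambda>i. lk m (Suc i)) [0..<n])"
  proof (rule poly_mapping_eqI)
    fix k
    show "lk m k = lk (xmon (map (\<lambda>i. lk m (Suc i)) [0..<n])) k"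
    proof (cases "k \<in> {1..n}")
      case True then show ?thesis by (auto simp: lookup_xmon)
    next
      case False
      then have "k \<notin> ksupp m" using assms by blast
      then show ?thesis using False by (auto simp: lookup_xmon in_keys_iff)
    qed
  qed
qed simp

lemma poly_inD: "poly_in n f \<Longrightarrow> lk f m \<noteq> 0 \<Longrightarrow> ksupp m \<subseteq> {1..n}"
  by (auto simp: poly_in_def in_keys_iff)

lemma poly_inI: "(\<And>m. lk f m \<noteq> 0 \<Longrightarrow> ksupp m \<subseteq> {1..n}) \<Longrightarrow> poly_in n f"
  by (auto simp: poly_in_def in_keys_iff)

lemma poly_eqI:
  assumes "poly_in n f" "poly_in n g" "\<And>p. length p = n \<Longrightarrow> lk f (xmon p) = lk g (xmon p)"
  shows "f = g"
proof (rule poly_mapping_eqI)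
  fix m
  show "lk f m = lk g m"
  proof (cases "ksupp m \<subseteq> {1..n}")
    case True then show ?thesis using assms(3) by (metis xmon_cases)
  next
    case False then show ?thesis using assms(1,2) poly_inD by metis
  qed
qed

lemma poly_in_add: "poly_in n f \<Longrightarrow> poly_in n g \<Longrightarrow> poly_in n (f + g)"
  by (rule poly_inI) (metis lookup_add poly_inD add.right_neutral)

lemma poly_in_0 [simp]: "poly_in n 0" by (simp add: poly_in_def)

lemma poly_in_scal: "poly_in n f \<Longrightarrow> poly_in n (scal c f)"
  by (rule poly_inI) (metis lookup_scal mult_zero_right poly_inD)

lemma poly_in_sum: "(\<And>x. x \<in> A \<Longrightarrow> poly_in n (f x)) \<Longrightarrow> poly_in n (\<Sum>x\<in>A. f x)"
  by (induction A rule: infinite_finite_induct) (auto intro: poly_in_add)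

lemma poly_in_single: "ksupp m \<subseteq> {1..n} \<Longrightarrow> poly_in n (Poly_Mapping.single m c)"
  by (rule poly_inI) (auto simp: lookup_single when_def split: if_splits)

lemma poly_in_mult:
  assumes "poly_in n f" "poly_in n g" shows "poly_in n (f * g)"
  unfolding poly_in_def
proof
  fix m assume "m \<in> ksupp (f * g)"
  then have "m \<in> {a + b |a b. a \<in> ksupp f \<and> b \<in> ksupp g}"
    using keys_mult by blast
  then obtain a b where "m = a + b" "a \<in> ksupp f" "b \<in> ksupp g" by blast
  then show "ksupp m \<subseteq> {1..n}"
    using assms Poly_Mapping.keys_add[of a b] unfolding poly_in_def by blast
qed

section \<open>Products through decompositions of exponent vectors\<close>

definition decomps :: "nat list \<Rightarrow> (nat \<times> nat) list set" where
  "decomps p = {y. map (\<lambda>(a, b). a + b) y = p}"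

lemma finite_decomps [simp]: "finite (decomps p)"
proof (rule finite_subset)
  show "decomps p \<subseteq> {y. set y \<subseteq> {0..sum_list p} \<times> {0..sum_list p} \<and> length y = length p}"
  proof
    fix y assume "y \<in> decomps p"
    then have y: "p = map (\<lambda>(a, b). a + b) y" by (simp add: decomps_def)
    have "a \<le> sum_list p \<and> b \<le> sum_list p" if "(a, b) \<in> set y" for a b
    proof -
      have "a + b \<in> set p" unfolding y using that by force
      then have "a + b \<le> sum_list p" by (rule member_le_sum_list) simp
      then show ?thesis by simp
    qed
    moreover have "length y = length p" unfolding y by simp
    ultimately show "y \<in> {y. set y \<subseteq> {0..sum_list p} \<times> {0..sum_list p} \<and> length y = length p}"
      by auto
  qed
  show "finite {y. set y \<subseteq> {0..sum_list p} \<times> {0..sum_list p} \<and> length y = length p}"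
    by (rule finite_lists_length_eq) simp
qed

lemma lookup_mult_xmon:
  assumes F: "poly_in n F" and G: "poly_in n G" and p: "length p = n"
  shows "lk (F * G) (xmon p) = (\<Sum>y\<in>decomps p. lk F (xmon (map fst y)) * lk G (xmon (map snd y)))"
proof -
  let ?h = "\<lambda>y. (xmon (map fst y), xmon (map snd y))"
  have len: "length y = n" if "y \<in> decomps p" for y
    using that p by (auto simp: decomps_def)
  have inj: "inj_on ?h (decomps p)"
  proof (rule inj_onI)
    fix y y' assume a: "y \<in> decomps p" "y' \<in> decomps p" "?h y = ?h y'"
    then have m: "xmon (map fst y) = xmon (map fst y')" "xmon (map snd y) = xmon (map snd y')"
      by (simp_all only: prod.inject)
    have l: "length (map fst y) = length (map fst y')" "length (map snd y) = length (map snd y')"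
      using len[OF a(1)] len[OF a(2)] by simp_all
    have "map fst y = map fst y'" "map snd y = map snd y'"
      using m xmon_eq_iff[OF l(1)] xmon_eq_iff[OF l(2)] by blast+
    then have "zip (map fst y) (map snd y) = zip (map fst y') (map snd y')" by (simp only:)
    then show "y = y'" by (simp only: zip_map_fst_snd)
  qed
  have add: "xmon p = xmon (map fst y) + xmon (map snd y)" if "y \<in> decomps p" for y
  proof -
    have "map2 (+) (map fst y) (map snd y) = p"
      using that zip_map_fst_snd[of y] by (simp only: decomps_def mem_Collect_eq)
    then show ?thesis using xmon_add[of "map fst y" "map snd y"] by simp
  qed
  have "lk (F * G) (xmon p) = (\<Sum>(a, b). lk F a * lk G b when xmon p = a + b)"
    unfolding times_poly_mapping.rep_eq by (rule prod_fun_unfold_prod) simp_all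
  also have "\<dots> = (\<Sum>(a, b) \<in> ?h ` decomps p. lk F a * lk G b when xmon p = a + b)"
  proof (rule Sum_any.expand_superset)
    show "{x. (case x of (a, b) \<Rightarrow> lk F a * lk G b when xmon p = a + b) \<noteq> 0} \<subseteq> ?h ` decomps p"
    proof clarsimp
      fix a b assume *: "xmon p = a + b" "lk F a \<noteq> 0" "lk G b \<noteq> 0"
      obtain s where s: "length s = n" "a = xmon s" using poly_inD[OF F *(2)] by (rule xmon_cases)
      obtain t where t: "length t = n" "b = xmon t" using poly_inD[OF G *(3)] by (rule xmon_cases)
      have "xmon p = xmon (map2 (+) s t)" using *(1) s t xmon_add[of s t] by simp
      then have "p = map2 (+) s t" using s t p xmon_eq_iff[of p "map2 (+) s t"] by simp
      then have "zip s t \<in> decomps p" by (simp add: decomps_def)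
      moreover have "(a, b) = ?h (zip s t)" using s t by simp
      ultimately show "(a, b) \<in> ?h ` decomps p" by (rule image_eqI[rotated])
    qed
  qed simp
  also have "\<dots> = (\<Sum>y\<in>decomps p. lk F (xmon (map fst y)) * lk G (xmon (map snd y)))"
    unfolding sum.reindex[OF inj] by (rule sum.cong) (use add in \<open>simp_all add: when_def\<close>)
  finally show ?thesis .
qed

section \<open>Monomial bases as sums over the fibres of a statistic\<close>

definition fz :: "nat list \<Rightarrow> nat list" where "fz p = del 0 p"

definition cls :: "nat \<Rightarrow> (nat list \<Rightarrow> 'c) \<Rightarrow> 'c \<Rightarrow> qpoly" where
  "cls n \<chi> c = (\<Sum>p | length p = n \<and> \<chi> p = c. Poly_Mapping.single (xmon p) 1)"

lemma poly_in_cls: "poly_in n (cls n \<chi> c)"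
  unfolding cls_def
proof (intro poly_in_sum poly_in_single)
  fix p :: "nat list" assume "p \<in> {p. length p = n \<and> \<chi> p = c}"
  then show "ksupp (xmon p) \<subseteq> {1..n}" using keys_xmon[of p] by simp
qed

lemma lookup_cls:
  assumes "finite {p. length p = n \<and> \<chi> p = c}" "length p = n"
  shows "lk (cls n \<chi> c) (xmon p) = (if \<chi> p = c then 1 else 0)"
proof -
  have "lk (cls n \<chi> c) (xmon p) = (\<Sum>q | length q = n \<and> \<chi> q = c. if q = p then 1 else 0)"
    unfolding cls_def lookup_sum
    by (rule sum.cong) (use assms xmon_eq_iff in \<open>auto simp: lookup_single when_def\<close>)
  then show ?thesis using assms by simp
qed

definition supp :: "nat \<Rightarrow> qpoly \<Rightarrow> nat list set" where
  "supp n f = {p. length p = n \<and> lk f (xmon p) \<noteq> 0}"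

lemma finite_supp: "finite (supp n f)"
proof (rule finite_imageD)
  show "finite (xmon ` supp n f)"
    by (rule finite_subset[of _ "ksupp f"]) (auto simp: supp_def in_keys_iff)
  show "inj_on xmon (supp n f)" by (rule inj_onI) (use xmon_eq_iff in \<open>auto simp: supp_def\<close>)
qed

lemma class_expand:
  assumes "poly_in n f" and co: "\<And>p. length p = n \<Longrightarrow> lk f (xmon p) = co (\<chi> p)"
    and fin: "\<And>c. finite {p. length p = n \<and> \<chi> p = c}"
  shows "f = (\<Sum>c \<in> \<chi> ` supp n f. scal (co c) (cls n \<chi> c))"
proof (rule poly_eqI[OF assms(1)])
  show "poly_in n (\<Sum>c \<in> \<chi> ` supp n f. scal (co c) (cls n \<chi> c))"
    by (intro poly_in_sum poly_in_scal poly_in_cls)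
  fix p :: "nat list" assume p: "length p = n"
  have "lk (\<Sum>c \<in> \<chi> ` supp n f. scal (co c) (cls n \<chi> c)) (xmon p) = (\<Sum>c \<in> \<chi> ` supp n f. if c = \<chi> p then co c else 0)"
    unfolding lookup_sum by (rule sum.cong) (use lookup_cls[OF fin p] in auto)
  also have "\<dots> = (if \<chi> p \<in> \<chi> ` supp n f then co (\<chi> p) else 0)"
    using finite_supp by simp
  also have "\<dots> = co (\<chi> p)" using p co by (force simp: supp_def)
  finally show "lk f (xmon p) = lk (\<Sum>c \<in> \<chi> ` supp n f. scal (co c) (cls n \<chi> c)) (xmon p)"
    using co p by simp
qed

lemma finite_fz: "finite {p. length p = n \<and> fz p = \<alpha>}"
proof (rule finite_subset)
  show "{p. length p = n \<and> fz p = \<alpha>} \<subseteq> {p. set p \<subseteq> insert 0 (set \<alpha>) \<and> length p = n}"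
    by (auto simp: fz_def)
qed (rule finite_lists_length_eq, simp)

lemma finite_mfz: "finite {p. length p = n \<and> mset (fz p) = \<mu>}"
proof (rule finite_subset)
  show "{p. length p = n \<and> mset (fz p) = \<mu>} \<subseteq> {p. set p \<subseteq> insert 0 (set_mset \<mu>) \<and> length p = n}"
    by (auto simp: fz_def)
qed (rule finite_lists_length_eq, simp)

definition MQ :: "nat \<Rightarrow> nat list \<Rightarrow> qpoly" where "MQ n = cls n fz"
definition MS :: "nat \<Rightarrow> nat multiset \<Rightarrow> qpoly" where "MS n = cls n (\<lambda>p. mset (fz p))"

lemma lookup_MQ: "length p = n \<Longrightarrow> lk (MQ n \<alpha>) (xmon p) = (if fz p = \<alpha> then 1 else 0)"
  unfolding MQ_def by (rule lookup_cls[OF finite_fz])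
lemma lookup_MS: "length p = n \<Longrightarrow> lk (MS n \<mu>) (xmon p) = (if mset (fz p) = \<mu> then 1 else 0)"
  unfolding MS_def by (rule lookup_cls[OF finite_mfz])

lemma fz_id: "0 \<notin> set p \<Longrightarrow> fz p = p"
  unfolding fz_def by (rule filter_True) metis

lemma fz_append [simp]: "fz (p @ q) = fz p @ fz q" by (simp add: fz_def)
lemma fz_replicate [simp]: "fz (replicate k 0) = []" by (simp add: fz_def)

section \<open>Quasisymmetry and symmetry in terms of exponent vectors\<close>

lemma monom_of_eq_xmon: "monom_of [1..<length \<alpha> + 1] \<alpha> = xmon \<alpha>"
  unfolding monom_of_def xmon_def by (rule sum.cong) (auto simp del: upt_Suc)

lemma lookup_monom_of:
  assumes "length is = length \<alpha>" "distinct is" "j < length is"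
  shows "lk (monom_of is \<alpha>) (is ! j) = \<alpha> ! j"
proof -
  have "lk (monom_of is \<alpha>) (is ! j) = (\<Sum>i<length \<alpha>. if i = j then \<alpha> ! i else 0)"
    unfolding monom_of_def lookup_sum
    by (rule sum.cong) (use assms nth_eq_iff_index_eq[OF assms(2)] in \<open>auto simp: lookup_single when_def\<close>)
  then show ?thesis using assms by simp
qed

lemma lookup_monom_of_outside:
  assumes "length is = length \<alpha>" "k \<notin> set is"
  shows "lk (monom_of is \<alpha>) k = 0"
  unfolding monom_of_def lookup_sum
  by (rule sum.neutral) (use assms in \<open>auto simp: lookup_single when_def\<close>)

lemma xmon_as_monom_of:
  obtains "is" where "length is = length (fz p)" "sorted_wrt (<) is" "set is \<subseteq> {1..length p}" "monom_of is (fz p) = xmon p"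
proof
  let ?js = "filter (\<lambda>i. p ! i \<noteq> 0) [0..<length p]"
  let ?is = "map Suc ?js"
  have fz: "fz p = map (\<lambda>i. p ! i) ?js"
    unfolding fz_def by (metis (mono_tags, lifting) filter_map map_nth comp_apply filter_cong)
  show len: "length ?is = length (fz p)" by (simp add: fz)
  have dist: "distinct ?is" by (simp add: distinct_map)
  show "sorted_wrt (<) ?is" by (simp add: sorted_wrt_map sorted_wrt_filter)
  show "set ?is \<subseteq> {1..length p}" by auto
  show "monom_of ?is (fz p) = xmon p"
  proof (rule poly_mapping_eqI)
    fix k
    show "lk (monom_of ?is (fz p)) k = lk (xmon p) k"
    proof (cases "k \<in> set ?is")
      case True
      then obtain j where j: "j < length ?is" "k = ?is ! j" by (metis in_set_conv_nth)
      then have "lk (monom_of ?is (fz p)) k = fz p ! j"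
        using lookup_monom_of[OF len dist j(1)] by (simp only:)
      moreover have "?js ! j \<in> set ?js" using j(1) by (intro nth_mem) simp
      ultimately show ?thesis using j by (auto simp: fz lookup_xmon)
    next
      case False
      have "p ! (k - 1) = 0" if k: "1 \<le> k" "k \<le> length p"
      proof (rule ccontr)
        assume "p ! (k - 1) \<noteq> 0"
        then have "k - 1 \<in> set ?js" using k by auto
        then have "Suc (k - 1) \<in> set ?is" by simp
        then show False using False k by simp
      qed
      then show ?thesis using lookup_monom_of_outside[OF len False] by (simp add: lookup_xmon)
    qed
  qed
qed

lemma monom_of_as_xmon:
  assumes "length is = length \<alpha>" "sorted_wrt (<) is" "set is \<subseteq> {1..n}" "is_composition \<alpha>"
  obtains p where "length p = n" "monom_of is \<alpha> = xmon p" "fz p = \<alpha>"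
proof -
  let ?m = "monom_of is \<alpha>"
  have dist: "distinct is" using assms(2) strict_sorted_iff by blast
  have km: "k \<in> ksupp ?m \<longleftrightarrow> k \<in> set is" for k
  proof
    show "k \<in> set is" if "k \<in> ksupp ?m"
      using that lookup_monom_of_outside[OF assms(1)] by (metis in_keys_iff)
    assume "k \<in> set is"
    then obtain j where "j < length is" "k = is ! j" by (metis in_set_conv_nth)
    then show "k \<in> ksupp ?m"
      using lookup_monom_of[OF assms(1) dist] assms(1,4) by (auto simp: in_keys_iff is_composition_def)
  qed
  then have "ksupp ?m \<subseteq> {1..n}" using assms(3) by blast
  then obtain p where p: "length p = n" "?m = xmon p" by (rule xmon_cases)
  have v: "p ! i = lk ?m (Suc i)" if "i < n" for i
    using that p by (simp add: lookup_xmon)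
  have js: "filter (\<lambda>i. p ! i \<noteq> 0) [0..<n] = map (\<lambda>k. k - 1) is"
  proof (rule sorted_distinct_set_unique)
    have pos: "\<forall>k \<in> set is. 1 \<le> k" using assms(3) by auto
    have "sorted_wrt (<) (map (\<lambda>k. k - 1) is)"
      unfolding sorted_wrt_map by (rule sorted_wrt_mono_rel[OF _ assms(2)]) (use pos in auto)
    then show "sorted (map (\<lambda>k. k - 1) is)" "distinct (map (\<lambda>k. k - 1) is)"
      using strict_sorted_iff by blast+
    show "sorted (filter (\<lambda>i. p ! i \<noteq> 0) [0..<n])" by (simp add: sorted_wrt_filter)
    show "distinct (filter (\<lambda>i. p ! i \<noteq> 0) [0..<n])" by simp
    have "i \<in> set (filter (\<lambda>i. p ! i \<noteq> 0) [0..<n]) \<longleftrightarrow> Suc i \<in> set is" for i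
    proof -
      have "i < n" if "Suc i \<in> set is" using that assms(3) by auto
      then show ?thesis using v[of i] km[of "Suc i"] by (auto simp: in_keys_iff)
    qed
    moreover have "Suc i \<in> set is \<longleftrightarrow> i \<in> (\<lambda>k. k - 1) ` set is" for i
      using pos by (force simp: image_iff)
    ultimately show "set (filter (\<lambda>i. p ! i \<noteq> 0) [0..<n]) = set (map (\<lambda>k. k - 1) is)" by auto
  qed
  have "fz p = map (\<lambda>i. p ! i) (filter (\<lambda>i. p ! i \<noteq> 0) [0..<n])"
    unfolding fz_def using p(1) by (metis (mono_tags, lifting) filter_map map_nth comp_apply filter_cong)
  also have "\<dots> = map (\<lambda>k. lk ?m k) is"
    unfolding js using assms(3) v by (auto simp: subset_iff)
  also have "\<dots> = \<alpha>"
    by (rule nth_equalityI) (use assms(1) lookup_monom_of[OF assms(1) dist] in auto)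
  finally show ?thesis using that p by blast
qed

lemma fz_composition: "is_composition (fz p)" by (auto simp: is_composition_def fz_def)
lemma length_fz_le: "length (fz p) \<le> length p" by (simp add: fz_def)

text \<open>A choice of variables with increasing indices is the set of positions of the nonzero
  entries of an exponent vector. The definition compares this vector with the one in which these
  entries are moved to the front.\<close>

lemma QSym_iff:
  "f \<in> QSym n \<longleftrightarrow> poly_in n f \<and> (\<forall>p. length p = n \<longrightarrow> lk f (xmon p) = lk f (xmon (fz p)))"
proof (intro iffI conjI allI impI)
  assume f: "f \<in> QSym n"
  then show "poly_in n f" by (simp add: QSym_def quasisymmetric_def)
  fix p :: "nat list" assume p: "length p = n"
  obtain "is" where i: "length is = length (fz p)" "sorted_wrt (<) is" "set is \<subseteq> {1..length p}" "monom_of is (fz p) = xmon p"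
    by (rule xmon_as_monom_of)
  have "lk f (monom_of [1..<length (fz p) + 1] (fz p)) = lk f (monom_of is (fz p))"
    using f i p length_fz_le[of p] fz_composition[of p] unfolding QSym_def quasisymmetric_def by blast
  then show "lk f (xmon p) = lk f (xmon (fz p))" using i(4) monom_of_eq_xmon by metis
next
  assume a: "poly_in n f \<and> (\<forall>p. length p = n \<longrightarrow> lk f (xmon p) = lk f (xmon (fz p)))"
  show "f \<in> QSym n" unfolding QSym_def quasisymmetric_def mem_Collect_eq
  proof (intro conjI allI impI; (elim conjE)?)
    show "poly_in n f" using a by simp
    fix \<alpha> "is" assume b: "is_composition \<alpha>" "length \<alpha> \<le> n" "length is = length \<alpha>" "sorted_wrt (<) is" "set is \<subseteq> {1..n}"
    obtain p where "length p = n" "monom_of is \<alpha> = xmon p" "fz p = \<alpha>"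
      by (rule monom_of_as_xmon[OF b(3,4,5,1)])
    then show "lk f (monom_of [1..<length \<alpha> + 1] \<alpha>) = lk f (monom_of is \<alpha>)"
      using a monom_of_eq_xmon by metis
  qed
qed

lemma Sym_iff:
  "f \<in> Sym n \<longleftrightarrow> poly_in n f \<and> (\<forall>p q. length p = n \<longrightarrow> mset p = mset q \<longrightarrow> lk f (xmon p) = lk f (xmon q))"
proof (intro iffI conjI allI impI)
  assume f: "f \<in> Sym n"
  then show "poly_in n f" by (simp add: Sym_def symmetric_def)
  fix p q :: "nat list" assume p: "length p = n" and pq: "mset p = mset q"
  obtain \<sigma> where \<sigma>: "\<sigma> permutes {..<length q}" "permute_list \<sigma> q = p"
    using mset_eq_permutation[OF pq] by blast
  have q: "length q = n" using p pq by (metis size_mset)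
  \<comment> \<open>Transports the permutation from the list positions \<open>0..n-1\<close> to the
    variables \<open>1..n\<close>.\<close>
  define \<tau> where "\<tau> i = (if i \<in> {1..n} then Suc (\<sigma> (i - 1)) else i)" for i
  have "\<tau> permutes {1..n}"
  proof (rule bij_imp_permutes)
    have "bij_betw (\<lambda>i. i - 1) {1..n} {..<n}"
      by (rule bij_betwI[where g = Suc]) auto
    moreover have "bij_betw \<sigma> {..<n} {..<n}" using \<sigma>(1) q permutes_imp_bij by blast
    moreover have "bij_betw Suc {..<n} {1..n}" by (rule bij_betwI[where g = "\<lambda>i. i - 1"]) auto
    ultimately have "bij_betw (Suc \<circ> (\<sigma> \<circ> (\<lambda>i. i - 1))) {1..n} {1..n}"
      by (metis bij_betw_trans)
    then show "bij_betw \<tau> {1..n} {1..n}"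
      by (rule bij_betw_cong[THEN iffD1, rotated]) (auto simp: \<tau>_def)
    show "\<tau> x = x" if "x \<notin> {1..n}" for x using that by (auto simp: \<tau>_def)
  qed
  moreover have "lk (xmon p) i = lk (xmon q) (\<tau> i)" for i
  proof (cases "i \<in> {1..n}")
    case True
    then have i: "i - 1 < length q" using q by auto
    then have "p ! (i - 1) = q ! \<sigma> (i - 1)" using \<sigma> permute_list_nth by metis
    moreover have "\<sigma> (i - 1) < n" using \<sigma>(1) i q by (metis lessThan_iff permutes_in_image)
    ultimately show ?thesis using True p q by (auto simp: lookup_xmon \<tau>_def)
  next
    case False
    then show ?thesis using p q by (auto simp: lookup_xmon \<tau>_def)
  qed
  ultimately show "lk f (xmon p) = lk f (xmon q)"
    using f unfolding Sym_def symmetric_def by blast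
next
  assume a: "poly_in n f \<and> (\<forall>p q. length p = n \<longrightarrow> mset p = mset q \<longrightarrow> lk f (xmon p) = lk f (xmon q))"
  show "f \<in> Sym n" unfolding Sym_def symmetric_def mem_Collect_eq
  proof (intro conjI allI impI; (elim conjE)?)
    show "poly_in n f" using a by simp
    fix \<sigma> and m m' :: monom assume \<sigma>: "\<sigma> permutes {1..n}" and mm: "\<forall>i. lk m' i = lk m (\<sigma> i)"
    have k: "i \<in> ksupp m' \<longleftrightarrow> \<sigma> i \<in> ksupp m" for i
      using mm by (simp add: in_keys_iff)
    show "lk f m' = lk f m"
    proof (cases "ksupp m \<subseteq> {1..n}")
      case True
      then have "ksupp m' \<subseteq> {1..n}" using k permutes_in_image[OF \<sigma>] by blast
      then obtain q where q: "length q = n" "m' = xmon q" by (rule xmon_cases)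
      obtain p where p: "length p = n" "m = xmon p" using True by (rule xmon_cases)
      have ms: "mset x = image_mset (lk (xmon x)) (mset_set {1..n})" if "length x = n" for x
      proof -
        have "x = map (\<lambda>i. lk (xmon x) i) [1..<Suc n]"
          by (rule nth_equalityI) (use that in \<open>auto simp: lookup_xmon simp del: upt_Suc\<close>)
        then have "mset x = image_mset (lk (xmon x)) (mset [1..<Suc n])" by (metis mset_map)
        then show ?thesis by (simp add: atLeastLessThanSuc_atLeastAtMost del: upt_Suc)
      qed
      have "mset q = image_mset (\<lambda>i. lk (xmon p) (\<sigma> i)) (mset_set {1..n})"
        using ms[OF q(1)] mm p q by (metis (mono_tags, lifting) image_mset_cong)
      also have "\<dots> = image_mset (lk (xmon p)) (image_mset \<sigma> (mset_set {1..n}))"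
        by (simp add: multiset.map_comp comp_def)
      also have "image_mset \<sigma> (mset_set {1..n}) = mset_set {1..n}"
        using \<sigma> by (simp add: image_mset_mset_set permutes_inj_on permutes_image)
      finally have "mset q = mset p" using ms[OF p(1)] by simp
      then show ?thesis using a p q by metis
    next
      case False
      then obtain i where i: "i \<in> ksupp m" "i \<notin> {1..n}" by blast
      then have "\<sigma> i = i" using \<sigma> permutes_not_in by metis
      then have "i \<in> ksupp m'" using k i by metis
      then show ?thesis using i a by (metis False poly_inD subsetD)
    qed
  qed
qed

lemma mset_fz: "length p = n \<Longrightarrow> mset p = mset (fz p) + replicate_mset (n - length (fz p)) 0"
proof -
  assume p: "length p = n"
  have "mset p = filter_mset (\<lambda>a. a \<noteq> 0) (mset p) + filter_mset (\<lambda>a. \<not> a \<noteq> 0) (mset p)"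
    by (rule multiset_partition)
  then have 1: "mset p = mset (fz p) + replicate_mset (count (mset p) 0) 0"
    by (simp add: fz_def filter_eq_replicate_mset eq_commute)
  have "count (mset p) 0 = n - length (fz p)"
    using arg_cong[OF 1, of size] p by simp
  then show ?thesis using 1 by simp
qed

lemma Sym_subset_QSym: "Sym n \<subseteq> QSym n"
proof
  fix f assume f: "f \<in> Sym n"
  show "f \<in> QSym n" unfolding QSym_iff
  proof (intro conjI allI impI)
    show "poly_in n f" using f Sym_iff by blast
    fix p :: "nat list" assume p: "length p = n"
    have "mset p = mset (fz p @ replicate (n - length (fz p)) 0)" using mset_fz[OF p] by simp
    then show "lk f (xmon p) = lk f (xmon (fz p))" using f p Sym_iff xmon_append_zeros by metis
  qed
qed

lemma MS_Sym: "MS n \<mu> \<in> Sym n"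
  unfolding Sym_iff
proof (intro conjI allI impI)
  show "poly_in n (MS n \<mu>)" by (simp add: MS_def poly_in_cls)
  fix p q :: "nat list" assume p: "length p = n" "mset p = mset q"
  then have "length q = n" by (metis size_mset)
  then show "lk (MS n \<mu>) (xmon p) = lk (MS n \<mu>) (xmon q)"
    using p by (simp add: lookup_MS fz_def)
qed

lemma MQ_QSym: "MQ n \<alpha> \<in> QSym n"
  unfolding QSym_iff
proof (intro conjI allI impI)
  show "poly_in n (MQ n \<alpha>)" by (simp add: MQ_def poly_in_cls)
  fix p :: "nat list" assume p: "length p = n"
  have "xmon (fz p) = xmon (fz p @ replicate (n - length (fz p)) 0)" by simp
  moreover have "length (fz p @ replicate (n - length (fz p)) 0) = n" using p length_fz_le[of p] by simp
  moreover have "fz (fz p) = fz p" by (simp add: fz_def)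
  ultimately show "lk (MQ n \<alpha>) (xmon p) = lk (MQ n \<alpha>) (xmon (fz p))"
    using p by (metis lookup_MQ fz_append fz_replicate append_Nil2)
qed

lemma QSym_expand:
  assumes "f \<in> QSym n"
  shows "f = (\<Sum>\<alpha> \<in> fz ` supp n f. scal (lk f (xmon \<alpha>)) (MQ n \<alpha>))"
  unfolding MQ_def by (rule class_expand) (use assms QSym_iff finite_fz in auto)

lemma Sym_expand:
  assumes "f \<in> Sym n"
  shows "f = (\<Sum>\<mu> \<in> (\<lambda>p. mset (fz p)) ` supp n f. scal (lk f (xmon (sorted_list_of_multiset \<mu>))) (MS n \<mu>))"
  unfolding MS_def
proof (rule class_expand[OF _ _ finite_mfz])
  show "poly_in n f" using assms Sym_iff by blast
  fix p :: "nat list" assume p: "length p = n"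
  let ?s = "sorted_list_of_multiset (mset (fz p))"
  have "mset p = mset (?s @ replicate (n - length (fz p)) 0)" using mset_fz[OF p] by simp
  then show "lk f (xmon p) = lk f (xmon ?s)" using assms p Sym_iff xmon_append_zeros by metis
qed

text \<open>Permuting an exponent vector permutes its decompositions, and the coefficients of both
  factors are unaffected.\<close>

lemma Sym_mult:
  assumes F: "F \<in> Sym n" and G: "G \<in> Sym n"
  shows "F * G \<in> Sym n"
  unfolding Sym_iff
proof (intro conjI allI impI)
  have pF: "poly_in n F" and pG: "poly_in n G" using assms Sym_iff by blast+
  then show "poly_in n (F * G)" by (rule poly_in_mult)
  fix p q :: "nat list" assume p: "length p = n" and pq: "mset p = mset q"
  obtain \<sigma> where \<sigma>: "\<sigma> permutes {..<length q}" "permute_list \<sigma> q = p"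
    using mset_eq_permutation[OF pq] by blast
  have q: "length q = n" using p pq by (metis size_mset)
  have \<sigma>': "inv \<sigma> permutes {..<length q}" by (rule permutes_inv[OF \<sigma>(1)])
  have o: "\<sigma> \<circ> inv \<sigma> = id" "inv \<sigma> \<circ> \<sigma> = id" using permutes_inv_o[OF \<sigma>(1)] by auto
  have perm: "map h (permute_list \<sigma> y) = permute_list \<sigma> (map h y)"
    "map h (permute_list (inv \<sigma>) y) = permute_list (inv \<sigma>) (map h y)"
    "permute_list (inv \<sigma>) (permute_list \<sigma> y) = y" "permute_list \<sigma> (permute_list (inv \<sigma>) y) = y"
    "mset (map h (permute_list \<sigma> y)) = mset (map h y)"
    if "length y = n" for h :: "nat \<times> nat \<Rightarrow> nat" and y
  proof -
    have i: "\<sigma> permutes {..<length y}" "inv \<sigma> permutes {..<length y}" using \<sigma>(1) \<sigma>' that q by auto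
    show "map h (permute_list \<sigma> y) = permute_list \<sigma> (map h y)"
      "map h (permute_list (inv \<sigma>) y) = permute_list (inv \<sigma>) (map h y)"
      using permute_list_map[OF i(1), of h] permute_list_map[OF i(2), of h] by simp_all
    show "permute_list (inv \<sigma>) (permute_list \<sigma> y) = y" "permute_list \<sigma> (permute_list (inv \<sigma>) y) = y"
      using permute_list_compose[OF i(2), of \<sigma>] permute_list_compose[OF i(1), of "inv \<sigma>"] o
      by (simp_all add: permute_list_id)
    show "mset (map h (permute_list \<sigma> y)) = mset (map h y)"
      using mset_permute_list[OF i(1)] by (simp only: mset_map)
  qed
  have len: "length y = n" if "y \<in> decomps p \<or> y \<in> decomps q" for y
    using that p q by (auto simp: decomps_def)
  have qp: "permute_list (inv \<sigma>) p = q"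
    using permute_list_compose[OF \<sigma>', of \<sigma>] o \<sigma>(2) by (simp add: permute_list_id)
  have inv: "lk H (xmon u) = lk H (xmon v)" if "H \<in> Sym n" "length u = n" "mset u = mset v" for H u v
    using that unfolding Sym_iff by blast
  have "(\<Sum>y\<in>decomps q. lk F (xmon (map fst y)) * lk G (xmon (map snd y))) =
      (\<Sum>y\<in>decomps p. lk F (xmon (map fst y)) * lk G (xmon (map snd y)))"
  proof (rule sum.reindex_bij_witness[where i = "permute_list (inv \<sigma>)" and j = "permute_list \<sigma>"])
    fix y assume y: "y \<in> decomps q"
    then have ly: "length y = n" using len by blast
    show "permute_list (inv \<sigma>) (permute_list \<sigma> y) = y" by (rule perm(3)[OF ly])
    show "permute_list \<sigma> y \<in> decomps p"
      using y perm(1)[OF ly] \<sigma>(2) by (simp add: decomps_def)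
    show "lk F (xmon (map fst (permute_list \<sigma> y))) * lk G (xmon (map snd (permute_list \<sigma> y))) =
        lk F (xmon (map fst y)) * lk G (xmon (map snd y))"
      by (intro arg_cong2[where f = "(*)"] inv F G perm(5)[OF ly]) (simp_all add: ly)
  next
    fix y assume y: "y \<in> decomps p"
    then have ly: "length y = n" using len by blast
    show "permute_list \<sigma> (permute_list (inv \<sigma>) y) = y" by (rule perm(4)[OF ly])
    show "permute_list (inv \<sigma>) y \<in> decomps q"
      using y perm(2)[OF ly] qp by (simp add: decomps_def)
  qed
  then show "lk (F * G) (xmon p) = lk (F * G) (xmon q)"
    using lookup_mult_xmon[OF pF pG p] lookup_mult_xmon[OF pF pG q] by simp
qed

section \<open>Products of quasisymmetric polynomials\<close>

definition nz2 :: "(nat \<times> nat) list \<Rightarrow> (nat \<times> nat) list" where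
  "nz2 y = filter (\<lambda>(a, b). a + b \<noteq> 0) y"

lemma decomps_Nil [simp]: "decomps [] = {[]}" by (auto simp: decomps_def)

lemma decomps_Cons: "decomps (a # p) = (\<lambda>(c, y). c # y) ` ({(s, t). s + t = a} \<times> decomps p)"
proof (intro equalityI subsetI)
  fix y assume "y \<in> decomps (a # p)"
  then obtain c y' where "y = c # y'" "fst c + snd c = a" "y' \<in> decomps p"
    by (cases y) (auto simp: decomps_def)
  then show "y \<in> (\<lambda>(c, y). c # y) ` ({(s, t). s + t = a} \<times> decomps p)"
    by (auto simp: image_iff split: prod.splits)
qed (auto simp: decomps_def)

text \<open>A zero entry has \<open>(0, 0)\<close> as its only decomposition, so dropping it loses
  nothing.\<close>

lemma bij_nz2: "bij_betw nz2 (decomps p) (decomps (fz p))"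
proof (induction p)
  case Nil then show ?case by (auto simp: bij_betw_def nz2_def fz_def)
next
  case (Cons a p)
  show ?case
  proof (rule bij_betwI')
    fix y y' assume yy: "y \<in> decomps (a # p)" "y' \<in> decomps (a # p)"
    then obtain c z c' z' where c: "y = c # z" "fst c + snd c = a" "z \<in> decomps p" "y' = c' # z'" "fst c' + snd c' = a" "z' \<in> decomps p"
      by (auto simp: decomps_Cons)
    have inj: "nz2 z = nz2 z' \<longleftrightarrow> z = z'" using Cons c by (auto simp: bij_betw_def dest: inj_onD)
    show "(nz2 y = nz2 y') = (y = y')"
    proof (cases "a = 0")
      case True
      then have "c = (0, 0)" "c' = (0, 0)" using c by (auto intro: prod_eqI)
      then show ?thesis using c inj by (simp add: nz2_def)
    next
      case False
      then show ?thesis using c inj by (auto simp: nz2_def split: prod.splits)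
    qed
  next
    fix y assume "y \<in> decomps (a # p)"
    then obtain c z where c: "y = c # z" "fst c + snd c = a" "z \<in> decomps p" by (auto simp: decomps_Cons)
    have "nz2 z \<in> decomps (fz p)" using Cons c by (auto simp: bij_betw_def)
    then show "nz2 y \<in> decomps (fz (a # p))" using c
      by (auto simp: nz2_def fz_def decomps_def split: prod.splits)
  next
    fix y assume y: "y \<in> decomps (fz (a # p))"
    show "\<exists>x\<in>decomps (a # p). y = nz2 x"
    proof (cases "a = 0")
      case True
      then have "y \<in> decomps (fz p)" using y by (simp add: fz_def)
      then obtain z where "z \<in> decomps p" "y = nz2 z" using Cons by (auto simp: bij_betw_def)
      then have "(0, 0) # z \<in> decomps (a # p)" "y = nz2 ((0, 0) # z)" using True by (auto simp: decomps_def nz2_def)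
      then show ?thesis by blast
    next
      case False
      then have "fz (a # p) = a # fz p" by (simp add: fz_def)
      then obtain c z where c: "y = c # z" "fst c + snd c = a" "z \<in> decomps (fz p)"
        using y by (auto simp: decomps_Cons)
      then obtain x where "x \<in> decomps p" "z = nz2 x" using Cons by (auto simp: bij_betw_def)
      then have "c # x \<in> decomps (a # p)" "y = nz2 (c # x)" using False c by (auto simp: decomps_def nz2_def split: prod.splits)
      then show ?thesis by blast
    qed
  qed
qed

lemma fz_nz2: "fz (map fst (nz2 y)) = fz (map fst y)" "fz (map snd (nz2 y)) = fz (map snd y)"
  by (induction y) (auto simp: fz_def nz2_def)

lemma QSym_lookup_fz:
  assumes "f \<in> QSym n" "length p \<le> n" shows "lk f (xmon p) = lk f (xmon (fz p))"
proof -
  have "lk f (xmon (p @ replicate (n - length p) 0)) = lk f (xmon (fz (p @ replicate (n - length p) 0)))"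
    using assms(1)[unfolded QSym_iff] assms(2)
    by (elim conjE allE[of _ "p @ replicate (n - length p) 0"]) simp
  then show ?thesis by simp
qed

text \<open>The right side depends on \<open>p\<close> only through \<open>fz p\<close>, which is
  what makes the product quasisymmetric.\<close>

lemma QSym_lookup_mult:
  assumes F: "F \<in> QSym n" and G: "G \<in> QSym n" and p: "length p \<le> n"
  shows "lk (F * G) (xmon p) = (\<Sum>y\<in>decomps (fz p). lk F (xmon (fz (map fst y))) * lk G (xmon (fz (map snd y))))"
proof -
  let ?p = "p @ replicate (n - length p) 0"
  have lp: "length ?p = n" using p by simp
  have fzp: "fz ?p = fz p" by simp
  have pF: "poly_in n F" and pG: "poly_in n G" using F G QSym_iff by blast+
  have "lk (F * G) (xmon ?p) = (\<Sum>y\<in>decomps ?p. lk F (xmon (map fst y)) * lk G (xmon (map snd y)))"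
    by (rule lookup_mult_xmon[OF pF pG lp])
  also have "\<dots> = (\<Sum>y\<in>decomps ?p. lk F (xmon (fz (map fst (nz2 y)))) * lk G (xmon (fz (map snd (nz2 y)))))"
  proof (rule sum.cong[OF refl])
    fix y assume "y \<in> decomps ?p"
    then have "length y = n" using lp by (metis (mono_tags, lifting) decomps_def length_map mem_Collect_eq)
    then show "lk F (xmon (map fst y)) * lk G (xmon (map snd y)) = lk F (xmon (fz (map fst (nz2 y)))) * lk G (xmon (fz (map snd (nz2 y))))"
      using QSym_lookup_fz[OF F] QSym_lookup_fz[OF G] by (simp add: fz_nz2)
  qed
  also have "\<dots> = (\<Sum>y\<in>decomps (fz p). lk F (xmon (fz (map fst y))) * lk G (xmon (fz (map snd y))))"
    using sum.reindex_bij_betw[OF bij_nz2[of ?p], of "\<lambda>y. lk F (xmon (fz (map fst y))) * lk G (xmon (fz (map snd y)))"] fzp by simp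
  finally show ?thesis by simp
qed

lemma QSym_mult:
  assumes F: "F \<in> QSym n" and G: "G \<in> QSym n" shows "F * G \<in> QSym n"
  unfolding QSym_iff
proof (intro conjI allI impI)
  show "poly_in n (F * G)" using F G QSym_iff poly_in_mult by blast
  fix p :: "nat list" assume p: "length p = n"
  have "fz (fz p) = fz p" by (simp add: fz_def)
  then show "lk (F * G) (xmon p) = lk (F * G) (xmon (fz p))"
    using QSym_lookup_mult[OF F G, of p] QSym_lookup_mult[OF F G, of "fz p"] length_fz_le[of p] p by simp
qed

section \<open>Leading terms of quasisymmetric Schur polynomials\<close>

definition sq :: "nat list \<Rightarrow> nat" where "sq p = (\<Sum>a\<leftarrow>p. a * a)"

lemma sq_eq_sum: "sq p = (\<Sum>i<length p. p ! i * p ! i)"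
  by (simp add: sq_def sum_list_sum_nth atLeast0LessThan)

lemma finite_cells [simp]: "finite (cells \<alpha>)"
proof (rule finite_subset)
  show "cells \<alpha> \<subseteq> {1..length \<alpha>} \<times> {1..sum_list \<alpha>}"
  proof
    fix c assume "c \<in> cells \<alpha>"
    then obtain i j where c: "c = (i, j)" "1 \<le> i" "i \<le> length \<alpha>" "1 \<le> j" "j \<le> \<alpha> ! (i - 1)"
      by (auto simp: cells_def)
    then have "\<alpha> ! (i - 1) \<le> sum_list \<alpha>" by (intro elem_le_sum_list) auto
    then show "c \<in> {1..length \<alpha>} \<times> {1..sum_list \<alpha>}" using c by auto
  qed
qed simp

lemma mem_cells: "(i, j) \<in> cells \<alpha> \<longleftrightarrow> 1 \<le> i \<and> i \<le> length \<alpha> \<and> 1 \<le> j \<and> j \<le> \<alpha> ! (i - 1)"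
  by (simp add: cells_def)

lemma lookup_weight: "lk (tableau_weight \<alpha> T) k = card {c \<in> cells \<alpha>. T c = k}"
proof -
  have "lk (tableau_weight \<alpha> T) k = (\<Sum>c\<in>cells \<alpha>. if T c = k then 1 else 0)"
    unfolding tableau_weight_def lookup_sum by (intro sum.cong refl) (simp add: lookup_single when_def)
  also have "\<dots> = card {c \<in> cells \<alpha>. T c = k}"
    by (simp add: sum.If_cases Int_def)
  finally show ?thesis .
qed

lemma finite_tableaux [simp]: "finite {T. is_comp_tableau n \<alpha> T}"
proof (rule finite_subset)
  show "{T. is_comp_tableau n \<alpha> T} \<subseteq> {T. \<forall>c. (c \<in> cells \<alpha> \<longrightarrow> T c \<in> {1..n}) \<and> (c \<notin> cells \<alpha> \<longrightarrow> T c = 0)}"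
    by (auto simp: is_comp_tableau_def)
  show "finite {T. \<forall>c. (c \<in> cells \<alpha> \<longrightarrow> T c \<in> {1..n}) \<and> (c \<notin> cells \<alpha> \<longrightarrow> T c = 0)}"
    by (rule finite_set_of_finite_funs) simp_all
qed

lemma lookup_qsSchur: "lk (qsSchur n \<alpha>) m = of_nat (card {T. is_comp_tableau n \<alpha> T \<and> tableau_weight \<alpha> T = m})"
proof -
  have "lk (qsSchur n \<alpha>) m = (\<Sum>T \<in> {T. is_comp_tableau n \<alpha> T}. if tableau_weight \<alpha> T = m then 1 else 0)"
    unfolding qsSchur_def lookup_sum by (simp add: lookup_single when_def)
  also have "\<dots> = of_nat (card ({T. is_comp_tableau n \<alpha> T} \<inter> {T. tableau_weight \<alpha> T = m}))"
    by (subst sum.If_cases) simp_all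
  finally show ?thesis by (simp add: Int_def)
qed

text \<open>For equal entries the first alternative of the triple rule fails, and the second one
  puts a strict inequality against the weak decrease in a row. In the first column, when the lower
  row is not longer, strict increase takes over.\<close>

lemma tableau_column_distinct:
  assumes T: "is_comp_tableau n \<alpha> T" and c: "(i, k) \<in> cells \<alpha>" "(j, k) \<in> cells \<alpha>" and e: "T (i, k) = T (j, k)"
  shows "i = j"
proof (rule ccontr)
  assume "i \<noteq> j"
  have *: False if ij: "i < j" and c: "(i, k) \<in> cells \<alpha>" "(j, k) \<in> cells \<alpha>" and e: "T (i, k) = T (j, k)" for i j
  proof -
    have ct1: "\<And>i j. (i, j) \<in> cells \<alpha> \<and> (i, j + 1) \<in> cells \<alpha> \<Longrightarrow> T (i, j + 1) \<le> T (i, j)"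
      and ct2: "\<And>i i'. 1 \<le> i \<and> i < i' \<and> i' \<le> length \<alpha> \<Longrightarrow> T (i, 1) < T (i', 1)"
      using T unfolding is_comp_tableau_def by blast+
    have ct3: "(\<alpha> ! (i - 1) \<ge> \<alpha> ! (j - 1) \<and> k \<ge> 2 \<longrightarrow> T (j, k) < T (i, k) \<or> T (i, k - 1) < T (j, k)) \<and>
        (\<alpha> ! (i - 1) < \<alpha> ! (j - 1) \<longrightarrow> T (j, k) < T (i, k) \<or> T (i, k) < T (j, k + 1))"
      using T c ij unfolding is_comp_tableau_def by blast
    show False
    proof (cases "\<alpha> ! (i - 1) < \<alpha> ! (j - 1)")
      case True
      then have "T (i, k) < T (j, k + 1)" using ct3 e by auto
      moreover have "(j, k + 1) \<in> cells \<alpha>" using c True by (auto simp: mem_cells)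
      then have "T (j, k + 1) \<le> T (j, k)" using ct1 c by blast
      ultimately show False using e by simp
    next
      case False
      show False
      proof (cases "k = 1")
        case True
        then have "T (i, 1) < T (j, 1)" using ct2[of i j] c ij by (auto simp: mem_cells)
        then show False using e True by simp
      next
        case k: False
        then have "k \<ge> 2" using c by (auto simp: mem_cells)
        then have "T (i, k - 1) < T (j, k)" using ct3 False e by auto
        moreover have "(i, k - 1) \<in> cells \<alpha>" "k - 1 + 1 = k" using c \<open>k \<ge> 2\<close> by (auto simp: mem_cells)
        then have "T (i, k) \<le> T (i, k - 1)" using ct1[of i "k - 1"] c by simp
        ultimately show False using e by simp
      qed
    qed
  qed
  then show False using \<open>i \<noteq> j\<close> c e by (metis linorder_neqE_nat)
qed

lemma card_fibres:
  assumes "finite C" "finite K" "h ` C \<subseteq> K"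
  shows "card C = (\<Sum>k\<in>K. card {c \<in> C. h c = k})"
  using sum.group[OF assms, of "\<lambda>_. 1 :: nat"] by simp

lemma card_equal_pairs:
  assumes "finite C" "finite K" "h ` C \<subseteq> K"
  shows "card {(c, c'). c \<in> C \<and> c' \<in> C \<and> h c = h c'} = (\<Sum>k\<in>K. card {c \<in> C. h c = k} * card {c \<in> C. h c = k})"
proof -
  have "{(c, c'). c \<in> C \<and> c' \<in> C \<and> h c = h c'} = (\<Union>k\<in>K. {c \<in> C. h c = k} \<times> {c \<in> C. h c = k})"
    using assms(3) by auto
  also have "card \<dots> = (\<Sum>k\<in>K. card ({c \<in> C. h c = k} \<times> {c \<in> C. h c = k}))"
    by (rule card_UN_disjoint) (use assms in auto)
  finally show ?thesis by (simp add: card_cartesian_product)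
qed

lemma card_row: "1 \<le> i \<Longrightarrow> i \<le> length \<alpha> \<Longrightarrow> card {c \<in> cells \<alpha>. fst c = i} = \<alpha> ! (i - 1)"
proof -
  assume "1 \<le> i" "i \<le> length \<alpha>"
  then have "{c \<in> cells \<alpha>. fst c = i} = Pair i ` {1..\<alpha> ! (i - 1)}"
    by (auto simp: cells_def)
  then show ?thesis by (simp add: card_image inj_on_def)
qed

lemma sum_shift1: "(\<Sum>i\<in>{1..n}. g (i - 1)) = (\<Sum>i<n. (g (i :: nat) :: nat))"
  by (rule sum.reindex_bij_witness[where i = Suc and j = "\<lambda>i. i - 1"]) auto

lemma card_cells: "card (cells \<alpha>) = sum_list \<alpha>"
proof -
  have "card (cells \<alpha>) = (\<Sum>i\<in>{1..length \<alpha>}. card {c \<in> cells \<alpha>. fst c = i})"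
    by (rule card_fibres) (auto simp: mem_cells)
  also have "\<dots> = (\<Sum>i\<in>{1..length \<alpha>}. \<alpha> ! (i - 1))" by (rule sum.cong) (use card_row in auto)
  also have "\<dots> = sum_list \<alpha>" using sum_shift1[of "\<lambda>i. \<alpha> ! i" "length \<alpha>"] by (simp add: sum_list_sum_nth atLeast0LessThan)
  finally show ?thesis .
qed

text \<open>The tableau behind the leading monomial \<open>xmon \<alpha>\<close>.\<close>

definition canon :: "nat list \<Rightarrow> nat \<times> nat \<Rightarrow> nat" where
  "canon \<alpha> c = (if c \<in> cells \<alpha> then fst c else 0)"

lemma canon_tableau:
  assumes "length \<alpha> \<le> n" "is_composition \<alpha>"
  shows "is_comp_tableau n \<alpha> (canon \<alpha>)"
  unfolding is_comp_tableau_def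
proof (intro conjI allI ballI impI)
  show "canon \<alpha> (i, 1) < canon \<alpha> (i', 1)" if "1 \<le> i \<and> i < i' \<and> i' \<le> length \<alpha>" for i i'
  proof -
    have "0 < \<alpha> ! (i - 1)" "0 < \<alpha> ! (i' - 1)" using assms(2) that unfolding is_composition_def by (auto intro!: nth_mem)
    then show ?thesis using that by (simp add: canon_def mem_cells)
  qed
  show "canon \<alpha> (j, k) < canon \<alpha> (i, k) \<or> canon \<alpha> (i, k - 1) < canon \<alpha> (j, k)"
    if "(i, k) \<in> cells \<alpha> \<and> (j, k) \<in> cells \<alpha> \<and> i < j" "\<alpha> ! (j - 1) \<le> \<alpha> ! (i - 1) \<and> 2 \<le> k" for i j k
    using that by (auto simp: canon_def mem_cells)
  show "canon \<alpha> (j, k) < canon \<alpha> (i, k) \<or> canon \<alpha> (i, k) < canon \<alpha> (j, k + 1)"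
    if "(i, k) \<in> cells \<alpha> \<and> (j, k) \<in> cells \<alpha> \<and> i < j" "\<alpha> ! (i - 1) < \<alpha> ! (j - 1)" for i j k
    using that by (auto simp: canon_def mem_cells)
qed (use assms in \<open>auto simp: canon_def cells_def\<close>)

lemma canon_weight: "tableau_weight \<alpha> (canon \<alpha>) = xmon \<alpha>"
proof (rule poly_mapping_eqI)
  fix k
  show "lk (tableau_weight \<alpha> (canon \<alpha>)) k = lk (xmon \<alpha>) k"
  proof (cases "1 \<le> k \<and> k \<le> length \<alpha>")
    case True
    have "{c \<in> cells \<alpha>. canon \<alpha> c = k} = {c \<in> cells \<alpha>. fst c = k}" by (auto simp: canon_def)
    then show ?thesis using True card_row by (simp add: lookup_weight lookup_xmon)
  next
    case False
    then have "{c \<in> cells \<alpha>. canon \<alpha> c = k} = {}" by (auto simp: canon_def cells_def)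
    then show ?thesis using False by (auto simp: lookup_weight lookup_xmon)
  qed
qed

text \<open>Pairs of cells with equal entries inject into pairs of cells in a common row: within its
  column, the cell further left is moved to the row of the other one. If this is onto, the sets
  of entries of the columns are nested, which forces the rows to be constant.\<close>

lemma tableau_weight_sq:
  assumes T: "is_comp_tableau n \<alpha> T" and \<alpha>: "is_composition \<alpha>"
    and w: "tableau_weight \<alpha> T = xmon \<gamma>" and \<gamma>: "is_composition \<gamma>"
  shows "sum_list \<gamma> = sum_list \<alpha>" and "sq \<gamma> < sq \<alpha> \<or> \<gamma> = \<alpha> \<and> T = canon \<alpha>"
proof -
  let ?C = "cells \<alpha>"
  have cnt: "card {c \<in> ?C. T c = k} = lk (xmon \<gamma>) k" for k
    using lookup_weight w by metis
  have vals: "T ` ?C \<subseteq> {1..length \<gamma>}"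
  proof clarify
    fix i j assume c: "(i, j) \<in> ?C"
    then have "{c \<in> ?C. T c = T (i, j)} \<noteq> {}" by auto
    then have "card {c \<in> ?C. T c = T (i, j)} \<noteq> 0" by simp
    then show "T (i, j) \<in> {1..length \<gamma>}" unfolding cnt by (auto simp: lookup_xmon split: if_splits)
  qed
  have "card ?C = (\<Sum>k\<in>{1..length \<gamma>}. card {c \<in> ?C. T c = k})"
    by (rule card_fibres) (use vals in auto)
  also have "\<dots> = (\<Sum>k\<in>{1..length \<gamma>}. \<gamma> ! (k - 1))" unfolding cnt by (rule sum.cong) (auto simp: lookup_xmon)
  also have "\<dots> = sum_list \<gamma>" using sum_shift1[of "\<lambda>i. \<gamma> ! i" "length \<gamma>"] by (simp add: sum_list_sum_nth atLeast0LessThan)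
  finally show "sum_list \<gamma> = sum_list \<alpha>" by (simp add: card_cells)
  \<comment> \<open>The number \<open>sq \<gamma>\<close> counts the pairs of cells with equal
    entries, and \<open>sq \<alpha>\<close> the pairs of cells in a common row.\<close>
  define E where "E = {(c, c'). c \<in> ?C \<and> c' \<in> ?C \<and> T c = T c'}"
  define R where "R = {(c, c'). c \<in> ?C \<and> c' \<in> ?C \<and> fst c = fst c'}"
  have cE: "card E = sq \<gamma>"
  proof -
    have "card E = (\<Sum>k\<in>{1..length \<gamma>}. card {c \<in> ?C. T c = k} * card {c \<in> ?C. T c = k})"
      unfolding E_def by (rule card_equal_pairs) (use vals in auto)
    also have "\<dots> = (\<Sum>k\<in>{1..length \<gamma>}. \<gamma> ! (k - 1) * \<gamma> ! (k - 1))"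
      unfolding cnt by (rule sum.cong) (auto simp: lookup_xmon)
    finally show ?thesis using sum_shift1[of "\<lambda>i. \<gamma> ! i * \<gamma> ! i" "length \<gamma>"] by (simp add: sq_eq_sum)
  qed
  have cR: "card R = sq \<alpha>"
  proof -
    have "card R = (\<Sum>k\<in>{1..length \<alpha>}. card {c \<in> ?C. fst c = k} * card {c \<in> ?C. fst c = k})"
      unfolding R_def by (rule card_equal_pairs[OF finite_cells]) (auto simp: mem_cells)
    also have "\<dots> = (\<Sum>k\<in>{1..length \<alpha>}. \<alpha> ! (k - 1) * \<alpha> ! (k - 1))"
      by (rule sum.cong) (use card_row in auto)
    finally show ?thesis using sum_shift1[of "\<lambda>i. \<alpha> ! i * \<alpha> ! i" "length \<alpha>"] by (simp add: sq_eq_sum)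
  qed
  define \<Psi> where "\<Psi> = (\<lambda>(c, c'). if snd c \<le> snd c' then ((fst c', snd c), c') else (c, (fst c, snd c' :: nat)) :: (nat \<times> nat) \<times> (nat \<times> nat))"
  have finR: "finite R" by (rule finite_subset[of _ "?C \<times> ?C"]) (auto simp: R_def)
  have \<Psi>R: "\<Psi> ` E \<subseteq> R" by (auto simp: \<Psi>_def E_def R_def mem_cells split: if_splits)
  have inj: "inj_on \<Psi> E"
  proof (rule inj_onI)
    fix x y assume xy: "x \<in> E" "y \<in> E" "\<Psi> x = \<Psi> y"
    obtain i j i' j' a b a' b' where x: "x = ((i, j), (i', j'))" and y: "y = ((a, b), (a', b'))"
      by (metis surj_pair)
    note e = xy[unfolded x y]
    have jb: "j = b" "j' = b'" using e(3) by (auto simp: \<Psi>_def split: if_splits)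
    have "i = a \<and> i' = a'"
    proof (cases "j \<le> j'")
      case True
      then have "i' = a'" using e(3) jb by (auto simp: \<Psi>_def)
      then have "T (i, j) = T (a, b)" using e(1,2) jb by (auto simp: E_def)
      then have "i = a" using tableau_column_distinct[OF T, of i j a] e(1,2) jb by (auto simp: E_def)
      then show ?thesis using \<open>i' = a'\<close> by simp
    next
      case False
      then have "i = a" using e(3) jb by (auto simp: \<Psi>_def)
      then have "T (i', j') = T (a', b')" using e(1,2) jb by (auto simp: E_def)
      then have "i' = a'" using tableau_column_distinct[OF T, of i' j' a'] e(1,2) jb by (auto simp: E_def)
      then show ?thesis using \<open>i = a\<close> by simp
    qed
    then show "x = y" using x y jb by simp
  qed
  have le: "sq \<gamma> \<le> sq \<alpha>" using card_inj_on_le[OF inj \<Psi>R finR] cE cR by simp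
  show "sq \<gamma> < sq \<alpha> \<or> \<gamma> = \<alpha> \<and> T = canon \<alpha>"
  proof (cases "sq \<gamma> = sq \<alpha>")
    case False then show ?thesis using le by simp
  next
    case True
    have surj: "\<Psi> ` E = R"
      by (rule card_subset_eq[OF finR \<Psi>R]) (use True cE cR card_image[OF inj] in simp)
    \<comment> \<open>Surjectivity at two adjacent cells of a row: each entry of a column also
      occurs in the column to its left.\<close>
    have nest: "\<exists>i. (i, j) \<in> ?C \<and> T (i, j) = T (k, Suc j)" if "(k, Suc j) \<in> ?C" "1 \<le> j" for k j
    proof -
      have "((k, j), (k, Suc j)) \<in> R" using that by (auto simp: R_def mem_cells)
      then obtain c c' where cc: "(c, c') \<in> E" "\<Psi> (c, c') = ((k, j), (k, Suc j))" using surj by (metis imageE surj_pair)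
      then have "snd c = j" "c' = (k, Suc j)" by (auto simp: \<Psi>_def split: if_splits)
      then show ?thesis using cc(1) by (cases c) (auto simp: E_def)
    qed
    define v where "v i = T (i, 1)" for i
    have ct1: "\<And>i j. (i, j) \<in> ?C \<and> (i, j + 1) \<in> ?C \<Longrightarrow> T (i, j + 1) \<le> T (i, j)"
      and ct2: "\<And>i i'. 1 \<le> i \<and> i < i' \<and> i' \<le> length \<alpha> \<Longrightarrow> v i < v i'"
      and ct3: "\<And>i j k. (i, k) \<in> ?C \<and> (j, k) \<in> ?C \<and> i < j \<Longrightarrow>
         \<alpha> ! (i - 1) < \<alpha> ! (j - 1) \<Longrightarrow> T (j, k) < T (i, k) \<or> T (i, k) < T (j, k + 1)"
      using T unfolding is_comp_tableau_def v_def by blast+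
    have rows: "T (i, j) = v i" if "(i, j) \<in> ?C" for i j
      using that
    proof (induction j arbitrary: i)
      case 0 then show ?case by (simp add: mem_cells)
    next
      case (Suc j)
      show ?case
      proof (cases "j = 0")
        case True then show ?thesis by (simp add: v_def)
      next
        case j: False
        from Suc.prems show ?thesis
        proof (induction i rule: less_induct)
          case (less i)
          obtain k where k: "(k, j) \<in> ?C" "T (k, j) = T (i, Suc j)" using nest[OF less.prems] j by auto
          have ij: "(i, j) \<in> ?C" using less.prems j by (auto simp: mem_cells)
          have vk: "T (i, Suc j) = v k" "T (i, j) = v i" using k Suc.IH ij by metis+
          have "v k \<le> v i" using ct1[of i j] ij less.prems vk by simp
          moreover have "v i < v k" if "i < k" using ct2[of i k] that k(1) less.prems by (auto simp: mem_cells)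
          ultimately have "k \<le> i" by (meson linorder_not_le)
          show ?case
          \<comment> \<open>For \<open>k < i\<close> there is a contradiction. If row
            \<open>k\<close> reaches column \<open>j + 1\<close>, it repeats the entry there.
            Otherwise row \<open>i\<close> is the longer one, and the triple rule asks for
            \<open>v i < v k\<close> or \<open>v k < v k\<close>.\<close>
          proof (cases "k = i")
            case True then show ?thesis using vk by simp
          next
            case False
            then have ki: "k < i" using \<open>k \<le> i\<close> by simp
            show ?thesis
            proof (cases "(k, Suc j) \<in> ?C")
              case True
              then have "T (k, Suc j) = v k" using less.IH[OF ki] by blast
              then have "k = i" using tableau_column_distinct[OF T True less.prems] vk by simp
              then show ?thesis using ki by simp
            next
              case False
              then have "\<alpha> ! (k - 1) < \<alpha> ! (i - 1)" using k(1) less.prems by (auto simp: mem_cells)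
              then have "T (i, j) < T (k, j) \<or> T (k, j) < T (i, j + 1)" using ct3[of k j i] k(1) ij ki by blast
              moreover have "v k < v i" using ct2[of k i] ki k(1) less.prems by (auto simp: mem_cells)
              ultimately show ?thesis using vk k(2) by simp
            qed
          qed
        qed
      qed
    qed
    have pos: "0 < \<alpha> ! (i - 1)" if "1 \<le> i" "i \<le> length \<alpha>" for i
      using \<alpha> that unfolding is_composition_def by (auto intro!: nth_mem)
    have col1: "(i, 1) \<in> ?C" if "1 \<le> i" "i \<le> length \<alpha>" for i
      using pos[OF that] that by (simp add: mem_cells)
    \<comment> \<open>As rows are constant, the first column contains every entry of
      \<open>T\<close>. These are exactly the numbers up to \<open>length \<gamma>\<close>, because
      \<open>\<gamma>\<close> has no zero entry; and the column increases strictly.\<close>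
    have "map v [1..<Suc (length \<alpha>)] = [1..<Suc (length \<gamma>)]"
    proof (rule sorted_distinct_set_unique)
      have "sorted_wrt (<) (map v [1..<Suc (length \<alpha>)])"
        unfolding sorted_wrt_map
        by (rule sorted_wrt_mono_rel[of _ "(<)"]) (use ct2 in \<open>auto simp del: upt_Suc\<close>)
      then show "sorted (map v [1..<Suc (length \<alpha>)])" "distinct (map v [1..<Suc (length \<alpha>)])"
        using strict_sorted_iff by blast+
      show "set (map v [1..<Suc (length \<alpha>)]) = set [1..<Suc (length \<gamma>)]"
      proof (intro equalityI subsetI)
        fix x assume "x \<in> set (map v [1..<Suc (length \<alpha>)])"
        then obtain i where "1 \<le> i" "i \<le> length \<alpha>" "x = v i" by (auto simp del: upt_Suc)
        then have "x \<in> T ` ?C" using col1 v_def by blast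
        then show "x \<in> set [1..<Suc (length \<gamma>)]" using vals by (auto simp del: upt_Suc)
      next
        fix x assume "x \<in> set [1..<Suc (length \<gamma>)]"
        then have x: "1 \<le> x" "x \<le> length \<gamma>" by (auto simp del: upt_Suc)
        then have "0 < \<gamma> ! (x - 1)" using \<gamma> unfolding is_composition_def by (auto intro!: nth_mem)
        then have "card {c \<in> ?C. T c = x} \<noteq> 0" unfolding cnt using x by (simp add: lookup_xmon)
        then have "{c \<in> ?C. T c = x} \<noteq> {}" by (metis card.empty)
        then obtain i j where "(i, j) \<in> ?C" "T (i, j) = x" by auto
        then have "v i = x" "1 \<le> i" "i \<le> length \<alpha>" using rows by (auto simp: mem_cells)
        then show "x \<in> set (map v [1..<Suc (length \<alpha>)])" by (auto simp del: upt_Suc)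
      qed
    qed (simp_all del: upt_Suc)
    note m = this
    have len: "length \<alpha> = length \<gamma>" using arg_cong[OF m, of length] by (simp del: upt_Suc)
    have vi: "v i = i" if "1 \<le> i" "i \<le> length \<alpha>" for i
      using arg_cong[OF m, of "\<lambda>xs. xs ! (i - 1)"] that len by (simp del: upt_Suc)
    have "T = canon \<alpha>"
    proof (rule ext)
      fix c
      show "T c = canon \<alpha> c"
      proof (cases "c \<in> ?C")
        case True
        then obtain i j where c: "c = (i, j)" "1 \<le> i" "i \<le> length \<alpha>" by (auto simp: cells_def)
        then show ?thesis using True rows vi by (simp add: canon_def)
      next
        case False
        then have "T c = 0" using T unfolding is_comp_tableau_def by blast
        then show ?thesis using False by (simp add: canon_def)
      qed
    qed
    moreover have "\<gamma> = \<alpha>"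
    proof -
      have "xmon \<gamma> = xmon \<alpha>" using w canon_weight \<open>T = canon \<alpha>\<close> by simp
      then show ?thesis using xmon_eq_iff len by simp
    qed
    ultimately show ?thesis by simp
  qed
qed

section \<open>Quasisymmetry by relabelling tableaux\<close>

lemma tableau_relabel:
  assumes T: "is_comp_tableau n \<alpha> T" and \<alpha>: "is_composition \<alpha>"
    and V: "\<And>c. c \<in> cells \<alpha> \<Longrightarrow> T c \<in> V"
    and \<phi>: "\<And>x y. x \<in> V \<Longrightarrow> y \<in> V \<Longrightarrow> x < y \<Longrightarrow> \<phi> x < (\<phi> y :: nat)"
    and \<phi>n: "\<And>x. x \<in> V \<Longrightarrow> 1 \<le> \<phi> x \<and> \<phi> x \<le> n" and \<phi>0: "\<phi> 0 = 0"
  shows "is_comp_tableau n \<alpha> (\<phi> \<circ> T)"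
proof -
  have col1: "(i, 1) \<in> cells \<alpha>" if "1 \<le> i" "i \<le> length \<alpha>" for i
  proof -
    have "0 < \<alpha> ! (i - 1)" using \<alpha> that unfolding is_composition_def by (auto intro!: nth_mem)
    then show ?thesis using that by (simp add: mem_cells)
  qed
  have less: "T c < T d \<Longrightarrow> \<phi> (T c) < \<phi> (T d)" if "c \<in> cells \<alpha>" "d \<in> cells \<alpha>" for c d
    using \<phi> V that by blast
  have le: "T c \<le> T d \<Longrightarrow> \<phi> (T c) \<le> \<phi> (T d)" if "c \<in> cells \<alpha>" "d \<in> cells \<alpha>" for c d
    using less[OF that] by (cases "T c = T d") auto
  have a0: "\<forall>c. c \<notin> cells \<alpha> \<longrightarrow> T c = 0"
    and a1: "\<And>i j. (i, j) \<in> cells \<alpha> \<Longrightarrow> (i, j + 1) \<in> cells \<alpha> \<Longrightarrow> T (i, j + 1) \<le> T (i, j)"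
    and a2: "\<And>i i'. 1 \<le> i \<Longrightarrow> i < i' \<Longrightarrow> i' \<le> length \<alpha> \<Longrightarrow> T (i, 1) < T (i', 1)"
    and a3: "\<And>i j k. (i, k) \<in> cells \<alpha> \<Longrightarrow> (j, k) \<in> cells \<alpha> \<Longrightarrow> i < j \<Longrightarrow>
       (\<alpha> ! (i - 1) \<ge> \<alpha> ! (j - 1) \<and> k \<ge> 2 \<longrightarrow> T (j, k) < T (i, k) \<or> T (i, k - 1) < T (j, k)) \<and>
        (\<alpha> ! (i - 1) < \<alpha> ! (j - 1) \<longrightarrow> T (j, k) < T (i, k) \<or> T (i, k) < T (j, k + 1))"
    using T unfolding is_comp_tableau_def by blast+
  \<comment> \<open>Each condition only compares entries of cells of the diagram:
    \<open>(i, k - 1)\<close> is one, and so is \<open>(j, k + 1)\<close> if row \<open>j\<close> is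
    longer than row \<open>i\<close>. The value 0 outside is never compared.\<close>
  show ?thesis unfolding is_comp_tableau_def comp_apply
  proof (intro conjI allI ballI impI; (elim conjE)?)
    show "\<phi> (T c) = 0" if "c \<notin> cells \<alpha>" for c using a0[rule_format, OF that] \<phi>0 by simp
    show "1 \<le> \<phi> (T c)" "\<phi> (T c) \<le> n" if "c \<in> cells \<alpha>" for c using \<phi>n V that by blast+
    show "\<phi> (T (i, j + 1)) \<le> \<phi> (T (i, j))" if "(i, j) \<in> cells \<alpha>" "(i, j + 1) \<in> cells \<alpha>" for i j
      using le a1 that by blast
    show "\<phi> (T (i, 1)) < \<phi> (T (i', 1))" if "1 \<le> i" "i < i'" "i' \<le> length \<alpha>" for i i'
      using less[OF col1 col1] a2[OF that] that by simp
    show "\<phi> (T (j, k)) < \<phi> (T (i, k)) \<or> \<phi> (T (i, k - 1)) < \<phi> (T (j, k))"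
      if "(i, k) \<in> cells \<alpha>" "(j, k) \<in> cells \<alpha>" "i < j" "\<alpha> ! (j - 1) \<le> \<alpha> ! (i - 1)" "2 \<le> k" for i j k
    proof -
      have "(i, k - 1) \<in> cells \<alpha>" using that by (auto simp: mem_cells)
      then show ?thesis using a3[OF that(1-3)] that less by blast
    qed
    show "\<phi> (T (j, k)) < \<phi> (T (i, k)) \<or> \<phi> (T (i, k)) < \<phi> (T (j, k + 1))"
      if "(i, k) \<in> cells \<alpha>" "(j, k) \<in> cells \<alpha>" "i < j" "\<alpha> ! (i - 1) < \<alpha> ! (j - 1)" for i j k
    proof -
      have "(j, k + 1) \<in> cells \<alpha>" using that by (auto simp: mem_cells)
      then show ?thesis using a3[OF that(1-3)] that less by blast
    qed
  qed
qed

lemma tableau_values: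
  assumes "c \<in> cells \<alpha>"
  shows "lk (tableau_weight \<alpha> T) (T c) \<noteq> 0"
proof -
  have f: "finite {d \<in> cells \<alpha>. T d = T c}" by simp
  have "{d \<in> cells \<alpha>. T d = T c} \<noteq> {}" using assms by blast
  then have "card {d \<in> cells \<alpha>. T d = T c} \<noteq> 0" unfolding card_0_eq[OF f] .
  then show ?thesis by (simp only: lookup_weight) simp
qed

lemma weight_relabel:
  assumes "\<And>c. c \<in> cells \<alpha> \<Longrightarrow> T c \<in> V" "inj_on \<phi> V" "x \<in> V"
  shows "lk (tableau_weight \<alpha> (\<phi> \<circ> T)) (\<phi> x) = lk (tableau_weight \<alpha> T) x"
proof -
  have "{c \<in> cells \<alpha>. (\<phi> \<circ> T) c = \<phi> x} = {c \<in> cells \<alpha>. T c = x}"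
    using assms by (auto dest: inj_onD)
  then show ?thesis by (simp add: lookup_weight)
qed

lemma qsSchur_QSym:
  assumes \<alpha>: "is_composition \<alpha>"
  shows "qsSchur n \<alpha> \<in> QSym n"
  unfolding QSym_def quasisymmetric_def mem_Collect_eq
proof (intro conjI allI impI; (elim conjE)?)
  show "poly_in n (qsSchur n \<alpha>)"
  proof (rule poly_inI)
    fix m assume "lk (qsSchur n \<alpha>) m \<noteq> 0"
    then have "{T. is_comp_tableau n \<alpha> T \<and> tableau_weight \<alpha> T = m} \<noteq> {}"
      unfolding lookup_qsSchur by (rule contrapos_nn) (simp only: card.empty of_nat_0)
    then obtain T where T: "is_comp_tableau n \<alpha> T" "tableau_weight \<alpha> T = m" by blast
    show "ksupp m \<subseteq> {1..n}"
    proof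
      fix k assume "k \<in> ksupp m"
      then have "card {c \<in> cells \<alpha>. T c = k} \<noteq> 0" using T(2) lookup_weight by (metis in_keys_iff)
      then have "{c \<in> cells \<alpha>. T c = k} \<noteq> {}" by (metis card.empty)
      then show "k \<in> {1..n}" using T(1) unfolding is_comp_tableau_def by auto
    qed
  qed
  fix \<gamma> "is" assume \<gamma>: "is_composition \<gamma>" "length \<gamma> \<le> n" and i: "length is = length \<gamma>" "sorted_wrt (<) is" "set is \<subseteq> {1..n}"
  \<comment> \<open>The increasing bijection from \<open>{1..length \<gamma>}\<close> onto
    \<open>set is\<close>, with inverse \<open>h'\<close>. Both fix 0, so that fillings remain 0
    outside the diagram.\<close>
  define h where "h k = (if 1 \<le> k \<and> k \<le> length \<gamma> then is ! (k - 1) else 0)" for k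
  define h' where "h' = (\<lambda>k. if k \<in> set is then inv_into {1..length \<gamma>} h k else 0)"
  let ?V = "{1..length \<gamma>}"
  have hm: "h x < h y" if "x \<in> ?V" "y \<in> ?V" "x < y" for x y
    using that i(1,2) unfolding h_def by (auto simp: sorted_wrt_iff_nth_less)
  have hinj: "inj_on h ?V"
    by (rule inj_onI) (metis hm less_irrefl linorder_neqE_nat)
  have him: "h ` ?V = set is"
  proof (intro equalityI subsetI)
    fix x assume "x \<in> set is"
    then obtain j where "j < length is" "x = is ! j" by (metis in_set_conv_nth)
    then have "x = h (Suc j)" "Suc j \<in> ?V" using i(1) by (auto simp: h_def)
    then show "x \<in> h ` ?V" by blast
  qed (use i(1) in \<open>auto simp: h_def\<close>)
  have h'h: "h' (h x) = x" if "x \<in> ?V" for x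
    using that him hinj by (auto simp: h'_def)
  have hh': "h (h' x) = x" "h' x \<in> ?V" if "x \<in> set is" for x
    using that him h'h by (metis imageE)+
  have h'm: "h' x < h' y" if "x \<in> set is" "y \<in> set is" "x < y" for x y
    using hm[of "h' y" "h' x"] hh' that by (metis less_asym linorder_neqE_nat)
  have h'inj: "inj_on h' (set is)" by (rule inj_onI) (metis hh'(1))
  have dist: "distinct is" using i(2) strict_sorted_iff by blast
  have luh: "lk (monom_of is \<gamma>) (h x) = lk (xmon \<gamma>) x" if "x \<in> ?V" for x
    using that lookup_monom_of[OF i(1) dist, of "x - 1"] i(1) by (auto simp: h_def lookup_xmon)
  let ?A = "{T. is_comp_tableau n \<alpha> T \<and> tableau_weight \<alpha> T = xmon \<gamma>}"
  let ?B = "{T. is_comp_tableau n \<alpha> T \<and> tableau_weight \<alpha> T = monom_of is \<gamma>}"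
  have VA: "T c \<in> ?V" if "T \<in> ?A" "c \<in> cells \<alpha>" for T c
    using tableau_values[OF that(2), of T] that(1) by (auto simp: lookup_xmon split: if_splits)
  have VB: "T c \<in> set is" if "T \<in> ?B" "c \<in> cells \<alpha>" for T c
  proof (rule ccontr)
    assume "T c \<notin> set is"
    then show False using tableau_values[OF that(2), of T] that(1) lookup_monom_of_outside[OF i(1)] by simp
  qed
  have z: "h 0 = 0" "h' 0 = 0" using i(3) by (auto simp: h_def h'_def)
  have wz: "lk (tableau_weight \<alpha> T) k = 0" if "\<And>c. c \<in> cells \<alpha> \<Longrightarrow> T c \<noteq> k" for T k
    using that by (simp add: lookup_weight)
  have "bij_betw (\<lambda>T. h \<circ> T) ?A ?B"
  proof (rule bij_betwI[where g = "\<lambda>T. h' \<circ> T"])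
    show "(\<lambda>T. h \<circ> T) \<in> ?A \<rightarrow> ?B"
    proof
      fix T assume T: "T \<in> ?A"
      have "is_comp_tableau n \<alpha> (h \<circ> T)"
      proof (rule tableau_relabel[where V = ?V])
        show "1 \<le> h x \<and> h x \<le> n" if "x \<in> ?V" for x
        proof -
          have "h x \<in> set is" using him that by blast
          then show ?thesis using i(3) by (simp add: subset_iff)
        qed
      qed (use T \<alpha> VA hm z in auto)
      moreover have "tableau_weight \<alpha> (h \<circ> T) = monom_of is \<gamma>"
      proof (rule poly_mapping_eqI)
        fix k
        show "lk (tableau_weight \<alpha> (h \<circ> T)) k = lk (monom_of is \<gamma>) k"
        proof (cases "k \<in> set is")
          case True
          then obtain x where x: "x \<in> ?V" "k = h x" using him by blast
          have "lk (tableau_weight \<alpha> (h \<circ> T)) (h x) = lk (tableau_weight \<alpha> T) x"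
            by (rule weight_relabel[where V = ?V]) (use VA[OF T] hinj x in blast)+
          then show ?thesis using T x luh by simp
        next
          case False
          have "(h \<circ> T) c \<noteq> k" if "c \<in> cells \<alpha>" for c
            using VA[OF T that] him False by auto
          then show ?thesis using wz lookup_monom_of_outside[OF i(1) False] by simp
        qed
      qed
      ultimately show "h \<circ> T \<in> ?B" by simp
    qed
    show "(\<lambda>T. h' \<circ> T) \<in> ?B \<rightarrow> ?A"
    proof
      fix T assume T: "T \<in> ?B"
      have "is_comp_tableau n \<alpha> (h' \<circ> T)"
      proof (rule tableau_relabel[where V = "set is"])
        show "1 \<le> h' x \<and> h' x \<le> n" if "x \<in> set is" for x using hh'(2)[OF that] \<gamma>(2) by auto
      qed (use T \<alpha> VB h'm z in auto)
      moreover have "tableau_weight \<alpha> (h' \<circ> T) = xmon \<gamma>"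
      proof (rule poly_mapping_eqI)
        fix k
        show "lk (tableau_weight \<alpha> (h' \<circ> T)) k = lk (xmon \<gamma>) k"
        proof (cases "k \<in> ?V")
          case True
          then have hk: "h k \<in> set is" using him by blast
          have "lk (tableau_weight \<alpha> (h' \<circ> T)) (h' (h k)) = lk (tableau_weight \<alpha> T) (h k)"
            by (rule weight_relabel[where V = "set is"]) (use VB[OF T] h'inj hk in blast)+
          then show ?thesis using T True luh h'h by simp
        next
          case False
          have "(h' \<circ> T) c \<noteq> k" if "c \<in> cells \<alpha>" for c
            using hh'(2)[OF VB[OF T that]] False by auto
          then show ?thesis using wz False by (auto simp: lookup_xmon)
        qed
      qed
      ultimately show "h' \<circ> T \<in> ?A" by simp
    qed
    show "h' \<circ> (h \<circ> T) = T" if T: "T \<in> ?A" for T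
    proof (rule ext)
      fix c show "(h' \<circ> (h \<circ> T)) c = T c"
      proof (cases "c \<in> cells \<alpha>")
        case True then show ?thesis using h'h[OF VA[OF T True]] by simp
      next
        case False
        then have "T c = 0" using T unfolding is_comp_tableau_def by blast
        then show ?thesis using z by simp
      qed
    qed
    show "h \<circ> (h' \<circ> T) = T" if T: "T \<in> ?B" for T
    proof (rule ext)
      fix c show "(h \<circ> (h' \<circ> T)) c = T c"
      proof (cases "c \<in> cells \<alpha>")
        case True then show ?thesis using hh'(1)[OF VB[OF T True]] by simp
      next
        case False
        then have "T c = 0" using T unfolding is_comp_tableau_def by blast
        then show ?thesis using z by simp
      qed
    qed
  qed
  then have "card ?A = card ?B" by (rule bij_betw_same_card)
  then show "lk (qsSchur n \<alpha>) (monom_of [1..<length \<gamma> + 1] \<gamma>) = lk (qsSchur n \<alpha>) (monom_of is \<gamma>)"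
    unfolding lookup_qsSchur monom_of_eq_xmon by simp
qed

lemma qsSchur_coeff_self:
  assumes "is_composition \<alpha>" "length \<alpha> \<le> n"
  shows "lk (qsSchur n \<alpha>) (xmon \<alpha>) = 1"
proof -
  have "T = canon \<alpha>" if "is_comp_tableau n \<alpha> T" "tableau_weight \<alpha> T = xmon \<alpha>" for T
    using tableau_weight_sq(2)[OF that(1) assms(1) that(2) assms(1)] by simp
  then have "{T. is_comp_tableau n \<alpha> T \<and> tableau_weight \<alpha> T = xmon \<alpha>} = {canon \<alpha>}"
    using canon_tableau[OF assms(2,1)] canon_weight by blast
  then show ?thesis by (simp add: lookup_qsSchur)
qed

lemma qsSchur_coeff:
  assumes "is_composition \<alpha>" "is_composition \<gamma>" "lk (qsSchur n \<alpha>) (xmon \<gamma>) \<noteq> 0"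
  shows "sum_list \<gamma> = sum_list \<alpha> \<and> (sq \<gamma> < sq \<alpha> \<or> \<gamma> = \<alpha>)"
proof -
  have "{T. is_comp_tableau n \<alpha> T \<and> tableau_weight \<alpha> T = xmon \<gamma>} \<noteq> {}"
    using assms(3) unfolding lookup_qsSchur by (rule contrapos_nn) (simp only: card.empty of_nat_0)
  then obtain T where T: "is_comp_tableau n \<alpha> T" "tableau_weight \<alpha> T = xmon \<gamma>" by blast
  show ?thesis using tableau_weight_sq[OF T(1) assms(1) T(2) assms(2)] by argo
qed

section \<open>Pure and inverting compositions\<close>

text \<open>The tail factorization with lowest letter \<open>b\<close> in place of 1, so that its
  blocks can be removed by induction.\<close>

definition tail_blocks :: "nat \<Rightarrow> nat \<Rightarrow> nat list \<Rightarrow> bool" where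
  "tail_blocks b k w \<longleftrightarrow> (\<exists>\<gamma> m. (\<forall>j \<in> {b..<b + k}. 1 \<le> m j) \<and> (\<forall>x \<in> set \<gamma>. x \<notin> {b..<b + k}) \<and>
      w = \<gamma> @ concat (map (\<lambda>j. replicate (m j) j) (rev [b..<b + k])))"

lemma tail_blocks_Suc:
  "tail_blocks b (Suc k) w \<longleftrightarrow> (\<exists>w' j. w = w' @ replicate j b \<and> 0 < j \<and> b \<notin> set w' \<and> tail_blocks (Suc b) k w')"
proof
  have u: "[b..<b + Suc k] = b # [Suc b..<Suc b + k]" by (simp add: upt_rec)
  {
    assume "tail_blocks b (Suc k) w"
    then obtain \<gamma> m where m: "\<forall>j \<in> {b..<b + Suc k}. 1 \<le> m j" "\<forall>x \<in> set \<gamma>. x \<notin> {b..<b + Suc k}"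
      and w: "w = \<gamma> @ concat (map (\<lambda>j. replicate (m j) j) (rev [b..<b + Suc k]))"
      unfolding tail_blocks_def by blast
    let ?w = "\<gamma> @ concat (map (\<lambda>j. replicate (m j) j) (rev [Suc b..<Suc b + k]))"
    have "w = ?w @ replicate (m b) b" unfolding w u by simp
    moreover have "0 < m b" using m(1) by force
    moreover have "b \<notin> set ?w" using m(2) by auto
    moreover have "tail_blocks (Suc b) k ?w" unfolding tail_blocks_def
      by (rule exI[of _ \<gamma>], rule exI[of _ m]) (use m in auto)
    ultimately show "\<exists>w' j. w = w' @ replicate j b \<and> 0 < j \<and> b \<notin> set w' \<and> tail_blocks (Suc b) k w'" by blast
  next
    assume "\<exists>w' j. w = w' @ replicate j b \<and> 0 < j \<and> b \<notin> set w' \<and> tail_blocks (Suc b) k w'"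
    then obtain w' j \<gamma> m where j: "w = w' @ replicate j b" "0 < j" "b \<notin> set w'"
      and m: "\<forall>i \<in> {Suc b..<Suc b + k}. 1 \<le> m i" "\<forall>x \<in> set \<gamma>. x \<notin> {Suc b..<Suc b + k}"
      and w': "w' = \<gamma> @ concat (map (\<lambda>j. replicate (m j) j) (rev [Suc b..<Suc b + k]))"
      unfolding tail_blocks_def by blast
    have e: "map (\<lambda>i. replicate ((m(b := j)) i) i) (rev [Suc b..<Suc b + k]) = map (\<lambda>i. replicate (m i) i) (rev [Suc b..<Suc b + k])"
      by (rule map_cong) auto
    show "tail_blocks b (Suc k) w" unfolding tail_blocks_def
    proof (rule exI[of _ \<gamma>], rule exI[of _ "m(b := j)"], intro conjI ballI)
      show "1 \<le> (m(b := j)) i" if "i \<in> {b..<b + Suc k}" for i using that m(1) j(2) by auto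
      show "x \<notin> {b..<b + Suc k}" if "x \<in> set \<gamma>" for x
      proof -
        have "x \<noteq> b" using that j(3) w' by auto
        then show ?thesis using m(2) that by auto
      qed
      have "concat (map (\<lambda>i. replicate ((m(b := j)) i) i) (rev [b..<b + Suc k]))
          = concat (map (\<lambda>i. replicate (m i) i) (rev [Suc b..<Suc b + k])) @ replicate j b"
        unfolding u rev.simps map_append e by simp
      then show "w = \<gamma> @ concat (map (\<lambda>i. replicate ((m(b := j)) i) i) (rev [b..<b + Suc k]))"
        unfolding j(1) w' by simp
    qed
  }
qed

lemma tail_blocks_iff: "tail_blocks b k w \<longleftrightarrow> k \<le> tailn b w"
proof (induction k arbitrary: b w)
  case 0
  then show ?case unfolding tail_blocks_def by auto
next
  case (Suc k)
  show ?case unfolding tail_blocks_Suc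
  proof
    assume "\<exists>w' j. w = w' @ replicate j b \<and> 0 < j \<and> b \<notin> set w' \<and> tail_blocks (Suc b) k w'"
    then show "Suc k \<le> tailn b w" using Suc.IH tailn_block by auto
  next
    assume l: "Suc k \<le> tailn b w"
    then have "0 < tailn b w" by simp
    then obtain w' j where w: "w = w' @ replicate j b" "b \<notin> set w'" "0 < j" "tailn b w = Suc (tailn (Suc b) w')"
      by (rule tailn_pos)
    then have "tail_blocks (Suc b) k w'" using l Suc.IH by simp
    then show "\<exists>w' j. w = w' @ replicate j b \<and> 0 < j \<and> b \<notin> set w' \<and> tail_blocks (Suc b) k w'" using w by blast
  qed
qed

lemma pure_iff: "pure \<alpha> \<longleftrightarrow> even (tailn 1 \<alpha>)"
proof -
  have s: "{1..k} = {1..<1 + k}" "[1..<k + 1] = [1..<1 + k]" for k :: nat by auto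
  have "tail_factor \<alpha> k \<longleftrightarrow> k \<le> tailn 1 \<alpha>" for k
    unfolding tail_blocks_iff[symmetric] tail_factor_def tail_blocks_def s ..
  then have "(GREATEST k. tail_factor \<alpha> k) = tailn 1 \<alpha>" by (intro Greatest_equality) auto
  then show ?thesis by (simp add: pure_def)
qed

lemma bef_nth: "bef i j w \<longleftrightarrow> (\<exists>s t. s < t \<and> t < length w \<and> w ! s = i \<and> w ! t = j)"
proof
  assume "bef i j w"
  then obtain us vs where w: "w = us @ vs" "i \<in> set us" "j \<in> set vs" unfolding bef_def by blast
  obtain s where s: "s < length us" "us ! s = i" using w(2) by (metis in_set_conv_nth)
  obtain t where t: "t < length vs" "vs ! t = j" using w(3) by (metis in_set_conv_nth)
  show "\<exists>s t. s < t \<and> t < length w \<and> w ! s = i \<and> w ! t = j"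
    by (rule exI[of _ s], rule exI[of _ "length us + t"]) (use s t w in \<open>simp add: nth_append\<close>)
next
  assume "\<exists>s t. s < t \<and> t < length w \<and> w ! s = i \<and> w ! t = j"
  then obtain s t where st: "s < t" "t < length w" "w ! s = i" "w ! t = j" by blast
  have "i \<in> set (take t w)" unfolding in_set_conv_nth by (rule exI[of _ s]) (use st in simp)
  moreover have "j \<in> set (drop t w)" unfolding in_set_conv_nth by (rule exI[of _ 0]) (use st in simp)
  ultimately have "bef i j (take t w @ drop t w)" by (rule bef_append3)
  then show "bef i j w" by simp
qed

lemma inverting_iff: "inverting \<alpha> \<longleftrightarrow> (\<forall>i. 1 < i \<and> (\<exists>a\<in>set \<alpha>. i \<le> a) \<longrightarrow> bef i (i - 1) \<alpha>)"
  unfolding inverting_def bef_nth ..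

text \<open>For \<open>i > 2\<close> the precedences are those of \<open>\<beta>\<close>, shifted.
  For \<open>i = 2\<close> the appended 1s serve, since an inverting \<open>\<beta>\<close> with a
  positive entry contains 1.\<close>

lemma inverting_shift:
  assumes "inverting \<beta>" "0 < c"
  shows "inverting (map Suc \<beta> @ replicate c 1)"
  unfolding inverting_iff
proof (intro allI impI; elim conjE)
  fix i :: nat assume i: "1 < i" "\<exists>a\<in>set (map Suc \<beta> @ replicate c 1). i \<le> a"
  then obtain a where a: "a \<in> set \<beta>" "i \<le> Suc a" by auto
  have *: "\<exists>s t. s < t \<and> t < length \<beta> \<and> \<beta> ! s = k \<and> \<beta> ! t = k - 1" if "1 < k" "k \<le> a" for k
    using assms(1) that a unfolding inverting_def by blast
  show "bef i (i - 1) (map Suc \<beta> @ replicate c 1)"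
  proof (cases "i = 2")
    case True
    have "1 \<in> set \<beta>"
    proof (cases "a = 1")
      case False
      then have "bef 2 1 \<beta>" using *[of 2] True a(2) unfolding bef_nth by force
      then show ?thesis using bef_mem[of 2 1 \<beta>] by simp
    qed (use a in simp)
    then have "bef 2 1 (map Suc \<beta> @ replicate c 1)" using assms(2) by (intro bef_append3) force+
    then show ?thesis using True by simp
  next
    case False
    then obtain s t where "s < t" "t < length \<beta>" "\<beta> ! s = i - 1" "\<beta> ! t = i - 1 - 1"
      using *[of "i - 1"] i(1) a(2) by force
    then have "bef i (i - 1) (map Suc \<beta>)" unfolding bef_nth using False i(1)
      by (intro exI[of _ s] exI[of _ t]) auto
    then show ?thesis by (rule bef_append1)
  qed
qed

lemma tailn_shift: "tailn (Suc b) (map Suc w) = tailn b w"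
proof (induction "length w" arbitrary: b w rule: less_induct)
  case less
  show ?case
  proof (cases "tailn b w = 0 \<and> tailn (Suc b) (map Suc w) = 0")
    case False
    then consider "0 < tailn b w" | "0 < tailn (Suc b) (map Suc w)" by auto
    then obtain w' j where w: "w = w' @ replicate j b" "b \<notin> set w'" "0 < j"
    proof cases
      case 1
      then show ?thesis using tailn_pos that by metis
    next
      case 2
      then obtain v j where v: "map Suc w = v @ replicate j (Suc b)" "Suc b \<notin> set v" "0 < j"
        using tailn_pos by metis
      then have "map (\<lambda>a. a - 1) (map Suc w) = map (\<lambda>a. a - 1) v @ replicate j b" by simp
      then have wv: "w = map (\<lambda>a. a - 1) v @ replicate j b" by (simp add: comp_def)
      have "v = take (length v) (map Suc w)" unfolding v(1) by simp
      then have vv: "v = map Suc (take (length v) w)" by (simp add: take_map)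
      have "b \<notin> set (map (\<lambda>a. a - 1) v)" using v(2) by (subst vv, subst (asm) vv) (auto simp: image_iff)
      then show ?thesis using that wv v(3) by blast
    qed
    have "tailn b w = Suc (tailn (Suc b) w')" using w tailn_block by simp
    moreover have "tailn (Suc b) (map Suc w) = Suc (tailn (Suc (Suc b)) (map Suc w'))"
      using tailn_block[of "Suc b" "map Suc w'" j] w by auto
    moreover have "tailn (Suc (Suc b)) (map Suc w') = tailn (Suc b) w'" by (rule less) (use w in simp)
    ultimately show ?thesis by simp
  qed simp
qed

text \<open>The appended 1s form one more complete final block.\<close>

lemma pure_shift:
  assumes "is_composition \<beta>" "0 < c"
  shows "pure (map Suc \<beta> @ replicate c 1) \<longleftrightarrow> \<not> pure \<beta>"
proof -
  have "1 \<notin> set (map Suc \<beta>)" using assms(1) unfolding is_composition_def by auto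
  then have "tailn 1 (map Suc \<beta> @ replicate c 1) = Suc (tailn (Suc 1) (map Suc \<beta>))"
    using assms(2) by (rule tailn_block)
  then show ?thesis unfolding pure_iff using tailn_shift[of 1 \<beta>] by simp
qed

section \<open>Adding a partition along the ranking of positions\<close>

definition prec :: "nat list \<Rightarrow> nat \<Rightarrow> nat \<Rightarrow> bool" where
  "prec \<epsilon> k l \<longleftrightarrow> \<epsilon> ! k > \<epsilon> ! l \<or> \<epsilon> ! k = \<epsilon> ! l \<and> k > l"

definition rk :: "nat list \<Rightarrow> nat \<Rightarrow> nat" where
  "rk \<epsilon> k = card {l. l < length \<epsilon> \<and> prec \<epsilon> l k}"

text \<open>Larger entries receive larger parts, and among equal entries the later position is
  served first; with this choice the sum keeps the ranking.\<close>

definition ladd :: "nat list \<Rightarrow> nat list \<Rightarrow> nat list" where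
  "ladd \<epsilon> \<nu> = map (\<lambda>k. \<epsilon> ! k + \<nu> ! rk \<epsilon> k) [0..<length \<epsilon>]"

lemma prec_trans: "prec \<epsilon> i j \<Longrightarrow> prec \<epsilon> j k \<Longrightarrow> prec \<epsilon> i k"
  and prec_total: "i \<noteq> j \<Longrightarrow> prec \<epsilon> i j \<or> prec \<epsilon> j i"
  and prec_irrefl: "\<not> prec \<epsilon> i i"
  by (auto simp: prec_def)

lemma rk_less: "prec \<epsilon> k l \<Longrightarrow> k < length \<epsilon> \<Longrightarrow> rk \<epsilon> k < rk \<epsilon> l"
proof -
  assume kl: "prec \<epsilon> k l" "k < length \<epsilon>"
  have "{i. i < length \<epsilon> \<and> prec \<epsilon> i k} \<subseteq> {i. i < length \<epsilon> \<and> prec \<epsilon> i l}"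
    using prec_trans[OF _ kl(1)] by blast
  moreover have "k \<in> {i. i < length \<epsilon> \<and> prec \<epsilon> i l}" "k \<notin> {i. i < length \<epsilon> \<and> prec \<epsilon> i k}"
    using kl prec_irrefl by auto
  ultimately have "{i. i < length \<epsilon> \<and> prec \<epsilon> i k} \<subset> {i. i < length \<epsilon> \<and> prec \<epsilon> i l}" by blast
  then show ?thesis unfolding rk_def by (rule psubset_card_mono[rotated]) simp
qed

lemma rk_bound: "k < length \<epsilon> \<Longrightarrow> rk \<epsilon> k < length \<epsilon>"
proof -
  assume k: "k < length \<epsilon>"
  have "{l. l < length \<epsilon> \<and> prec \<epsilon> l k} \<subset> {..<length \<epsilon>}" using k prec_irrefl by blast
  then have "rk \<epsilon> k < card {..<length \<epsilon>}" unfolding rk_def by (rule psubset_card_mono[rotated]) simp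
  then show ?thesis by simp
qed

lemma rk_bij: "bij_betw (rk \<epsilon>) {..<length \<epsilon>} {..<length \<epsilon>}"
proof -
  have i: "inj_on (rk \<epsilon>) {..<length \<epsilon>}"
  proof (rule inj_onI, rule ccontr)
    fix k l assume *: "k \<in> {..<length \<epsilon>}" "l \<in> {..<length \<epsilon>}" "rk \<epsilon> k = rk \<epsilon> l" "k \<noteq> l"
    then show False using prec_total[of k l \<epsilon>] rk_less[of \<epsilon> k l] rk_less[of \<epsilon> l k] by auto
  qed
  then show ?thesis using endo_inj_surj[OF _ _ i] rk_bound by (auto simp: bij_betw_def)
qed

lemma length_ladd [simp]: "length (ladd \<epsilon> \<nu>) = length \<epsilon>" by (simp add: ladd_def)

text \<open>Entries and added parts both decrease weakly along the ranking. Equal sums thus force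
  equal entries, and there the position decides as before.\<close>

lemma prec_ladd:
  assumes "length \<nu> = length \<epsilon>" "sorted_wrt (\<ge>) \<nu>" "k < length \<epsilon>" "l < length \<epsilon>"
  shows "prec (ladd \<epsilon> \<nu>) k l \<longleftrightarrow> prec \<epsilon> k l"
proof -
  have *: "prec (ladd \<epsilon> \<nu>) k l" if "prec \<epsilon> k l" "k < length \<epsilon>" "l < length \<epsilon>" for k l
  proof -
    have "\<nu> ! rk \<epsilon> k \<ge> \<nu> ! rk \<epsilon> l"
      using rk_less[OF that(1,2)] rk_bound[OF that(3)] assms(1,2) by (simp add: sorted_wrt_iff_nth_less)
    then show ?thesis using that by (auto simp: prec_def ladd_def)
  qed
  show ?thesis
  proof (cases "k = l")
    case False
    show ?thesis
    proof (cases "prec \<epsilon> k l")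
      case True
      then show ?thesis using *[OF True assms(3,4)] by simp
    next
      case f: False
      then have "prec (ladd \<epsilon> \<nu>) l k" using *[OF _ assms(4,3)] prec_total[OF False, of \<epsilon>] by blast
      then have "\<not> prec (ladd \<epsilon> \<nu>) k l" using prec_trans[of _ k l k] prec_irrefl by blast
      then show ?thesis using f by simp
    qed
  qed (simp add: prec_irrefl)
qed

lemma sum_list_ladd:
  assumes "length \<nu> = length \<epsilon>"
  shows "sum_list (ladd \<epsilon> \<nu>) = sum_list \<epsilon> + sum_list \<nu>"
proof -
  have "(\<Sum>k<length \<epsilon>. \<nu> ! rk \<epsilon> k) = (\<Sum>k<length \<epsilon>. \<nu> ! k)"
    by (rule sum.reindex_bij_betw[OF rk_bij])
  then show ?thesis using assms
    by (simp add: ladd_def sum_list_sum_nth atLeast0LessThan sum.distrib)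
qed

text \<open>The values along the order \<^term>\<open>prec\<close> decrease by at most one per step, and an inverting
  composition decreases exactly at the ascents of position, so the order determines it.\<close>

lemma inverting_le:
  assumes len: "length \<epsilon>' = length \<epsilon>" and inv: "inverting \<epsilon>" and pos: "is_composition \<epsilon>'"
    and same: "\<And>k l. k < length \<epsilon> \<Longrightarrow> l < length \<epsilon> \<Longrightarrow> prec \<epsilon> k l \<longleftrightarrow> prec \<epsilon>' k l"
    and "k < length \<epsilon>"
  shows "\<epsilon> ! k \<le> \<epsilon>' ! k"
  using assms(5)
proof (induction "length \<epsilon> - rk \<epsilon> k" arbitrary: k rule: less_induct)
  case less
  have k: "k < length \<epsilon>" by fact
  have p: "0 < \<epsilon>' ! k" using pos k len unfolding is_composition_def by (metis nth_mem)
  show ?case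
  proof (rule ccontr)
    assume "\<not> \<epsilon> ! k \<le> \<epsilon>' ! k"
    then have lt: "\<epsilon>' ! k < \<epsilon> ! k" by simp
    then have "1 < \<epsilon> ! k" using p by simp
    moreover have "\<exists>a\<in>set \<epsilon>. \<epsilon> ! k \<le> a" using k by (metis nth_mem order_refl)
    ultimately obtain s t where st: "s < t" "t < length \<epsilon>" "\<epsilon> ! s = \<epsilon> ! k" "\<epsilon> ! t = \<epsilon> ! k - 1"
      using inv unfolding inverting_def by blast
    have kt: "prec \<epsilon> k t" "prec \<epsilon> s t" using st(3,4) \<open>1 < \<epsilon> ! k\<close> by (auto simp: prec_def)
    have "\<epsilon> ! t \<le> \<epsilon>' ! t"
      by (rule less.hyps) (use rk_less[OF kt(1) k] rk_bound[OF st(2)] st(2) in auto)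
    moreover have kt': "prec \<epsilon>' k t" "prec \<epsilon>' s t" using kt same k st(1,2) by auto
    ultimately have eq: "\<epsilon>' ! k = \<epsilon>' ! t" using lt st(4) by (auto simp: prec_def)
    \<comment> \<open>The entries of \<open>\<epsilon>'\<close> at \<open>k\<close> and
      \<open>t\<close> tie, so only the position ranks \<open>k\<close> before \<open>t\<close>.
      Hence \<open>s < t < k\<close>, and \<open>\<epsilon>' ! s\<close> is squeezed between these
      two equal entries; but then \<open>s < t\<close> ranks \<open>s\<close> after
      \<open>t\<close>.\<close>
    then have tk: "t < k" using kt'(1) by (auto simp: prec_def)
    then have "prec \<epsilon> k s" using st(1,3) by (auto simp: prec_def)
    then have "prec \<epsilon>' k s" using same k st(1,2) by auto
    then have "\<epsilon>' ! s \<le> \<epsilon>' ! k" by (auto simp: prec_def)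
    then show False using kt'(2) eq st(1) by (auto simp: prec_def)
  qed
qed

text \<open>The sum reveals the ranking by \<open>prec_ladd\<close>, the ranking determines the
  inverting composition by \<open>inverting_le\<close> in both directions, and subtraction leaves
  the partition.\<close>

lemma ladd_inj:
  assumes "ladd \<epsilon> \<nu> = ladd \<epsilon>' \<nu>'"
    and "is_composition \<epsilon>" "inverting \<epsilon>" "sorted_wrt (\<ge>) \<nu>" "length \<nu> = length \<epsilon>"
    and "is_composition \<epsilon>'" "inverting \<epsilon>'" "sorted_wrt (\<ge>) \<nu>'" "length \<nu>' = length \<epsilon>'"
  shows "\<epsilon> = \<epsilon>' \<and> \<nu> = \<nu>'"
proof -
  have len: "length \<epsilon>' = length \<epsilon>" using arg_cong[OF assms(1), of length] by simp
  have same: "prec \<epsilon> k l \<longleftrightarrow> prec \<epsilon>' k l" if "k < length \<epsilon>" "l < length \<epsilon>" for k l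
    using prec_ladd[OF assms(5,4) that] prec_ladd[OF assms(9,8), of k l] that len assms(1) by simp
  have e: "\<epsilon> = \<epsilon>'"
  proof (rule nth_equalityI)
    show "length \<epsilon> = length \<epsilon>'" using len by simp
    fix k assume k: "k < length \<epsilon>"
    show "\<epsilon> ! k = \<epsilon>' ! k"
      using inverting_le[OF len assms(3,6) same k] inverting_le[OF len[symmetric] assms(7,2), of k] same k len
      by simp
  qed
  moreover have "\<nu> = \<nu>'"
  proof (rule nth_equalityI)
    show "length \<nu> = length \<nu>'" using len assms by simp
    fix i assume "i < length \<nu>"
    then obtain k where k: "k < length \<epsilon>" "i = rk \<epsilon> k"
      using rk_bij[of \<epsilon>] assms(5) unfolding bij_betw_def by (metis imageE lessThan_iff)
    have "ladd \<epsilon> \<nu> ! k = ladd \<epsilon> \<nu>' ! k" using assms(1) e by simp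
    then show "\<nu> ! i = \<nu>' ! i" using k by (simp add: ladd_def)
  qed
  ultimately show ?thesis ..
qed

section \<open>Counting the products\<close>

definition prod_index :: "nat \<Rightarrow> (nat multiset \<times> nat list) set" where
  "prod_index n = {(\<mu>, \<beta>). \<beta> \<in> Bset n \<and> 0 \<notin># \<mu> \<and> size \<mu> \<le> n}"

definition desc :: "nat multiset \<Rightarrow> nat list" where
  "desc \<mu> = rev (sorted_list_of_multiset \<mu>)"

lemma mset_desc [simp]: "mset (desc \<mu>) = \<mu>" by (simp add: desc_def)
lemma length_desc [simp]: "length (desc \<mu>) = size \<mu>" by (metis mset_desc size_mset)
lemma sum_list_desc [simp]: "sum_list (desc \<mu>) = sum_mset \<mu>" by (metis mset_desc sum_mset_sum_list)
lemma sorted_desc: "sorted_wrt (\<ge>) (desc \<mu>)"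
  unfolding desc_def sorted_wrt_rev by simp

text \<open>If the partition is longer than \<open>\<beta>\<close>, one unit is moved from each of its parts to
  the positions of \<open>\<beta>\<close>; this makes \<open>\<beta>\<close> impure, so that the two cases can be told apart.\<close>

definition split_pair :: "nat multiset \<times> nat list \<Rightarrow> nat list \<times> nat list" where
  "split_pair = (\<lambda>(\<mu>, \<beta>). if size \<mu> \<le> length \<beta> then (\<beta>, desc \<mu> @ replicate (length \<beta> - size \<mu>) 0)
     else (map Suc \<beta> @ replicate (size \<mu> - length \<beta>) 1, map (\<lambda>a. a - 1) (desc \<mu>)))"

lemma split_pair_props:
  assumes "(\<mu>, \<beta>) \<in> prod_index n" "split_pair (\<mu>, \<beta>) = (\<epsilon>, \<nu>)"
  shows "is_composition \<epsilon>" "inverting \<epsilon>" "sorted_wrt (\<ge>) \<nu>" "length \<nu> = length \<epsilon>" "length \<epsilon> \<le> n"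
    "sum_list \<epsilon> + sum_list \<nu> = sum_mset \<mu> + sum_list \<beta>"
    "pure \<epsilon> \<longleftrightarrow> size \<mu> \<le> length \<beta>"
proof -
  have \<beta>: "is_composition \<beta>" "length \<beta> \<le> n" "pure \<beta>" "inverting \<beta>" and \<mu>: "0 \<notin># \<mu>" "size \<mu> \<le> n"
    using assms(1) by (auto simp: prod_index_def Bset_def)
  have sd: "sum_list (map (\<lambda>a. a - 1) (desc \<mu>)) + size \<mu> = sum_mset \<mu>"
  proof -
    have "0 \<notin> set xs \<Longrightarrow> sum_list (map (\<lambda>a. a - 1) xs) + length xs = sum_list xs" for xs :: "nat list"
      by (induction xs) auto
    moreover have "0 \<notin> set (desc \<mu>)" using \<mu>(1) by (simp flip: set_mset_mset)
    ultimately show ?thesis by (metis length_desc sum_list_desc)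
  qed
  have ss: "sum_list (map Suc \<beta>) = sum_list \<beta> + length \<beta>" by (induction \<beta>) auto
  show "is_composition \<epsilon>" "length \<nu> = length \<epsilon>" "length \<epsilon> \<le> n"
    using assms(2) \<beta> \<mu> by (auto simp: split_pair_def is_composition_def split: if_splits)
  show "inverting \<epsilon>" using assms(2) \<beta> inverting_shift by (auto simp: split_pair_def split: if_splits)
  have "sorted_wrt (\<ge>) (replicate k (0 :: nat))" for k by (induction k) auto
  moreover have "sorted_wrt (\<lambda>a b. a - 1 \<ge> b - 1) (desc \<mu>)"
    using sorted_desc[of \<mu>] by (rule sorted_wrt_mono_rel[rotated]) simp
  ultimately show "sorted_wrt (\<ge>) \<nu>"
    using assms(2) sorted_desc[of \<mu>]
    by (auto simp: split_pair_def sorted_wrt_append sorted_wrt_map split: if_splits)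
  show "sum_list \<epsilon> + sum_list \<nu> = sum_mset \<mu> + sum_list \<beta>"
    using assms(2) sd ss by (auto simp: split_pair_def sum_list_replicate split: if_splits)
  show "pure \<epsilon> \<longleftrightarrow> size \<mu> \<le> length \<beta>"
    using assms(2) \<beta> pure_shift[OF \<beta>(1), of "size \<mu> - length \<beta>"] by (auto simp: split_pair_def split: if_splits)
qed

lemma split_pair_inj: "inj_on split_pair (prod_index n)"
proof (rule inj_onI)
  fix x y assume xy: "x \<in> prod_index n" "y \<in> prod_index n" "split_pair x = split_pair y"
  obtain \<mu> \<beta> \<mu>' \<beta>' where x: "x = (\<mu>, \<beta>)" and y: "y = (\<mu>', \<beta>')" by (metis surj_pair)
  obtain \<epsilon> \<nu> where s: "split_pair (\<mu>, \<beta>) = (\<epsilon>, \<nu>)" by (metis surj_pair)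
  then have s': "split_pair (\<mu>', \<beta>') = (\<epsilon>, \<nu>)" using xy x y by simp
  have z: "0 \<notin># \<mu>" "0 \<notin># \<mu>'" using xy x y by (auto simp: prod_index_def)
  have c: "is_composition \<beta>" "is_composition \<beta>'" using xy x y by (auto simp: prod_index_def Bset_def)
  show "x = y"
  proof (cases "pure \<epsilon>")
    case True
    then have l: "size \<mu> \<le> length \<beta>" "size \<mu>' \<le> length \<beta>'"
      using split_pair_props(7) xy s s' x y by blast+
    then have b: "\<beta> = \<epsilon>" "\<beta>' = \<epsilon>" and n: "\<nu> = desc \<mu> @ replicate (length \<beta> - size \<mu>) 0"
        "\<nu> = desc \<mu>' @ replicate (length \<beta>' - size \<mu>') 0"
      using s s' by (auto simp: split_pair_def)
    have "mset (fz \<nu>) = \<kappa>" if "\<nu> = desc \<kappa> @ replicate k 0" "0 \<notin># \<kappa>" for \<kappa> k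
    proof -
      have "0 \<notin> set (desc \<kappa>)" using that(2) by (simp flip: set_mset_mset)
      then show ?thesis unfolding that(1) by (simp add: fz_append fz_replicate fz_id)
    qed
    then show ?thesis using n z b x y by metis
  next
    case False
    then have l: "\<not> size \<mu> \<le> length \<beta>" "\<not> size \<mu>' \<le> length \<beta>'"
      using split_pair_props(7) xy s s' x y by blast+
    then have b: "map Suc \<beta> @ replicate (size \<mu> - length \<beta>) 1 = \<epsilon>" "map Suc \<beta>' @ replicate (size \<mu>' - length \<beta>') 1 = \<epsilon>"
      and n: "\<nu> = map (\<lambda>a. a - 1) (desc \<mu>)" "\<nu> = map (\<lambda>a. a - 1) (desc \<mu>')"
      using s s' by (auto simp: split_pair_def)
    have "map Suc \<nu> = desc \<kappa>" if "\<nu> = map (\<lambda>a. a - 1) (desc \<kappa>)" "0 \<notin># \<kappa>" for \<kappa>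
    proof -
      have "0 \<notin> set (desc \<kappa>)" using that(2) by (simp flip: set_mset_mset)
      then have "map (Suc \<circ> (\<lambda>a. a - 1)) (desc \<kappa>) = map id (desc \<kappa>)"
        by (intro map_cong) (auto intro: Suc_pred gr0I)
      then show ?thesis unfolding that(1) by simp
    qed
    then have m: "\<mu> = \<mu>'" using n z by (metis mset_desc)
    have "fz (map (\<lambda>a. a - 1) \<epsilon>) = \<gamma>" if "map Suc \<gamma> @ replicate k 1 = \<epsilon>" "is_composition \<gamma>" for \<gamma> k
    proof -
      have "0 \<notin> set \<gamma>" using that(2) by (auto simp: is_composition_def)
      then show ?thesis unfolding that(1)[symmetric] by (simp add: comp_def fz_append fz_replicate fz_id)
    qed
    then have "\<beta> = \<beta>'" using b c by metis
    then show ?thesis using m x y by simp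
  qed
qed

text \<open>The injection is \<open>split_pair\<close> followed by \<open>ladd\<close>; it preserves
  the degree, and the resulting composition has at most \<open>n\<close> entries.\<close>

lemma card_prod_index:
  assumes fin: "finite {\<alpha>. is_composition \<alpha> \<and> length \<alpha> \<le> n \<and> sum_list \<alpha> \<le> D}" (is "finite ?C")
  shows "finite {(\<mu>, \<beta>) \<in> prod_index n. sum_mset \<mu> + sum_list \<beta> \<le> D}" (is "finite ?I")
    and "card {(\<mu>, \<beta>) \<in> prod_index n. sum_mset \<mu> + sum_list \<beta> \<le> D} \<le> card {\<alpha>. is_composition \<alpha> \<and> length \<alpha> \<le> n \<and> sum_list \<alpha> \<le> D}"
proof -
  let ?h = "\<lambda>x. case split_pair x of (\<epsilon>, \<nu>) \<Rightarrow> ladd \<epsilon> \<nu>"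
  have inj: "inj_on ?h ?I"
  proof (rule inj_onI)
    fix x y assume xy: "x \<in> ?I" "y \<in> ?I" "?h x = ?h y"
    obtain \<mu> \<beta> \<mu>' \<beta>' where x: "x = (\<mu>, \<beta>)" and y: "y = (\<mu>', \<beta>')" by (metis surj_pair)
    obtain \<epsilon> \<nu> \<epsilon>' \<nu>' where s: "split_pair x = (\<epsilon>, \<nu>)" "split_pair y = (\<epsilon>', \<nu>')" by (metis surj_pair)
    have i: "(\<mu>, \<beta>) \<in> prod_index n" "(\<mu>', \<beta>') \<in> prod_index n" using xy(1,2) x y by auto
    note p = split_pair_props[OF i(1) s(1)[unfolded x]] split_pair_props[OF i(2) s(2)[unfolded y]]
    have "\<epsilon> = \<epsilon>' \<and> \<nu> = \<nu>'"
      by (rule ladd_inj) (use xy(3) s p in simp_all)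
    then show "x = y" using s split_pair_inj i x y by (metis inj_onD)
  qed
  have im: "?h ` ?I \<subseteq> ?C"
  proof
    fix z assume "z \<in> ?h ` ?I"
    then obtain \<mu> \<beta> where i: "(\<mu>, \<beta>) \<in> prod_index n" "sum_mset \<mu> + sum_list \<beta> \<le> D" "z = ?h (\<mu>, \<beta>)" by auto
    obtain \<epsilon> \<nu> where s: "split_pair (\<mu>, \<beta>) = (\<epsilon>, \<nu>)" by (metis surj_pair)
    note p = split_pair_props[OF i(1) s]
    have z: "z = ladd \<epsilon> \<nu>" using i(3) s by simp
    have "is_composition z" using p(1) unfolding z is_composition_def ladd_def by (auto intro!: add_pos_nonneg)
    then show "z \<in> ?C" using z p sum_list_ladd[OF p(4)] i(2) by simp
  qed
  show "finite ?I" using inj_on_finite[OF inj im fin] .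
  show "card ?I \<le> card ?C" using card_inj_on_le[OF inj im fin] .
qed

section \<open>Spanning\<close>

lemma scal_mult: "scal c f = Poly_Mapping.single 0 c * f"
  unfolding scal_def by (rule mult_map_scale_conv_mult)

lemma scal_mult_left: "scal c f * g = scal c (f * g)"
  and scal_mult_right: "f * scal c g = scal c (f * g)"
  by (simp_all add: scal_mult ac_simps)

interpretation qv: vector_space scal
  by unfold_locales (auto intro!: poly_mapping_eqI simp: lookup_add algebra_simps)

interpretation qp: vector_space_pair scal "(*) :: rat \<Rightarrow> rat \<Rightarrow> rat"
  by unfold_locales (auto simp: algebra_simps)

lemma separating_functional:
  assumes "x \<notin> qv.span S"
  shows "\<exists>g. Vector_Spaces.linear scal (*) g \<and> (\<forall>y\<in>S. g y = (0 :: rat)) \<and> g x = 1"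
proof -
  obtain B where B: "B \<subseteq> S" "qv.independent B" "S \<subseteq> qv.span B" by (rule qv.maximal_independent_subset)
  have xB: "x \<notin> qv.span B" using assms qv.span_mono[OF B(1)] by blast
  have "qv.independent (insert x B)" by (rule qv.independent_insertI[OF xB B(2)])
  from qp.linear_independent_extend[OF this, of "\<lambda>y. if y = x then 1 else 0"]
  obtain g where g: "Vector_Spaces.linear scal (*) g" "\<forall>y\<in>insert x B. g y = (if y = x then 1 else 0)" by blast
  have "x \<notin> B" using xB qv.span_base by blast
  then have "g y = 0" if "y \<in> B" for y using g(2) that by auto
  then have "g y = 0" if "y \<in> qv.span B" for y using qp.linear_eq_0_on_span[OF g(1) _ that] by blast
  then show ?thesis using B(3) g by (intro exI[of _ g]) auto
qed

lemma xmon_replicate_0: "xmon (replicate n 0) = 0"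
  using xmon_append_zeros[of "[]" n] by (simp add: xmon_def)

lemma fz_eq_Nil: "fz p = [] \<longleftrightarrow> p = replicate (length p) 0"
  by (induction p) (auto simp: fz_def)

lemma sum_list_fz: "sum_list (fz p) = sum_list p"
  by (induction p) (auto simp: fz_def)

lemma fz_composition_id: "is_composition \<alpha> \<Longrightarrow> fz \<alpha> = \<alpha>"
  unfolding is_composition_def by (intro fz_id) blast

lemma zero_notin_fz: "0 \<notin> set (fz p)"
  by (simp add: fz_def)

lemma MS_empty: "MS n {#} = 1"
proof (rule poly_eqI)
  show "poly_in n (MS n {#})" unfolding MS_def by (rule poly_in_cls)
  show "poly_in n 1" by (rule poly_inI) (simp add: lookup_one when_def split: if_splits)
  fix p :: "nat list" assume p: "length p = n"
  have "xmon p = 0 \<longleftrightarrow> p = replicate n 0"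
    using xmon_eq_iff[of p "replicate n 0"] p xmon_replicate_0 by simp
  then show "lk (MS n {#}) (xmon p) = lk 1 (xmon p)"
    using p fz_eq_Nil[of p] by (simp add: lookup_MS lookup_one when_def)
qed

lemma lookup_MS_le: "length p \<le> n \<Longrightarrow> lk (MS n \<mu>) (xmon p) = (if mset (fz p) = \<mu> then 1 else 0)"
  using lookup_MS[of "p @ replicate (n - length p) 0" n \<mu>] by (simp add: fz_append fz_replicate)

lemma lookup_MQ_le: "length p \<le> n \<Longrightarrow> lk (MQ n \<alpha>) (xmon p) = (if fz p = \<alpha> then 1 else 0)"
  using lookup_MQ[of "p @ replicate (n - length p) 0" n \<alpha>] by (simp add: fz_append fz_replicate)

section \<open>Symmetric multiples of the products\<close>

definition partitions :: "nat \<Rightarrow> nat multiset set" where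
  "partitions n = {\<mu>. 0 \<notin># \<mu> \<and> size \<mu> \<le> n}"

lemma mset_fz_partition: "length p = n \<Longrightarrow> mset (fz p) \<in> partitions n"
  using zero_notin_fz[of p] length_filter_le[of "\<lambda>a. a \<noteq> 0" p]
  unfolding partitions_def fz_def by (auto simp del: mset_filter)

text \<open>The product is symmetric, so by \<open>Sym_expand\<close> only the degree of the
  monomials that occur has to be determined.\<close>

lemma MS_mult:
  "MS n \<mu> * MS n \<nu> \<in> qv.span (MS n ` {\<kappa> \<in> partitions n. sum_mset \<kappa> = sum_mset \<mu> + sum_mset \<nu>})"
proof -
  let ?F = "MS n \<mu> * MS n \<nu>"
  have P: "poly_in n (MS n \<mu>)" for \<mu> unfolding MS_def by (rule poly_in_cls)
  have "mset (fz p) \<in> {\<kappa> \<in> partitions n. sum_mset \<kappa> = sum_mset \<mu> + sum_mset \<nu>}" if "p \<in> supp n ?F" for p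
  proof -
    have p: "length p = n" "lk ?F (xmon p) \<noteq> 0" using that by (auto simp: supp_def)
    obtain y where y: "y \<in> decomps p" "lk (MS n \<mu>) (xmon (map fst y)) * lk (MS n \<nu>) (xmon (map snd y)) \<noteq> 0"
      using p(2) unfolding lookup_mult_xmon[OF P P p(1)] by (rule sum.not_neutral_contains_not_neutral)
    have yp: "map (\<lambda>(a, b). a + b) y = p" using y(1) by (simp add: decomps_def)
    then have "length y = n" using p(1) by auto
    then have "mset (fz (map fst y)) = \<mu>" "mset (fz (map snd y)) = \<nu>"
      using y(2) by (auto simp: lookup_MS split: if_splits)
    then have "sum_list (map fst y) = sum_mset \<mu>" "sum_list (map snd y) = sum_mset \<nu>"
      using sum_list_fz sum_mset_sum_list by metis+
    moreover have "sum_list p = sum_list (map fst y) + sum_list (map snd y)"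
      unfolding yp[symmetric] by (induction y) auto
    ultimately show ?thesis using mset_fz_partition[OF p(1)] by (simp add: sum_mset_sum_list sum_list_fz)
  qed
  then have "(\<Sum>\<kappa> \<in> (\<lambda>p. mset (fz p)) ` supp n ?F. scal (lk ?F (xmon (sorted_list_of_multiset \<kappa>))) (MS n \<kappa>))
     \<in> qv.span (MS n ` {\<kappa> \<in> partitions n. sum_mset \<kappa> = sum_mset \<mu> + sum_mset \<nu>})"
    by (intro qv.span_sum qv.span_scale qv.span_base) blast
  then show ?thesis using Sym_expand[OF Sym_mult[OF MS_Sym MS_Sym], of n \<mu> \<nu>] by simp
qed

definition prodp :: "nat \<Rightarrow> nat multiset \<times> nat list \<Rightarrow> qpoly" where
  "prodp n = (\<lambda>(\<mu>, \<beta>). MS n \<mu> * qsSchur n \<beta>)"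

definition pspan :: "nat \<Rightarrow> nat \<Rightarrow> qpoly set" where
  "pspan n d = qv.span (prodp n ` {(\<mu>, \<beta>) \<in> prod_index n. sum_mset \<mu> + sum_list \<beta> = d})"

lemma prod_index_iff: "(\<mu>, \<beta>) \<in> prod_index n \<longleftrightarrow> \<mu> \<in> partitions n \<and> \<beta> \<in> Bset n"
  by (auto simp: prod_index_def partitions_def)

lemma span_mult_right:
  assumes "f \<in> qv.span S" "\<And>x. x \<in> S \<Longrightarrow> x * g \<in> qv.span T"
  shows "f * g \<in> qv.span T"
  using assms(1)
proof (induction rule: qv.span_induct_alt)
  case base then show ?case by (simp add: qv.span_zero)
next
  case (step c x y)
  then show ?case using assms(2) by (simp add: distrib_right scal_mult_left qv.span_add qv.span_scale)
qed

lemma MS_mult_prodp: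
  assumes "(\<mu>, \<beta>) \<in> prod_index n"
  shows "MS n \<nu> * prodp n (\<mu>, \<beta>) \<in> qv.span (prodp n ` ({\<kappa> \<in> partitions n. sum_mset \<kappa> = sum_mset \<nu> + sum_mset \<mu>} \<times> {\<beta>}))"
proof -
  have "MS n \<nu> * MS n \<mu> * qsSchur n \<beta> \<in> qv.span (prodp n ` ({\<kappa> \<in> partitions n. sum_mset \<kappa> = sum_mset \<nu> + sum_mset \<mu>} \<times> {\<beta>}))"
    by (rule span_mult_right[OF MS_mult]) (auto simp: prodp_def intro!: qv.span_base)
  then show ?thesis by (simp add: prodp_def mult.assoc)
qed

lemma MS_mult_pspan:
  assumes "x \<in> pspan n d"
  shows "MS n \<nu> * x \<in> pspan n (sum_mset \<nu> + d)"
proof -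
  have "x * MS n \<nu> \<in> pspan n (sum_mset \<nu> + d)"
    unfolding pspan_def
  proof (rule span_mult_right[OF assms[unfolded pspan_def]])
    fix x assume "x \<in> prodp n ` {(\<mu>, \<beta>) \<in> prod_index n. sum_mset \<mu> + sum_list \<beta> = d}"
    then obtain \<mu> \<beta> where x: "x = prodp n (\<mu>, \<beta>)" "(\<mu>, \<beta>) \<in> prod_index n" "sum_mset \<mu> + sum_list \<beta> = d" by auto
    have "{\<kappa> \<in> partitions n. sum_mset \<kappa> = sum_mset \<nu> + sum_mset \<mu>} \<times> {\<beta>}
        \<subseteq> {(\<mu>, \<beta>) \<in> prod_index n. sum_mset \<mu> + sum_list \<beta> = sum_mset \<nu> + d}"
      using x(2,3) by (auto simp: prod_index_iff)
    then show "x * MS n \<nu> \<in> qv.span (prodp n ` {(\<mu>, \<beta>) \<in> prod_index n. sum_mset \<mu> + sum_list \<beta> = sum_mset \<nu> + d})"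
      using MS_mult_prodp[OF x(2), of \<nu>] unfolding x(1) by (metis (no_types, lifting) mult.commute image_mono qv.span_mono subsetD)
  qed
  then show ?thesis by (simp add: mult.commute)
qed

section \<open>Leading terms of an elementary symmetric times a monomial quasisymmetric
  polynomial\<close>

definition red :: "nat \<Rightarrow> nat list \<Rightarrow> nat list" where
  "red v w = fz (map (\<lambda>a. if v \<le> a then a - 1 else a) w)"

definition above :: "nat \<Rightarrow> nat list \<Rightarrow> nat" where
  "above v w = length (filter (\<lambda>a. v \<le> a) w)"

text \<open>The decomposition that gives the leading term: first components are exponents taken from
  the elementary symmetric polynomial, one unit for each entry \<ge> \<open>v\<close>.\<close>

definition can :: "nat \<Rightarrow> nat list \<Rightarrow> (nat \<times> nat) list" where
  "can v w = map (\<lambda>a. if v \<le> a then (1, a - 1) else (0, a)) w"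

text \<open>For \<open>e \<le> 1\<close>, passing from \<open>s\<close> to \<open>e + s\<close>
  raises the square by \<open>e * (2 * v - 1) + 2 * e * (s + 1 - v)\<close>, read over the integers.
  The sum of the terms \<open>e * (s + 1 - v)\<close> is at most \<open>exc\<close>, as truncated
  subtraction keeps just the positive ones; \<open>v\<close> acts as a threshold.\<close>

definition exc :: "nat \<Rightarrow> nat list \<Rightarrow> nat" where
  "exc v p = (\<Sum>t\<leftarrow>p. t + 1 - v)"

lemma above_red_filter:
  assumes "1 \<le> u"
  shows "above u (red v w) = length (filter (\<lambda>a. u \<le> (if v \<le> a then a - 1 else a)) w)"
proof -
  have "above u (fz p) = above u p" for p using assms by (induction p) (auto simp: above_def fz_def)
  then show ?thesis by (simp add: red_def above_def filter_map comp_def)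
qed

lemma above_red:
  assumes "1 \<le> v" "1 \<le> u"
  shows "u < v \<Longrightarrow> above u w = above u (red v w)" and "v < u \<Longrightarrow> above u w = above (u - 1) (red v w)"
proof -
  assume "u < v"
  then have "u \<le> (if v \<le> a then a - 1 else a) \<longleftrightarrow> u \<le> a" for a using assms by auto
  then show "above u w = above u (red v w)" using above_red_filter[OF assms(2)] by (simp add: above_def)
next
  assume uv: "v < u"
  then have "1 \<le> u - 1" using assms by simp
  moreover have "u - 1 \<le> (if v \<le> a then a - 1 else a) \<longleftrightarrow> u \<le> a" for a using uv assms by auto
  ultimately show "above u w = above (u - 1) (red v w)" using above_red_filter[of "u - 1" v w] by (simp add: above_def)
qed

lemma above_Suc: "above u w = count (mset w) u + above (Suc u) w"
  by (induction w) (auto simp: above_def)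

text \<open>The numbers \<open>above u\<close> with \<open>u \<ge> 1\<close> determine the content.
  Lowering keeps those with \<open>u < v\<close> and shifts those with \<open>u > v\<close>, so only
  \<open>above v\<close> is lost and has to be given separately.\<close>

lemma mset_eq_of_red:
  assumes "is_composition w" "is_composition w'" "1 \<le> v" "red v w = red v w'" "above v w = above v w'"
  shows "mset w = mset w'"
proof (rule multiset_eqI)
  fix u
  have a: "above u w = above u w'" if "1 \<le> u" for u
  proof -
    consider "u < v" | "u = v" | "v < u" by linarith
    then show ?thesis
    proof cases
      case 1 then show ?thesis using above_red(1)[OF assms(3) that 1] assms(4) by metis
    next
      case 3 then show ?thesis using above_red(2)[OF assms(3) that 3] assms(4) by metis
    qed (use assms(5) in simp)
  qed
  show "count (mset w) u = count (mset w') u"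
  proof (cases "u = 0")
    case True
    have "0 \<notin># mset w" "0 \<notin># mset w'" using assms(1,2) by (auto simp: is_composition_def)
    then show ?thesis by (metis True not_in_iff)
  next
    case False
    then show ?thesis using a[of u] a[of "Suc u"] above_Suc[of u w] above_Suc[of u w'] by simp
  qed
qed

lemma sq_mset: "sq p = (\<Sum>a\<in>#mset p. a * a)" by (induction p) (auto simp: sq_def)
lemma above_mset: "above v w = size (filter_mset ((\<le>) v) (mset w))" by (induction w) (auto simp: above_def)
lemma sq_fz: "sq (fz p) = sq p" by (induction p) (auto simp: sq_def fz_def)
lemma exc_fz: "1 \<le> v \<Longrightarrow> exc v (fz p) = exc v p" by (induction p) (auto simp: exc_def fz_def)

text \<open>Adding \<open>j\<close> units to the entries of a vector increases the sum of squares most if they go to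
  the largest entries.\<close>

lemma sq_bound:
  assumes "1 \<le> v" "\<forall>(e, s)\<in>set y. e \<le> 1"
  shows "sq (map (\<lambda>(e, s). e + s) y) \<le> sq (map snd y) + sum_list (map fst y) * (2 * v - 1) + 2 * exc v (map snd y)
    \<and> (sq (map (\<lambda>(e, s). e + s) y) = sq (map snd y) + sum_list (map fst y) * (2 * v - 1) + 2 * exc v (map snd y)
        \<longleftrightarrow> (\<forall>(e, s)\<in>set y. e = (if v \<le> e + s then 1 else 0)))"
  using assms(2)
proof (induction y)
  case Nil then show ?case by (simp add: sq_def exc_def)
next
  case (Cons c y)
  obtain e s where c: "c = (e, s)" by fastforce
  have "e = 0 \<or> e = 1" using Cons.prems c by auto
  then have *: "(e + s) * (e + s) \<le> s * s + e * (2 * v - 1) + 2 * (s + 1 - v)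
     \<and> ((e + s) * (e + s) = s * s + e * (2 * v - 1) + 2 * (s + 1 - v) \<longleftrightarrow> e = (if v \<le> e + s then 1 else 0))"
    using assms(1) by auto
  define A B where "A = sq (map (\<lambda>(e, s). e + s) y)" and "B = sq (map snd y) + sum_list (map fst y) * (2 * v - 1) + 2 * exc v (map snd y)"
  have AB: "A \<le> B" "A = B \<longleftrightarrow> (\<forall>(e, s)\<in>set y. e = (if v \<le> e + s then 1 else 0))"
    using Cons by (auto simp: A_def B_def)
  have 1: "sq (map (\<lambda>(e, s). e + s) (c # y)) = (e + s) * (e + s) + A" by (simp add: c sq_def A_def)
  have 2: "sq (map snd (c # y)) + sum_list (map fst (c # y)) * (2 * v - 1) + 2 * exc v (map snd (c # y))
     = (s * s + e * (2 * v - 1) + 2 * (s + 1 - v)) + B"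
    by (simp add: c sq_def exc_def B_def add_mult_distrib)
  have 3: "(\<forall>(e, s)\<in>set (c # y). e = (if v \<le> e + s then 1 else 0)) \<longleftrightarrow> e = (if v \<le> e + s then 1 else 0) \<and> A = B"
    unfolding AB(2) by (simp add: c)
  show ?case unfolding 1 2 3 using * AB(1) by linarith
qed

text \<open>Describes the terms of e_j M_\<gamma>: \<open>MS n (replicate_mset j 1)\<close> is the
  elementary symmetric polynomial e_j.\<close>

definition unit_decomp :: "nat \<Rightarrow> nat list \<Rightarrow> (nat \<times> nat) list \<Rightarrow> bool" where
  "unit_decomp j \<gamma> y \<longleftrightarrow> mset (fz (map fst y)) = replicate_mset j 1 \<and> fz (map snd y) = \<gamma>"

lemma can_decomps: "1 \<le> v \<Longrightarrow> can v w \<in> decomps w"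
  unfolding decomps_def can_def by (auto simp: comp_def intro!: map_idI)

lemma can_unit_decomp: "1 \<le> v \<Longrightarrow> unit_decomp j \<gamma> (can v w) \<longleftrightarrow> above v w = j \<and> red v w = \<gamma>"
proof -
  have "mset (fz (map fst (can v w))) = replicate_mset (above v w) 1"
    by (induction w) (auto simp: can_def above_def fz_def)
  moreover have "fz (map snd (can v w)) = red v w"
    unfolding can_def red_def by (simp add: comp_def if_distrib cong: if_cong)
  moreover have "replicate_mset (above v w) (1::nat) = replicate_mset j 1 \<longleftrightarrow> above v w = j"
    by (metis size_replicate_mset)
  ultimately show ?thesis by (simp add: unit_decomp_def)
qed

lemma unit_decomp_sq:
  assumes v: "1 \<le> v" and y: "y \<in> decomps \<alpha>" "unit_decomp j \<gamma> y"
  shows "sq \<alpha> \<le> sq \<gamma> + j * (2 * v - 1) + 2 * exc v \<gamma>"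
    and "sq \<alpha> = sq \<gamma> + j * (2 * v - 1) + 2 * exc v \<gamma> \<longleftrightarrow> y = can v \<alpha>"
    and "sum_list \<alpha> = j + sum_list \<gamma>"
proof -
  have a: "\<alpha> = map (\<lambda>(e, s). e + s) y" using y(1) by (simp add: decomps_def)
  have m: "mset (fz (map fst y)) = replicate_mset j 1" and g: "fz (map snd y) = \<gamma>" using y(2) by (auto simp: unit_decomp_def)
  have le1: "\<forall>(e, s)\<in>set y. e \<le> 1"
  proof clarify
    fix e s assume es: "(e, s) \<in> set y"
    show "e \<le> 1"
    proof (cases "e = 0")
      case False
      have "e \<in> fst ` set y" using es by force
      then have "e \<in> set (fz (map fst y))" using False by (simp add: fz_def)
      then have "e \<in># replicate_mset j 1" unfolding m[symmetric] by simp
      then show ?thesis by (simp split: if_splits)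
    qed simp
  qed
  have sf: "sum_list (map fst y) = j"
    using arg_cong[OF m, of sum_mset] by (simp add: sum_mset_sum_list sum_list_fz)
  have ss: "sq (map snd y) = sq \<gamma>" "exc v (map snd y) = exc v \<gamma>" "sum_list (map snd y) = sum_list \<gamma>"
    using g sq_fz exc_fz[OF v] sum_list_fz by metis+
  note b = sq_bound[OF v le1, folded a, unfolded sf ss]
  show "sq \<alpha> \<le> sq \<gamma> + j * (2 * v - 1) + 2 * exc v \<gamma>" using b by blast
  have "(\<forall>(e, s)\<in>set y. e = (if v \<le> e + s then 1 else 0)) \<longleftrightarrow> y = can v \<alpha>"
  proof -
    have c: "can v \<alpha> = map (\<lambda>(e, s). if v \<le> e + s then (1, e + s - 1) else (0, e + s)) y"
      unfolding can_def a by (simp add: comp_def case_prod_unfold)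
    show ?thesis unfolding c by (induction y) auto
  qed
  then show "sq \<alpha> = sq \<gamma> + j * (2 * v - 1) + 2 * exc v \<gamma> \<longleftrightarrow> y = can v \<alpha>" using b by blast
  have "sum_list \<alpha> = sum_list (map fst y) + sum_list (map snd y)" unfolding a by (induction y) auto
  then show "sum_list \<alpha> = j + sum_list \<gamma>" using sf ss by simp
qed

text \<open>Terms of the product are decompositions into a vector of units and a vector belonging to
  \<open>red v w\<close>. Their sum of squares is at most that of \<open>w\<close>, with equality
  only for \<open>can v \<alpha>\<close>; a single decomposition means coefficient 1.\<close>

lemma mult_coeff:
  assumes v: "1 \<le> v" and w: "is_composition w" "length w \<le> n" and \<alpha>: "is_composition \<alpha>" "length \<alpha> \<le> n"
  defines "F \<equiv> MS n (replicate_mset (above v w) 1) * MQ n (red v w)"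
  shows "mset \<alpha> = mset w \<Longrightarrow> red v \<alpha> = red v w \<Longrightarrow> lk F (xmon \<alpha>) = 1"
    and "lk F (xmon \<alpha>) \<noteq> 0 \<Longrightarrow> sum_list \<alpha> = sum_list w \<and> (sq \<alpha> < sq w \<or> mset \<alpha> = mset w \<and> red v \<alpha> = red v w)"
proof -
  let ?ud = "unit_decomp (above v w) (red v w)"
  let ?B = "sq (red v w) + above v w * (2 * v - 1) + 2 * exc v (red v w)"
  have cw: "?ud (can v w)" using can_unit_decomp[OF v] by simp
  have sqw: "sq w = ?B" using unit_decomp_sq(2)[OF v can_decomps[OF v] cw] by simp
  have "lk F (xmon \<alpha>) = (\<Sum>y\<in>decomps (fz \<alpha>). lk (MS n (replicate_mset (above v w) 1)) (xmon (fz (map fst y))) * lk (MQ n (red v w)) (xmon (fz (map snd y))))"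
    unfolding F_def by (rule QSym_lookup_mult[OF subsetD[OF Sym_subset_QSym MS_Sym] MQ_QSym \<alpha>(2)])
  also have "fz \<alpha> = \<alpha>" by (rule fz_composition_id[OF \<alpha>(1)])
  also have "(\<Sum>y\<in>decomps \<alpha>. lk (MS n (replicate_mset (above v w) 1)) (xmon (fz (map fst y))) * lk (MQ n (red v w)) (xmon (fz (map snd y))))
      = (\<Sum>y\<in>decomps \<alpha>. if ?ud y then 1 else 0)"
  proof (rule sum.cong)
    fix y assume "y \<in> decomps \<alpha>"
    then have "length y = length \<alpha>" unfolding decomps_def by auto
    then have l: "length (fz (map fst y)) \<le> n" "length (fz (map snd y)) \<le> n"
      using \<alpha>(2) length_fz_le[of "map fst y"] length_fz_le[of "map snd y"] by simp_all
    have "fz (fz p) = fz p" for p by (rule fz_id) (rule zero_notin_fz)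
    then show "lk (MS n (replicate_mset (above v w) 1)) (xmon (fz (map fst y))) * lk (MQ n (red v w)) (xmon (fz (map snd y))) = (if ?ud y then 1 else 0)"
      unfolding lookup_MS_le[OF l(1)] lookup_MQ_le[OF l(2)] unit_decomp_def by simp
  qed (rule refl)
  finally have F: "lk F (xmon \<alpha>) = (\<Sum>y\<in>decomps \<alpha>. if ?ud y then 1 else 0)" .
  show "lk F (xmon \<alpha>) = 1" if m: "mset \<alpha> = mset w" and r: "red v \<alpha> = red v w"
  proof -
    have "sq \<alpha> = sq w" unfolding sq_mset m ..
    have "above v \<alpha> = above v w" unfolding above_mset m ..
    then have ud: "?ud (can v \<alpha>)" using can_unit_decomp[OF v] r by simp
    have "?ud y \<longleftrightarrow> y = can v \<alpha>" if y: "y \<in> decomps \<alpha>" for y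
    proof
      assume "?ud y"
      from unit_decomp_sq(2)[OF v y this] show "y = can v \<alpha>" using \<open>sq \<alpha> = sq w\<close> sqw by simp
    qed (simp only: ud)
    then have "(\<Sum>y\<in>decomps \<alpha>. if ?ud y then 1 else 0) = (\<Sum>y\<in>decomps \<alpha>. if y = can v \<alpha> then 1 else (0 :: rat))"
      by (intro sum.cong refl) simp
    then show ?thesis unfolding F using can_decomps[OF v] by simp
  qed
  show "sum_list \<alpha> = sum_list w \<and> (sq \<alpha> < sq w \<or> mset \<alpha> = mset w \<and> red v \<alpha> = red v w)" if nz: "lk F (xmon \<alpha>) \<noteq> 0"
  proof -
    obtain y where y: "y \<in> decomps \<alpha>" "(if ?ud y then 1 else (0 :: rat)) \<noteq> 0"
      using nz unfolding F by (rule sum.not_neutral_contains_not_neutral)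
    then have ud: "?ud y" by (simp split: if_splits)
    note b = unit_decomp_sq[OF v y(1) ud]
    have "sum_list \<alpha> = sum_list w" using b(3) unit_decomp_sq(3)[OF v can_decomps[OF v] cw] by simp
    moreover have "mset \<alpha> = mset w \<and> red v \<alpha> = red v w" if "\<not> sq \<alpha> < sq w"
    proof -
      have "y = can v \<alpha>" using b(1,2) that sqw by simp
      then have "above v \<alpha> = above v w" "red v \<alpha> = red v w" using ud can_unit_decomp[OF v] by simp_all
      then show ?thesis using mset_eq_of_red[OF \<alpha>(1) w(1) v] by simp
    qed
    ultimately show ?thesis by blast
  qed
qed

section \<open>From leading terms to equations for a functional\<close>

lemma fz_supp:
  assumes "\<alpha> \<in> fz ` supp n F" "F \<in> QSym n"
  shows "is_composition \<alpha>" "length \<alpha> \<le> n" "lk F (xmon \<alpha>) \<noteq> 0"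
proof -
  obtain p where p: "\<alpha> = fz p" "length p = n" "lk F (xmon p) \<noteq> 0" using assms(1) by (auto simp: supp_def)
  show "is_composition \<alpha>" unfolding p(1) by (rule fz_composition)
  show "length \<alpha> \<le> n" using length_fz_le[of p] p by simp
  show "lk F (xmon \<alpha>) \<noteq> 0" using assms(2) p unfolding QSym_iff by metis
qed

lemma supp_fzI:
  assumes "is_composition \<alpha>" "length \<alpha> \<le> n" "lk F (xmon \<alpha>) \<noteq> 0"
  shows "\<alpha> \<in> fz ` supp n F"
proof
  show "\<alpha> = fz (\<alpha> @ replicate (n - length \<alpha>) 0)"
    using assms(1) by (simp add: fz_append fz_replicate fz_composition_id)
  show "\<alpha> @ replicate (n - length \<alpha>) 0 \<in> supp n F" using assms(2,3) by (simp add: supp_def)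
qed

lemma functional_expand:
  assumes "Vector_Spaces.linear scal (*) g" "F \<in> QSym n"
  shows "g F = (\<Sum>\<alpha> \<in> fz ` supp n F. lk F (xmon \<alpha>) * g (MQ n \<alpha>))"
proof -
  have "g F = g (\<Sum>\<alpha> \<in> fz ` supp n F. scal (lk F (xmon \<alpha>)) (MQ n \<alpha>))"
    using QSym_expand[OF assms(2)] by simp
  then show ?thesis by (simp only: qp.linear_sum[OF assms(1)] qp.linear_scale[OF assms(1)])
qed

text \<open>The functional kills the product and all lower terms, so the leading terms, which have
  coefficient 1, sum to zero.\<close>

lemma red_relation:
  assumes lin: "Vector_Spaces.linear scal (*) g" and v: "1 \<le> v"
    and w: "is_composition w" "length w \<le> n"
    and low: "\<And>\<alpha>. is_composition \<alpha> \<Longrightarrow> length \<alpha> \<le> n \<Longrightarrow> sum_list \<alpha> = sum_list w \<Longrightarrow> sq \<alpha> < sq w \<Longrightarrow> g (MQ n \<alpha>) = 0"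
    and z: "g (MS n (replicate_mset (above v w) 1) * MQ n (red v w)) = (0 :: rat)"
  shows "csum (\<lambda>\<alpha>. g (MQ n \<alpha>)) (mset w) (red v) (red v w) = 0"
proof -
  let ?F = "MS n (replicate_mset (above v w) 1) * MQ n (red v w)"
  let ?C = "{\<alpha>. mset \<alpha> = mset w \<and> red v \<alpha> = red v w}"
  let ?A = "fz ` supp n ?F"
  have F: "?F \<in> QSym n" by (rule QSym_mult[OF subsetD[OF Sym_subset_QSym MS_Sym] MQ_QSym])
  have C: "is_composition \<alpha>" "length \<alpha> \<le> n" "lk ?F (xmon \<alpha>) = 1" if "\<alpha> \<in> ?C" for \<alpha>
  proof -
    have m: "mset \<alpha> = mset w" "red v \<alpha> = red v w" using that by auto
    show c: "is_composition \<alpha>" using w(1) mset_eq_setD[OF m(1)] by (simp add: is_composition_def)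
    show l: "length \<alpha> \<le> n" using w(2) mset_eq_length[OF m(1)] by simp
    show "lk ?F (xmon \<alpha>) = 1" by (rule mult_coeff(1)[OF v w c l m])
  qed
  have CA: "?C \<subseteq> ?A"
  proof
    fix \<alpha> assume a: "\<alpha> \<in> ?C"
    show "\<alpha> \<in> ?A" by (rule supp_fzI[OF C(1)[OF a] C(2)[OF a]]) (simp only: C(3)[OF a] one_neq_zero not_False_eq_True)
  qed
  have "0 = (\<Sum>\<alpha>\<in>?A. lk ?F (xmon \<alpha>) * g (MQ n \<alpha>))" using functional_expand[OF lin F] z by simp
  also have "\<dots> = (\<Sum>\<alpha>\<in>?C. lk ?F (xmon \<alpha>) * g (MQ n \<alpha>))"
  proof (rule sum.mono_neutral_right[OF _ CA])
    show "finite ?A" using finite_supp by simp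
    show "\<forall>\<alpha>\<in>?A - ?C. lk ?F (xmon \<alpha>) * g (MQ n \<alpha>) = 0"
    proof
      fix \<alpha> assume a: "\<alpha> \<in> ?A - ?C"
      note s = fz_supp[OF DiffD1[OF a] F]
      have "sum_list \<alpha> = sum_list w \<and> (sq \<alpha> < sq w \<or> mset \<alpha> = mset w \<and> red v \<alpha> = red v w)"
        by (rule mult_coeff(2)[OF v w s])
      then have "g (MQ n \<alpha>) = 0" using low[OF s(1,2)] a by blast
      then show "lk ?F (xmon \<alpha>) * g (MQ n \<alpha>) = 0" by simp
    qed
  qed
  also have "\<dots> = csum (\<lambda>\<alpha>. g (MQ n \<alpha>)) (mset w) (red v) (red v w)"
    unfolding csum_def by (rule sum.cong) (simp_all only: C(3) mult_1_left)
  finally show ?thesis by simp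
qed

lemma qsSchur_relation:
  assumes lin: "Vector_Spaces.linear scal (*) g"
    and w: "is_composition w" "length w \<le> n"
    and low: "\<And>\<alpha>. is_composition \<alpha> \<Longrightarrow> length \<alpha> \<le> n \<Longrightarrow> sum_list \<alpha> = sum_list w \<Longrightarrow> sq \<alpha> < sq w \<Longrightarrow> g (MQ n \<alpha>) = 0"
    and z: "g (qsSchur n w) = (0 :: rat)"
  shows "g (MQ n w) = 0"
proof -
  let ?F = "qsSchur n w"
  have F: "?F \<in> QSym n" by (rule qsSchur_QSym[OF w(1)])
  have one: "lk ?F (xmon w) = 1" by (rule qsSchur_coeff_self[OF w])
  have wA: "{w} \<subseteq> fz ` supp n ?F" using supp_fzI[OF w, of ?F] one by simp
  have "0 = (\<Sum>\<alpha>\<in>fz ` supp n ?F. lk ?F (xmon \<alpha>) * g (MQ n \<alpha>))" using functional_expand[OF lin F] z by simp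
  also have "\<dots> = (\<Sum>\<alpha>\<in>{w}. lk ?F (xmon \<alpha>) * g (MQ n \<alpha>))"
  proof (rule sum.mono_neutral_right[OF _ wA])
    show "finite (fz ` supp n ?F)" using finite_supp by simp
    show "\<forall>\<alpha>\<in>fz ` supp n ?F - {w}. lk ?F (xmon \<alpha>) * g (MQ n \<alpha>) = 0"
    proof
      fix \<alpha> assume a: "\<alpha> \<in> fz ` supp n ?F - {w}"
      note s = fz_supp[OF DiffD1[OF a] F]
      have "sum_list \<alpha> = sum_list w \<and> (sq \<alpha> < sq w \<or> \<alpha> = w)" by (rule qsSchur_coeff[OF w(1) s(1,3)])
      then have "g (MQ n \<alpha>) = 0" using low[OF s(1,2)] a by blast
      then show "lk ?F (xmon \<alpha>) * g (MQ n \<alpha>) = 0" by simp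
    qed
  qed
  finally show ?thesis using one by simp
qed

text \<open>After \<open>v\<close> is identified with \<open>v - 1\<close>, the letter
  \<open>v\<close> is vacant and lowering the larger letters is injective. As
  \<open>v \<ge> 2\<close>, no entry becomes zero.\<close>

lemma red_eq_mgw:
  assumes "is_composition w" "is_composition w'" "2 \<le> v"
  shows "red v w = red v w' \<longleftrightarrow> mgw v w = mgw v w'"
proof -
  let ?d = "\<lambda>a. if v < a then a - 1 else (a :: nat)"
  have r: "red v w = map ?d (mgw v w)" if "is_composition w" for w
  proof -
    have "red v w = map (\<lambda>a. if v \<le> a then a - 1 else a) w"
      unfolding red_def by (rule fz_id) (use that assms(3) in \<open>auto simp: is_composition_def\<close>)
    also have "\<dots> = map ?d (mgw v w)" unfolding mgw_def map_map by (rule map_cong) (use assms(3) in auto)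
    finally show ?thesis .
  qed
  have nv: "v \<notin> set (mgw v w)" for w using assms(3) by (auto simp: mgw_def)
  have dec_inj: "a = b" if "a \<noteq> v" "b \<noteq> v" "?d a = ?d b" for a b
    using that by (cases "v < a"; cases "v < b") auto
  have "inj_on ?d (set (mgw v w) \<union> set (mgw v w'))"
  proof (intro inj_onI)
    fix a b assume ab: "a \<in> set (mgw v w) \<union> set (mgw v w')" "b \<in> set (mgw v w) \<union> set (mgw v w')" "?d a = ?d b"
    show "a = b" by (rule dec_inj[OF _ _ ab(3)]) (use ab(1,2) nv in blast)+
  qed
  then show ?thesis unfolding r[OF assms(1)] r[OF assms(2)] by (rule inj_on_map_eq_map)
qed

text \<open>For \<open>v = 1\<close> the entries 1 become zeros and disappear, while the others are
  lowered injectively.\<close>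

lemma red_1_eq_filter:
  assumes "is_composition w" "is_composition w'"
  shows "red 1 w = red 1 w' \<longleftrightarrow> del 1 w = del 1 w'"
proof -
  have r: "red 1 w = map (\<lambda>a. a - 1) (del 1 w)" if "is_composition w" for w
    using that unfolding is_composition_def red_def by (induction w) (auto simp: fz_def)
  have "inj_on (\<lambda>a. a - 1) (set (del 1 w) \<union> set (del 1 w'))"
  proof (rule inj_onI)
    fix a b assume ab: "a \<in> set (del 1 w) \<union> set (del 1 w')"
      "b \<in> set (del 1 w) \<union> set (del 1 w')" "a - 1 = b - 1"
    then have "0 < a" "0 < b" using assms unfolding is_composition_def by auto
    then show "a = b" using ab(3) by simp
  qed
  then show ?thesis unfolding r[OF assms(1)] r[OF assms(2)] by (rule inj_on_map_eq_map)
qed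

lemma downward_closed_interval:
  assumes "finite S" "0 \<notin> S" "\<And>v :: nat. v \<in> S \<Longrightarrow> 2 \<le> v \<Longrightarrow> v - 1 \<in> S"
  obtains e where "S = {1..<e}"
proof (cases "S = {}")
  case True then show ?thesis using that[of 1] by simp
next
  case False
  have down: "y \<in> S" if "y \<le> Max S" "1 \<le> y" for y
    using that
  proof (induction rule: inc_induct)
    case base then show ?case using Max_in[OF assms(1) False] by simp
  next
    case (step k)
    then show ?case using assms(3)[of "Suc k"] by simp
  qed
  have "S = {1..<Suc (Max S)}"
  proof (intro equalityI subsetI)
    fix x assume x: "x \<in> S"
    then have "x \<noteq> 0" using assms(2) by metis
    then show "x \<in> {1..<Suc (Max S)}" using Max_ge[OF assms(1) x] by simp
  qed (use down in auto)
  then show ?thesis by (rule that)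
qed

lemma MQ_in_pspan:
  assumes "is_composition \<alpha>" "length \<alpha> \<le> n"
  shows "MQ n \<alpha> \<in> pspan n (sum_list \<alpha>)"
  using assms
proof (induction "sum_list \<alpha>" arbitrary: \<alpha> rule: less_induct)
  case less
  show ?case
  proof (rule ccontr)
    assume "MQ n \<alpha> \<notin> pspan n (sum_list \<alpha>)"
    then obtain g where lin: "Vector_Spaces.linear scal (*) g"
      and gen: "\<forall>y \<in> prodp n ` {(\<mu>, \<beta>) \<in> prod_index n. sum_mset \<mu> + sum_list \<beta> = sum_list \<alpha>}. g y = (0 :: rat)"
      and one: "g (MQ n \<alpha>) = 1"
      using separating_functional unfolding pspan_def by blast
    have g0: "g y = 0" if "y \<in> pspan n (sum_list \<alpha>)" for y
      using qp.linear_eq_0_on_span[OF lin bspec[OF gen]] that unfolding pspan_def by blast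
    have "g (MQ n w) = 0" if "is_composition w" "length w \<le> n" "sum_list w = sum_list \<alpha>" for w
      using that
    proof (induction "sq w" arbitrary: w rule: less_induct)
      case IH: (less w)
      define \<phi> where "\<phi> u = g (MQ n u)" for u
      have perm: "is_composition u" "length u \<le> n" "sum_list u = sum_list \<alpha>" "sq u = sq w"
        and low: "\<And>\<gamma>. is_composition \<gamma> \<Longrightarrow> length \<gamma> \<le> n \<Longrightarrow> sum_list \<gamma> = sum_list u \<Longrightarrow> sq \<gamma> < sq u \<Longrightarrow> g (MQ n \<gamma>) = 0"
        if "mset u = mset w" for u
      proof -
        show "is_composition u" using IH.prems(1) mset_eq_setD[OF that] by (simp add: is_composition_def)
        show "length u \<le> n" using IH.prems(2) mset_eq_length[OF that] by simp
        show s: "sum_list u = sum_list \<alpha>" using IH.prems(3) that by (metis sum_mset_sum_list)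
        show q: "sq u = sq w" unfolding sq_mset that ..
        show "g (MQ n \<gamma>) = 0" if "is_composition \<gamma>" "length \<gamma> \<le> n" "sum_list \<gamma> = sum_list u" "sq \<gamma> < sq u" for \<gamma>
          using IH.hyps that s q by simp
      qed
      \<comment> \<open>Since \<open>v\<close> occurs, at least one entry is lowered. So
        \<open>MQ n (red v u)\<close> has smaller degree, lies in the span of its degree by the
        outer induction, and stays in the span after multiplication.\<close>
      have rel: "csum \<phi> (mset w) (red v) (red v u) = 0" if v: "1 \<le> v" "v \<in># mset w" and u: "mset u = mset w" for v u
      proof -
        note p = perm[OF u]
        have "v \<in> set (filter (\<lambda>a. v \<le> a) u)" using v(2) mset_eq_setD[OF u] by simp
        then have pos: "0 < above v u" unfolding above_def by (rule length_pos_if_in_set)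
        have sum: "sum_list u = above v u + sum_list (red v u)"
          by (rule unit_decomp_sq(3)[OF v(1) can_decomps[OF v(1)]]) (simp add: can_unit_decomp[OF v(1)])
        have "length (red v u) \<le> n" using length_fz_le[of "map (\<lambda>a. if v \<le> a then a - 1 else a) u"] p(2) by (simp add: red_def)
        then have "MQ n (red v u) \<in> pspan n (sum_list (red v u))"
          using less.hyps[of "red v u"] fz_composition pos sum p(3) unfolding red_def by simp
        from MS_mult_pspan[OF this, of "replicate_mset (above v u) 1"]
        have "MS n (replicate_mset (above v u) 1) * MQ n (red v u) \<in> pspan n (sum_list \<alpha>)"
          using sum p(3) by simp
        then have "csum (\<lambda>\<alpha>. g (MQ n \<alpha>)) (mset u) (red v) (red v u) = 0"
          by (intro red_relation[OF lin v(1) p(1,2) low[OF u]] g0)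
        then show ?thesis unfolding u \<phi>_def .
      qed
      have csum_0: "csum \<phi> (mset w) \<pi> c = 0"
        if v: "1 \<le> v" "v \<in># mset w" and eq: "\<And>u u'. mset u = mset w \<Longrightarrow> mset u' = mset w \<Longrightarrow> red v u' = red v u \<longleftrightarrow> \<pi> u' = \<pi> u"
        for v and \<pi> :: "nat list \<Rightarrow> nat list" and c
      proof (cases "\<exists>u. mset u = mset w \<and> \<pi> u = c")
        case True
        then obtain u where u: "mset u = mset w" "\<pi> u = c" by blast
        have "mset u' = mset w \<and> \<pi> u' = c \<longleftrightarrow> mset u' = mset w \<and> red v u' = red v u" for u'
          unfolding u(2)[symmetric] by (rule conj_cong[OF refl]) (simp only: eq[OF u(1)])
        then show ?thesis using rel[OF v u(1)] by (simp only: csum_def)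
      next
        case False
        then have "{u'. mset u' = mset w \<and> \<pi> u' = c} = {}" by blast
        then show ?thesis by (simp only: csum_def sum.empty)
      qed
      have mg: "csum \<phi> (mset w) (mgw v) c = 0" if "2 \<le> v" "v \<in># mset w" for v c
      proof (rule csum_0[OF _ that(2)])
        show "1 \<le> v" using that(1) by simp
        show "red v u' = red v u \<longleftrightarrow> mgw v u' = mgw v u" if "mset u = mset w" "mset u' = mset w" for u u'
          by (rule red_eq_mgw[OF perm(1)[OF that(2)] perm(1)[OF that(1)] \<open>2 \<le> v\<close>])
      qed
      have "\<phi> w = 0"
      proof (cases "\<exists>v. 2 \<le> v \<and> v \<in># mset w \<and> v - 1 \<notin># mset w")
        case True
        then obtain v where v: "2 \<le> v" "v \<in># mset w" "v - 1 \<notin># mset w" by blast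
        \<comment> \<open>With a gap below \<open>v\<close> merging is injective on the
          rearrangements, so the relation has a single term.\<close>
        have "u = w" if "mset u = mset w" "mgw v u = mgw v w" for u
        proof -
          have "v - 1 \<notin> set u \<union> set w" using v(3) mset_eq_setD[OF that(1)] by simp
          then have "inj_on (\<lambda>a. if a = v then v - 1 else a) (set u \<union> set w)"
            by (intro inj_onI) (metis (full_types))
          then show ?thesis using that(2) unfolding mgw_def by (simp only: inj_on_map_eq_map)
        qed
        then have "{u. mset u = mset w \<and> mgw v u = mgw v w} = {w}" by blast
        then show ?thesis using mg[OF v(1,2), of "mgw v w"] by (simp add: csum_def)
      next
        case False
        have "0 \<notin> set_mset (mset w)" using IH.prems(1) by (auto simp: is_composition_def)
        then obtain e where e: "set_mset (mset w) = {1..<e}"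
          using downward_closed_interval[of "set_mset (mset w)"] False finite_set_mset by metis
        show ?thesis
        proof (rule words_vanish[OF e _ _ _ refl])
          show "csum \<phi> (mset w) (mgw i) u = 0" if "1 < i" "i < e" for i u
            by (rule mg) (use that e in auto)
          show "csum \<phi> (mset w) (del 1) x = 0" if "mset w \<noteq> {#}" for x
          proof (rule csum_0[of 1])
            show "1 \<in># mset w" using that e by (metis atLeastLessThan_empty_iff atLeastLessThan_iff le_refl set_mset_eq_empty_iff)
            show "red 1 u' = red 1 u \<longleftrightarrow> del 1 u' = del 1 u"
              if "mset u = mset w" "mset u' = mset w" for u u'
              by (rule red_1_eq_filter[OF perm(1)[OF that(2)] perm(1)[OF that(1)]])
          qed simp
          show "\<phi> u = 0" if u: "mset u = mset w" and b: "\<forall>i\<in>{1<..<e}. bef i (i - 1) u" and ev: "even (tailn 1 u)" for u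
          proof -
            note p = perm[OF u]
            have "inverting u" unfolding inverting_iff
            proof (intro allI impI)
              fix i assume i: "1 < i \<and> (\<exists>a\<in>set u. i \<le> a)"
              then obtain a where "a \<in> set u" "i \<le> a" by blast
              then have "a < e" using e mset_eq_setD[OF u] by auto
              then show "bef i (i - 1) u" using b i \<open>i \<le> a\<close> by auto
            qed
            then have "u \<in> Bset n" using p ev by (simp add: Bset_def pure_iff)
            \<comment> \<open>The product for the empty partition is the quasisymmetric Schur
              polynomial itself, so the functional kills it.\<close>
            then have "({#}, u) \<in> prod_index n" by (simp add: prod_index_def)
            then have "prodp n ({#}, u) \<in> prodp n ` {(\<mu>, \<beta>) \<in> prod_index n. sum_mset \<mu> + sum_list \<beta> = sum_list \<alpha>}"
              using p(3) by (intro imageI) simp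
            then have "g (prodp n ({#}, u)) = 0" by (rule bspec[OF gen])
            then have "g (qsSchur n u) = 0" by (simp add: prodp_def MS_empty)
            with low[OF u] show ?thesis unfolding \<phi>_def by (rule qsSchur_relation[OF lin p(1,2)])
          qed
        qed
      qed
      then show ?case by (simp add: \<phi>_def)
    qed
    then show False using one less.prems by simp
  qed
qed

section \<open>Independence\<close>

abbreviation comps :: "nat \<Rightarrow> nat \<Rightarrow> nat list set" where
  "comps n D \<equiv> {\<alpha>. is_composition \<alpha> \<and> length \<alpha> \<le> n \<and> sum_list \<alpha> \<le> D}"

abbreviation prods :: "nat \<Rightarrow> nat \<Rightarrow> (nat multiset \<times> nat list) set" where
  "prods n D \<equiv> {(\<mu>, \<beta>) \<in> prod_index n. sum_mset \<mu> + sum_list \<beta> \<le> D}"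

lemma finite_comps: "finite (comps n D)"
proof (rule finite_subset)
  show "comps n D \<subseteq> {\<alpha>. set \<alpha> \<subseteq> {..D} \<and> length \<alpha> \<le> n}"
    using member_le_sum_list by fastforce
qed (rule finite_lists_length_le, simp)

lemma lookup_MQ_composition:
  "is_composition \<gamma> \<Longrightarrow> length \<gamma> \<le> n \<Longrightarrow> lk (MQ n \<alpha>) (xmon \<gamma>) = (if \<gamma> = \<alpha> then 1 else 0)"
  by (simp add: lookup_MQ_le fz_composition_id)

lemma MQ_inj: "inj_on (MQ n) (comps n D)"
proof (rule inj_onI)
  fix \<alpha> \<gamma> assume a: "\<alpha> \<in> comps n D" "\<gamma> \<in> comps n D" "MQ n \<alpha> = MQ n \<gamma>"
  then have "lk (MQ n \<delta>) (xmon \<alpha>) = (if \<alpha> = \<delta> then 1 else 0)" for \<delta>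
    by (intro lookup_MQ_composition) simp_all
  from this[of \<alpha>] this[of \<gamma>] show "\<alpha> = \<gamma>" unfolding a(3) by (simp split: if_splits)
qed

lemma MQ_independent: "qv.independent (MQ n ` comps n D)"
proof (rule qv.independent_if_scalars_zero)
  show "finite (MQ n ` comps n D)" using finite_comps by simp
  fix f x assume 0: "(\<Sum>x\<in>MQ n ` comps n D. scal (f x) x) = 0" and x: "x \<in> MQ n ` comps n D"
  obtain \<gamma> where g: "\<gamma> \<in> comps n D" "x = MQ n \<gamma>" using x by blast
  have "0 = lk (\<Sum>x\<in>MQ n ` comps n D. scal (f x) x) (xmon \<gamma>)" unfolding 0 by simp
  also have "\<dots> = (\<Sum>\<alpha>\<in>comps n D. f (MQ n \<alpha>) * lk (MQ n \<alpha>) (xmon \<gamma>))"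
    by (simp add: sum.reindex[OF MQ_inj] lookup_sum)
  also have "\<dots> = (\<Sum>\<alpha>\<in>comps n D. if \<alpha> = \<gamma> then f (MQ n \<alpha>) else 0)"
    by (rule sum.cong) (use g in \<open>auto simp: lookup_MQ_composition\<close>)
  also have "\<dots> = f x" using g finite_comps[of n D] by simp
  finally show "f x = 0" by simp
qed

lemma MQ_in_span:
  assumes "\<alpha> \<in> comps n D"
  shows "MQ n \<alpha> \<in> qv.span (prodp n ` prods n D)"
proof -
  have "MQ n \<alpha> \<in> pspan n (sum_list \<alpha>)" using MQ_in_pspan assms by simp
  moreover have "prodp n ` {(\<mu>, \<beta>) \<in> prod_index n. sum_mset \<mu> + sum_list \<beta> = sum_list \<alpha>} \<subseteq> prodp n ` prods n D"
    using assms by (intro image_mono) auto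
  ultimately show ?thesis unfolding pspan_def using qv.span_mono by blast
qed

text \<open>The products span a space of dimension at least their number.\<close>

lemma prods_basis:
  shows "inj_on (prodp n) (prods n D)" and "qv.independent (prodp n ` prods n D)"
proof -
  note I = card_prod_index[OF finite_comps, of n D]
  obtain B where B: "B \<subseteq> prodp n ` prods n D" "qv.independent B" "prodp n ` prods n D \<subseteq> qv.span B"
    by (rule qv.maximal_independent_subset)
  have fin: "finite (prodp n ` prods n D)" using I(1) by simp
  have "qv.span (prodp n ` prods n D) \<subseteq> qv.span B" by (rule qv.span_minimal[OF B(3) qv.subspace_span])
  then have "MQ n ` comps n D \<subseteq> qv.span B" using MQ_in_span by blast
  then have "card (MQ n ` comps n D) \<le> card B"
    using qv.independent_span_bound[OF finite_subset[OF B(1) fin] MQ_independent] by blast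
  then have "card (comps n D) \<le> card B" by (simp only: card_image[OF MQ_inj])
  moreover have "card B \<le> card (prodp n ` prods n D)" by (rule card_mono[OF fin B(1)])
  moreover have "card (prodp n ` prods n D) \<le> card (prods n D)" by (rule card_image_le[OF I(1)])
  \<comment> \<open>By \<open>card_prod_index\<close> there are no more index pairs than
    compositions, so the chain of inequalities closes and equality holds throughout.\<close>
  ultimately have c: "card B = card (prodp n ` prods n D)" "card (prodp n ` prods n D) = card (prods n D)"
    using I(2) by linarith+
  show "inj_on (prodp n) (prods n D)" by (rule eq_card_imp_inj_on[OF I(1) c(2)])
  show "qv.independent (prodp n ` prods n D)" using card_subset_eq[OF fin B(1) c(1)] B(2) by simp
qed

text \<open>A linear relation or a coincidence involves finitely many products, hence takes place in
  bounded degree, where \<open>prods_basis\<close> applies.\<close>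

lemma finite_prods_bound:
  assumes "finite J" "J \<subseteq> prod_index n"
  obtains D where "J \<subseteq> prods n D"
proof
  show "J \<subseteq> prods n (\<Sum>(\<mu>, \<beta>)\<in>J. sum_mset \<mu> + sum_list \<beta>)"
  proof
    fix x assume x: "x \<in> J"
    have "(case x of (\<mu>, \<beta>) \<Rightarrow> sum_mset \<mu> + sum_list \<beta>) \<le> (\<Sum>(\<mu>, \<beta>)\<in>J. sum_mset \<mu> + sum_list \<beta>)"
      by (rule member_le_sum[OF x _ assms(1)]) simp
    then show "x \<in> prods n (\<Sum>(\<mu>, \<beta>)\<in>J. sum_mset \<mu> + sum_list \<beta>)" using x assms(2) by auto
  qed
qed

lemma prodp_inj: "inj_on (prodp n) (prod_index n)"
proof (rule inj_onI)
  fix x y assume xy: "x \<in> prod_index n" "y \<in> prod_index n" "prodp n x = prodp n y"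
  obtain D where "{x, y} \<subseteq> prods n D" by (rule finite_prods_bound[of "{x, y}" n]) (use xy in auto)
  then show "x = y" using inj_onD[OF prods_basis(1) xy(3)] by blast
qed

lemma prodp_independent: "qv.independent (prodp n ` prod_index n)"
proof
  assume "qv.dependent (prodp n ` prod_index n)"
  then obtain t u where t: "finite t" "t \<subseteq> prodp n ` prod_index n" "(\<Sum>v\<in>t. scal (u v) v) = 0" "\<exists>v\<in>t. u v \<noteq> 0"
    unfolding qv.dependent_explicit by blast
  obtain J where J: "J \<subseteq> prod_index n" "finite J" "t = prodp n ` J" using finite_subset_image[OF t(1,2)] by blast
  obtain D where "J \<subseteq> prods n D" by (rule finite_prods_bound[OF J(2,1)])
  then have "t \<subseteq> prodp n ` prods n D" using J(3) by blast
  then have "qv.dependent (prodp n ` prods n D)" unfolding qv.dependent_explicit using t by blast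
  then show False using prods_basis(2) by blast
qed

lemma QSym_span: "f \<in> QSym n \<Longrightarrow> f \<in> qv.span (prodp n ` prod_index n)"
proof -
  assume f: "f \<in> QSym n"
  have "MQ n \<alpha> \<in> qv.span (prodp n ` prod_index n)" if "\<alpha> \<in> fz ` supp n f" for \<alpha>
  proof -
    have "MQ n \<alpha> \<in> qv.span (prodp n ` prods n (sum_list \<alpha>))"
      by (rule MQ_in_span) (use fz_supp[OF that f] in simp)
    then show ?thesis using qv.span_mono[of "prodp n ` prods n (sum_list \<alpha>)" "prodp n ` prod_index n"] by blast
  qed
  then show ?thesis by (subst QSym_expand[OF f]) (intro qv.span_sum qv.span_scale)
qed

section \<open>The ideal and the quotient\<close>

lemma lookup_MS_0: "lk (MS n \<mu>) 0 = (if \<mu> = {#} then 1 else 0)"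
  using lookup_MS_le[of "[]" n \<mu>] by (simp add: xmon_def fz_def)

lemma QSym_scal: "f \<in> QSym n \<Longrightarrow> scal c f \<in> QSym n"
  unfolding QSym_iff using poly_in_scal by simp

lemma Eideal_0: "0 \<in> Eideal n"
  unfolding Eideal_def by (intro CollectI exI[of _ "[]"]) simp

lemma Eideal_add:
  assumes "p \<in> Eideal n" "q \<in> QSym n" "s \<in> Sym n" "lk s 0 = 0"
  shows "q * s + p \<in> Eideal n"
proof -
  obtain qs ss where "length qs = length ss" "set qs \<subseteq> QSym n" "\<forall>s \<in> set ss. s \<in> Sym n \<and> lk s 0 = 0"
      "p = sum_list (map2 (*) qs ss)"
    using assms(1) unfolding Eideal_def by blast
  then show ?thesis unfolding Eideal_def
    by (intro CollectI exI[of _ "q # qs"] exI[of _ "s # ss"]) (use assms in simp)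
qed

text \<open>In an expansion into products, those with nonempty partition lie in the ideal because
  \<open>MS n \<mu>\<close> then has no constant term; the others are quasisymmetric Schur
  polynomials.\<close>

lemma QSym_mod_Eideal:
  assumes "f \<in> QSym n"
  shows "\<exists>s \<in> qv.span (qsSchur n ` Bset n). f - s \<in> Eideal n"
  using QSym_span[OF assms]
proof (induction rule: qv.span_induct_alt)
  case base
  show ?case by (rule bexI[of _ 0]) (simp_all add: Eideal_0 qv.span_zero)
next
  case (step c x y)
  then obtain s where s: "s \<in> qv.span (qsSchur n ` Bset n)" "y - s \<in> Eideal n" by blast
  obtain \<mu> \<beta> where x: "x = MS n \<mu> * qsSchur n \<beta>" "\<beta> \<in> Bset n"
    using step(1) by (auto simp: prodp_def prod_index_def)
  show ?case
  proof (cases "\<mu> = {#}")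
    case True
    then have "x \<in> qv.span (qsSchur n ` Bset n)" using x by (simp add: MS_empty qv.span_base)
    then have "scal c x + s \<in> qv.span (qsSchur n ` Bset n)" using s(1) by (intro qv.span_add qv.span_scale)
    moreover have "scal c x + y - (scal c x + s) \<in> Eideal n" using s(2) by simp
    ultimately show ?thesis by blast
  next
    case False
    have "scal c (qsSchur n \<beta>) \<in> QSym n" using x(2) qsSchur_QSym QSym_scal by (simp add: Bset_def)
    then have "scal c (qsSchur n \<beta>) * MS n \<mu> + (y - s) \<in> Eideal n"
      by (rule Eideal_add[OF s(2) _ MS_Sym]) (simp add: lookup_MS_0 False)
    then have "scal c x + y - s \<in> Eideal n"
      unfolding x(1) by (simp add: scal_mult_left scal_mult_right mult.commute add_diff_eq)
    then show ?thesis using s(1) by blast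
  qed
qed

lemma Sym_positive_span:
  assumes s: "s \<in> Sym n" "lk s 0 = 0"
  shows "s \<in> qv.span (MS n ` {\<nu> \<in> partitions n. \<nu> \<noteq> {#}})"
proof -
  have "scal (lk s (xmon (sorted_list_of_multiset \<mu>))) (MS n \<mu>) \<in> qv.span (MS n ` {\<nu> \<in> partitions n. \<nu> \<noteq> {#}})"
    if "\<mu> \<in> (\<lambda>p. mset (fz p)) ` supp n s" for \<mu>
  proof (cases "\<mu> = {#}")
    case True
    then have "xmon (sorted_list_of_multiset \<mu>) = 0" by (simp add: xmon_def)
    then show ?thesis using s(2) by (simp add: qv.span_zero)
  next
    case False
    then have "\<mu> \<in> {\<nu> \<in> partitions n. \<nu> \<noteq> {#}}" using that mset_fz_partition by (auto simp: supp_def)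
    then show ?thesis by (intro qv.span_scale qv.span_base imageI)
  qed
  then show ?thesis by (subst Sym_expand[OF s(1)]) (intro qv.span_sum)
qed

text \<open>Multiplication by \<open>MS n \<nu>\<close> with \<open>\<nu>\<close> nonempty produces
  only partitions of positive sum, which are nonempty.\<close>

lemma Eideal_span:
  assumes "p \<in> Eideal n"
  shows "p \<in> qv.span (prodp n ` {x \<in> prod_index n. fst x \<noteq> {#}})" (is "_ \<in> qv.span ?N")
proof -
  obtain qs ss where qs: "set qs \<subseteq> QSym n" and ss: "\<forall>s \<in> set ss. s \<in> Sym n \<and> lk s 0 = 0"
    and p: "p = sum_list (map2 (*) qs ss)" using assms unfolding Eideal_def by blast
  have qs_span: "q * s \<in> qv.span ?N" if "q \<in> QSym n" "s \<in> Sym n" "lk s 0 = 0" for q s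
  proof (rule span_mult_right[OF QSym_span[OF that(1)]])
    fix x assume "x \<in> prodp n ` prod_index n"
    then obtain \<mu> \<beta> where x: "x = prodp n (\<mu>, \<beta>)" "(\<mu>, \<beta>) \<in> prod_index n" by auto
    have "s * x \<in> qv.span ?N"
    proof (rule span_mult_right[OF Sym_positive_span[OF that(2,3)]])
      fix y assume "y \<in> MS n ` {\<nu> \<in> partitions n. \<nu> \<noteq> {#}}"
      then obtain \<nu> where y: "y = MS n \<nu>" "\<nu> \<in> partitions n" "\<nu> \<noteq> {#}" by blast
      have "sum_mset \<nu> \<noteq> 0"
      proof
        assume "sum_mset \<nu> = 0"
        then have "\<forall>a\<in>#\<nu>. a = 0" by simp
        then show False using y(2,3) unfolding partitions_def by (metis (mono_tags, lifting) mem_Collect_eq multiset_nonemptyE)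
      qed
      then have "prodp n ` ({\<kappa> \<in> partitions n. sum_mset \<kappa> = sum_mset \<nu> + sum_mset \<mu>} \<times> {\<beta>}) \<subseteq> ?N"
        using x(2) by (intro image_mono) (auto simp: prod_index_iff)
      then show "y * x \<in> qv.span ?N" using MS_mult_prodp[OF x(2), of \<nu>] qv.span_mono unfolding x(1) y(1) by blast
    qed
    then show "x * s \<in> qv.span ?N" by (simp add: mult.commute)
  qed
  have "sum_list xs \<in> qv.span ?N" if "\<forall>x \<in> set xs. x \<in> qv.span ?N" for xs
    using that by (induction xs) (simp_all add: qv.span_zero qv.span_add)
  moreover have "\<forall>x \<in> set (map2 (*) qs ss). x \<in> qv.span ?N"
  proof
    fix x assume "x \<in> set (map2 (*) qs ss)"
    then obtain q s where x: "(q, s) \<in> set (zip qs ss)" "x = q * s" by auto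
    then show "x \<in> qv.span ?N" using qs_span qs ss set_zip_leftD[OF x(1)] set_zip_rightD[OF x(1)] by blast
  qed
  ultimately show ?thesis unfolding p by blast
qed

lemma qsSchur_prodp: "qsSchur n \<beta> = prodp n ({#}, \<beta>)"
  by (simp add: prodp_def MS_empty)

lemma empty_prod_index: "\<beta> \<in> Bset n \<longleftrightarrow> ({#}, \<beta>) \<in> prod_index n"
  by (simp add: prod_index_def)

theorem theorem4p1:
  fixes n :: nat
  assumes "1 \<le> n"
  shows "(\<forall>f \<in> QSym n. \<exists>c :: nat list \<Rightarrow> rat.
            finite {\<beta>. c \<beta> \<noteq> 0} \<and> {\<beta>. c \<beta> \<noteq> 0} \<subseteq> Bset n \<and>
            f - (\<Sum>\<beta> \<in> {\<beta>. c \<beta> \<noteq> 0}. scal (c \<beta>) (qsSchur n \<beta>)) \<in> Eideal n)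
       \<and> (\<forall>c :: nat list \<Rightarrow> rat.
            finite {\<beta>. c \<beta> \<noteq> 0} \<and> {\<beta>. c \<beta> \<noteq> 0} \<subseteq> Bset n \<and>
            (\<Sum>\<beta> \<in> {\<beta>. c \<beta> \<noteq> 0}. scal (c \<beta>) (qsSchur n \<beta>)) \<in> Eideal n
            \<longrightarrow> (\<forall>\<beta>. c \<beta> = 0))"
proof (intro conjI ballI allI impI; (elim conjE)?)
  have inj: "inj_on (qsSchur n) (Bset n)"
  proof (rule inj_onI)
    fix \<beta> \<gamma> assume "\<beta> \<in> Bset n" "\<gamma> \<in> Bset n" "qsSchur n \<beta> = qsSchur n \<gamma>"
    then have "({#}, \<beta>) = (({#}, \<gamma>) :: nat multiset \<times> nat list)"
      unfolding qsSchur_prodp empty_prod_index by (intro inj_onD[OF prodp_inj])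
    then show "\<beta> = \<gamma>" by simp
  qed
  fix f assume "f \<in> QSym n"
  then obtain s where s: "s \<in> qv.span (qsSchur n ` Bset n)" "f - s \<in> Eideal n" using QSym_mod_Eideal by blast
  obtain t r where t: "finite t" "t \<subseteq> qsSchur n ` Bset n" "s = (\<Sum>x\<in>t. scal (r x) x)"
    using s(1) unfolding qv.span_explicit by blast
  obtain J where J: "J \<subseteq> Bset n" "finite J" "t = qsSchur n ` J" using finite_subset_image[OF t(1,2)] by blast
  define c where "c \<beta> = (if \<beta> \<in> J then r (qsSchur n \<beta>) else 0)" for \<beta>
  have sub: "{\<beta>. c \<beta> \<noteq> 0} \<subseteq> J" by (auto simp: c_def)
  have "s = (\<Sum>\<beta>\<in>J. scal (c \<beta>) (qsSchur n \<beta>))"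
    unfolding t(3) J(3) by (subst sum.reindex[OF inj_on_subset[OF inj J(1)]]) (simp add: c_def)
  also have "\<dots> = (\<Sum>\<beta> \<in> {\<beta>. c \<beta> \<noteq> 0}. scal (c \<beta>) (qsSchur n \<beta>))"
    by (rule sum.mono_neutral_right[OF J(2) sub]) simp
  finally have "f - (\<Sum>\<beta> \<in> {\<beta>. c \<beta> \<noteq> 0}. scal (c \<beta>) (qsSchur n \<beta>)) \<in> Eideal n" using s(2) by simp
  then show "\<exists>c :: nat list \<Rightarrow> rat. finite {\<beta>. c \<beta> \<noteq> 0} \<and> {\<beta>. c \<beta> \<noteq> 0} \<subseteq> Bset n \<and>
      f - (\<Sum>\<beta> \<in> {\<beta>. c \<beta> \<noteq> 0}. scal (c \<beta>) (qsSchur n \<beta>)) \<in> Eideal n"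
    using finite_subset[OF sub J(2)] order_trans[OF sub J(1)] by blast
next
  fix c :: "nat list \<Rightarrow> rat" and \<beta>
  let ?S = "{\<beta>. c \<beta> \<noteq> 0}"
  assume fin: "finite ?S" and B: "?S \<subseteq> Bset n"
    and E: "(\<Sum>\<beta> \<in> ?S. scal (c \<beta>) (qsSchur n \<beta>)) \<in> Eideal n"
  show "c \<beta> = 0"
  proof (rule ccontr)
    assume c: "c \<beta> \<noteq> 0"
    \<comment> \<open>All products except the one for \<open>({#}, \<beta>)\<close>. The given
      element of the ideal and the remaining terms of the combination lie in their span, so solving
      for \<open>qsSchur n \<beta>\<close> contradicts independence.\<close>
    let ?V = "prodp n ` prod_index n - {qsSchur n \<beta>}"
    have \<beta>: "({#}, \<beta>) \<in> prod_index n" using c B empty_prod_index by blast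
    have V: "prodp n x \<in> ?V" if "x \<in> prod_index n" "x \<noteq> ({#}, \<beta>)" for x
      using that inj_onD[OF prodp_inj _ that(1) \<beta>] unfolding qsSchur_prodp by blast
    have "prodp n ` {x \<in> prod_index n. fst x \<noteq> {#}} \<subseteq> ?V" using V by auto
    then have 1: "(\<Sum>\<beta> \<in> ?S. scal (c \<beta>) (qsSchur n \<beta>)) \<in> qv.span ?V"
      using Eideal_span[OF E] qv.span_mono by blast
    have 2: "(\<Sum>\<gamma> \<in> ?S - {\<beta>}. scal (c \<gamma>) (qsSchur n \<gamma>)) \<in> qv.span ?V"
    proof (intro qv.span_sum qv.span_scale qv.span_base)
      fix \<gamma> assume "\<gamma> \<in> ?S - {\<beta>}"
      then have "({#}, \<gamma>) \<in> prod_index n" "({#}, \<gamma>) \<noteq> (({#}, \<beta>) :: nat multiset \<times> nat list)"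
        using B empty_prod_index by auto
      then show "qsSchur n \<gamma> \<in> ?V" unfolding qsSchur_prodp[of n \<gamma>] by (rule V)
    qed
    have "scal (c \<beta>) (qsSchur n \<beta>) = (\<Sum>\<beta> \<in> ?S. scal (c \<beta>) (qsSchur n \<beta>)) - (\<Sum>\<gamma> \<in> ?S - {\<beta>}. scal (c \<gamma>) (qsSchur n \<gamma>))"
      by (subst sum.remove[OF fin, of \<beta>]) (use c in simp_all)
    then have "scal (c \<beta>) (qsSchur n \<beta>) \<in> qv.span ?V" using qv.span_diff[OF 1 2] by simp
    then have "scal (inverse (c \<beta>)) (scal (c \<beta>) (qsSchur n \<beta>)) \<in> qv.span ?V" by (rule qv.span_scale)
    then have "qsSchur n \<beta> \<in> qv.span ?V" using c by simp
    moreover have "qsSchur n \<beta> \<in> prodp n ` prod_index n" using \<beta> unfolding qsSchur_prodp by blast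
    ultimately show False using prodp_independent unfolding qv.dependent_def by blast
  qed
qed

end
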